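(* Let $V:\mathcal X\to\mathbb R_+$ be continuous and let $\mathfrak F=\{f\in B(\mathcal X):|f(x)|\le1+V(x)\ \forall x\}$ satisfy Hypothesis $(\mathbf{H_2})$. Then the following are equivalent: (i) $\Phi$ admits a unique invariant probability measure $\mu$ with $\mathfrak F\subset L^1(\mu)$ and $\lim_{t\to\infty}d_V(Q_t(x,\cdot),\mu)=0$ for all $x\in\mathcal X$; (ii) $\Phi$ is uniformly Cesàro eventually continuous with respect to $\mathfrak F$ on $\mathcal X$, and there exists $z\in\mathcal X$ such that $\Phi$ satisfies $(\mathcal C_2)$ at $z$; (iii) there exists $z\in\mathcal X$ such that $\Phi$ is uniformly Cesàro eventually continuous with respect to $\mathfrak F$ at $z$ and satisfies $(\mathcal C_2)$ at $z$.
   Context: Standing setting: $(\mathcal{X},\rho)$ is a Polish space; $\Phi=\{\Phi_t\}_{t\ge0}$ is a càdlàg Feller Markov process on $\mathcal{X}$ (hence strong Markov) with laws $\mathbb{P}^x$ and transition kernels $P_t(x,\cdot)$. $B(\mathcal X)$: Borel real functions; $B(z,r)$: open ball. $\mathcal{A}=\{f\in B(\mathcal{X}):\int|f|\,dP_t(x,\cdot)<\infty\ \forall x,t\}$; for $f\in\mathcal A$, $P_tf(x)=\int f\,dP_t(x,\cdot)$, $Q_tf(x)=\frac1t\int_0^tP_sf(x)ds$; $Q_t(x,\cdot)=\frac1t\int_0^tP_s(x,\cdot)ds$. For probability measures $\mu,\nu$ with $\int V d\mu,\int Vd\nu<\infty$, $d_V(\mu,\nu)=\inf_\pi\int_{\{x\neq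 y\}}(2+V(x)+V(y))\pi(dx,dy)$, the infimum over couplings $\pi$ of $\mu$ and $\nu$. $(\mathcal C_2)$ at $z$: for every $r>0$, $\inf_{x\in\mathcal X}\limsup_{t\to\infty}Q_t(x,B(z,r))>0$. $\Phi$ is uniformly Cesàro eventually continuous with respect to $\mathfrak F$ at $x$ if $\limsup_{x'\to x}\limsup_{t\to\infty}\sup_{f\in\mathfrak F}|Q_tf(x')-Q_tf(x)|=0$; "on $\mathcal X$" means at every point. Uniform integrability of $\{\xi_t\}$: $\lim_{K\to\infty}\sup_t\mathbb E(|\xi_t|\chi_{\{|\xi_t|\ge K\}})=0$. Hypothesis $(\mathbf{H_2})$: there is $\tilde V\in\mathcal A$ with $|f|\le\tilde V$ for all $f\in\mathfrak F$, such that $\{\tilde V(\Phi_t)\}_{t\ge0}$ is uniformly integrable under every $\mathbb P^x$. *)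

theory Defs
  imports "HOL-Probability.Probability"
begin

definition kernel :: "('a \<Rightarrow> 'w measure) \<Rightarrow> (real \<Rightarrow> 'w \<Rightarrow> 'a::topological_space)
    \<Rightarrow> real \<Rightarrow> 'a \<Rightarrow> 'a measure" where
  "kernel Pr Phi t x = distr (Pr x) borel (Phi t)"

definition natural_filtration :: "'w measure \<Rightarrow> (real \<Rightarrow> 'w \<Rightarrow> 'a::topological_space)
    \<Rightarrow> real \<Rightarrow> 'w set set" where
  "natural_filtration M Phi s =
     sigma_sets (space M) {Phi r -` B \<inter> space M | r B. 0 \<le> r \<and> r \<le> s \<and> B \<in> sets borel}"

text \<open>Cadlag Feller Markov process (strong Markov property follows from
Feller + right-continuous paths, hence is not imposed separately).\<close>
definition cadlag_feller_markov ::
  "'w measure \<Rightarrow> ('a::polish_space \<Rightarrow> 'w measure) \<Rightarrow> (real \<Rightarrow> 'w \<Rightarrow> 'a) \<Rightarrow> bool" where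
  "cadlag_feller_markov M Pr Phi \<longleftrightarrow>
     (\<forall>x. prob_space (Pr x) \<and> sets (Pr x) = sets M) \<and>
     (\<forall>t\<ge>0. Phi t \<in> measurable M borel) \<and>
     (\<forall>x. AE \<omega> in Pr x. Phi 0 \<omega> = x) \<and>
     (\<forall>E\<in>sets M. (\<lambda>x. emeasure (Pr x) E) \<in> borel_measurable borel) \<and>
     (\<forall>\<omega>\<in>space M. \<forall>t\<ge>0. continuous (at_right t) (\<lambda>s. Phi s \<omega>) \<and>
        (t > 0 \<longrightarrow> (\<exists>l. ((\<lambda>s. Phi s \<omega>) \<longlongrightarrow> l) (at_left t)))) \<and>
     (\<forall>x s t A E. 0 \<le> s \<longrightarrow> 0 \<le> t \<longrightarrow> A \<in> sets borel \<longrightarrow>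
        E \<in> natural_filtration M Phi s \<longrightarrow>
        emeasure (Pr x) (E \<inter> Phi (s + t) -` A) =
          (\<integral>\<^sup>+ \<omega>. indicator E \<omega> * emeasure (kernel Pr Phi t (Phi s \<omega>)) A \<partial>Pr x)) \<and>
     (\<forall>t\<ge>0. \<forall>f::'a \<Rightarrow> real. continuous_on UNIV f \<and> bounded (range f) \<longrightarrow>
        continuous_on UNIV (\<lambda>x. \<integral>y. f y \<partial>kernel Pr Phi t x))"

definition Pt :: "('a \<Rightarrow> 'w measure) \<Rightarrow> (real \<Rightarrow> 'w \<Rightarrow> 'a::topological_space)
    \<Rightarrow> real \<Rightarrow> ('a \<Rightarrow> real) \<Rightarrow> 'a \<Rightarrow> real" where
  "Pt Pr Phi t f x = (\<integral>y. f y \<partial>kernel Pr Phi t x)"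

definition Qt :: "('a \<Rightarrow> 'w measure) \<Rightarrow> (real \<Rightarrow> 'w \<Rightarrow> 'a::topological_space)
    \<Rightarrow> real \<Rightarrow> ('a \<Rightarrow> real) \<Rightarrow> 'a \<Rightarrow> real" where
  "Qt Pr Phi t f x = (1 / t) * (LBINT s=0..t. Pt Pr Phi s f x)"

definition Qset :: "('a \<Rightarrow> 'w measure) \<Rightarrow> (real \<Rightarrow> 'w \<Rightarrow> 'a::topological_space)
    \<Rightarrow> real \<Rightarrow> 'a \<Rightarrow> 'a set \<Rightarrow> real" where
  "Qset Pr Phi t x B = (1 / t) * (LBINT s=0..t. measure (kernel Pr Phi s x) B)"

definition Qmeasure :: "('a \<Rightarrow> 'w measure) \<Rightarrow> (real \<Rightarrow> 'w \<Rightarrow> 'a::topological_space)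
    \<Rightarrow> real \<Rightarrow> 'a \<Rightarrow> 'a measure" where
  "Qmeasure Pr Phi t x = measure_of UNIV (sets borel) (\<lambda>B. ennreal (Qset Pr Phi t x B))"

definition classA :: "('a \<Rightarrow> 'w measure) \<Rightarrow> (real \<Rightarrow> 'w \<Rightarrow> 'a::topological_space)
    \<Rightarrow> ('a \<Rightarrow> real) set" where
  "classA Pr Phi = {f. f \<in> borel_measurable borel \<and>
      (\<forall>x. \<forall>t\<ge>0. integrable (kernel Pr Phi t x) f)}"

definition Ffam :: "('a::topological_space \<Rightarrow> real) \<Rightarrow> ('a \<Rightarrow> real) set" where
  "Ffam V = {f. f \<in> borel_measurable borel \<and> (\<forall>x. \<bar>f x\<bar> \<le> 1 + V x)}"

definition unif_integrable_along ::
  "('a \<Rightarrow> 'w measure) \<Rightarrow> (real \<Rightarrow> 'w \<Rightarrow> 'a) \<Rightarrow> ('a \<Rightarrow> real) \<Rightarrow> 'a \<Rightarrow> bool" where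
  "unif_integrable_along Pr Phi g x \<longleftrightarrow>
     ((\<lambda>K::real. SUP t\<in>{0..}. \<integral>\<^sup>+ \<omega>. ennreal \<bar>g (Phi t \<omega>)\<bar> *
         indicator {\<omega>. \<bar>g (Phi t \<omega>)\<bar> \<ge> K} \<omega> \<partial>Pr x) \<longlongrightarrow> 0) at_top"

definition H2 :: "('a \<Rightarrow> 'w measure) \<Rightarrow> (real \<Rightarrow> 'w \<Rightarrow> 'a::topological_space)
    \<Rightarrow> ('a \<Rightarrow> real) set \<Rightarrow> bool" where
  "H2 Pr Phi F \<longleftrightarrow> (\<exists>Vt \<in> classA Pr Phi. (\<forall>f\<in>F. \<forall>x. \<bar>f x\<bar> \<le> Vt x) \<and>
      (\<forall>x. unif_integrable_along Pr Phi Vt x))"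

definition invariant_prob :: "('a \<Rightarrow> 'w measure) \<Rightarrow> (real \<Rightarrow> 'w \<Rightarrow> 'a::topological_space)
    \<Rightarrow> 'a measure \<Rightarrow> bool" where
  "invariant_prob Pr Phi \<mu> \<longleftrightarrow> prob_space \<mu> \<and> sets \<mu> = sets borel \<and>
     (\<forall>t\<ge>0. \<forall>B\<in>sets borel.
        (\<integral>\<^sup>+ x. emeasure (kernel Pr Phi t x) B \<partial>\<mu>) = emeasure \<mu> B)"

definition couplings :: "'a::topological_space measure \<Rightarrow> 'a measure \<Rightarrow> ('a \<times> 'a) measure set" where
  "couplings \<mu> \<nu> = {\<pi>. prob_space \<pi> \<and> sets \<pi> = sets (borel \<Otimes>\<^sub>M borel) \<and>
      distr \<pi> borel fst = \<mu> \<and> distr \<pi> borel snd = \<nu>}"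

definition dV :: "('a::topological_space \<Rightarrow> real) \<Rightarrow> 'a measure \<Rightarrow> 'a measure \<Rightarrow> ennreal" where
  "dV V \<mu> \<nu> = (INF \<pi>\<in>couplings \<mu> \<nu>.
      \<integral>\<^sup>+ p. indicator {p. fst p \<noteq> snd p} p * ennreal (2 + V (fst p) + V (snd p)) \<partial>\<pi>)"

text \<open>Uniform Cesaro eventual continuity w.r.t. F at x.  The outer limsup is
taken over nhds x (x' = x contributes 0, so this equals the punctured limsup
whenever x is not isolated, and is 0 otherwise).\<close>
definition unif_cesaro_ev_cont :: "('a \<Rightarrow> 'w measure) \<Rightarrow> (real \<Rightarrow> 'w \<Rightarrow> 'a::topological_space)
    \<Rightarrow> ('a \<Rightarrow> real) set \<Rightarrow> 'a \<Rightarrow> bool" where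
  "unif_cesaro_ev_cont Pr Phi F x \<longleftrightarrow>
     Limsup (nhds x) (\<lambda>x'. Limsup at_top (\<lambda>t. SUP f\<in>F.
        ereal \<bar>Qt Pr Phi t f x' - Qt Pr Phi t f x\<bar>)) = 0"

definition C2 :: "('a \<Rightarrow> 'w measure) \<Rightarrow> (real \<Rightarrow> 'w \<Rightarrow> 'a::metric_space) \<Rightarrow> 'a \<Rightarrow> bool" where
  "C2 Pr Phi z \<longleftrightarrow> (\<forall>r>0. (INF x. Limsup at_top (\<lambda>t. ereal (Qset Pr Phi t x (ball z r)))) > 0)"

end

theory Submission
  imports Defs
begin

text \<open>
  The weight \<open>V\<close> is controlled by uniform integrability, so everything reduces to total variation. For
  times \<open>t\<^sub>n \<rightarrow> \<infinity>\<close> and test functions \<open>0 \<le> f\<^sub>n \<le> 1\<close> the function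
  \<open>limsup\<^sub>n |Q\<^sub>t\<^sub>n f\<^sub>n(y) - Q\<^sub>t\<^sub>n f\<^sub>n(z)|\<close> of \<open>y\<close> is subharmonic, is small near \<open>z\<close>, and balls around \<open>z\<close>
  are charged uniformly from every starting point; so it vanishes, and all \<open>Q\<^sub>t(x)\<close> merge in total
  variation. An invariant probability is the countably additive part of a finitely additive cluster
  point of \<open>Q\<^sub>t(z)\<close>: this part is nonzero because, by the Feller property and Baire's theorem, the
  merging is uniform in time near some point to which \<open>Q\<^sub>t(z)\<close> keeps giving mass. Merging then forces
  \<open>Q\<^sub>t(x)\<close> to converge to it, and a Hahn-decomposition coupling turns total variation plus small tails
  into smallness of \<open>d\<^sub>V\<close>.
\<close>

subsection \<open>Kernels and Cesaro means\<close>

text \<open>No compactness of the measures Q_t(z) is available beforehand, so the limit is taken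
  where compactness is free, among functionals on all [0,1]-valued Borel functions; the price is
  countable additivity. Passing to the countably additive part keeps invariance: its image under P_u
  is again a countably additive minorant of the limit with the same mass. What must be excluded is
  that all mass escapes from this part.

  Pointwise merging does not exclude it, since the time after which Q_t(y) is close to Q_t(z)
  depends on y. One needs a single time T and a set of points y, charged by Q_t(z) at arbitrarily
  large t, on which Q_T(y) stays close to the one countably additive measure Q_T(z). Any gap below 1
  would do; 1/2 is used.

  That (i) implies (ii) is a separate short argument: |f| <= 1 + V gives |f(x) - f(y)| <= 2 + V(x) +
  V(y), so d_V bounds the differences of integrals for the whole family at once, and the lower bound
  in (C_2) is read off at a support point of \<mu>.\<close>

lemma integral_bind_integrable:
  fixes f :: "'b \<Rightarrow> real"
  assumes N[measurable]: "N \<in> M \<rightarrow>\<^sub>M subprob_algebra B" and f[measurable]: "f \<in> borel_measurable B"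
    and ne: "space M \<noteq> {}" and int: "integrable (M \<bind> N) f"
  shows "integral\<^sup>L (M \<bind> N) f = (\<integral>x. integral\<^sup>L (N x) f \<partial>M)"
proof -
  have sB: "sets (M \<bind> N) = sets B"
    using sets_bind[OF sets_kernel[OF N] ne] by simp
  have setsN: "sets (N x) = sets B" if "x \<in> space M" for x
    using sets_kernel[OF N that] .
  \<comment> \<open>The two signs are integrated separately in \<open>ennreal\<close>, where
    integration over the mixture needs no integrability. Only \<open>M\<close>-almost every
    \<open>x\<close> has both parts finite, hence the passage through \<open>enn2real\<close>.
    Unbounded \<open>f\<close> must be covered because of \<open>Ffam V\<close>.\<close>
  define p where "p x = (\<integral>\<^sup>+y. ennreal (f y) \<partial>N x)" for x
  define q where "q x = (\<integral>\<^sup>+y. ennreal (- f y) \<partial>N x)" for x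
  have pq[measurable]: "p \<in> borel_measurable M" "q \<in> borel_measurable M"
    unfolding p_def q_def
    by (rule measurable_compose[OF N nn_integral_measurable_subprob_algebra], measurable)+
  have P: "(\<integral>\<^sup>+y. ennreal (f y) \<partial>(M \<bind> N)) = (\<integral>\<^sup>+x. p x \<partial>M)"
    unfolding p_def by (rule nn_integral_bind[OF _ N]) simp
  have Q: "(\<integral>\<^sup>+y. ennreal (- f y) \<partial>(M \<bind> N)) = (\<integral>\<^sup>+x. q x \<partial>M)"
    unfolding q_def by (rule nn_integral_bind[OF _ N]) simp
  have fin: "(\<integral>\<^sup>+x. p x \<partial>M) \<noteq> \<infinity>" "(\<integral>\<^sup>+x. q x \<partial>M) \<noteq> \<infinity>"
    using int P Q unfolding real_integrable_def by auto
  have AEp: "AE x in M. p x \<noteq> \<infinity>" and AEq: "AE x in M. q x \<noteq> \<infinity>"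
    using nn_integral_PInf_AE[OF pq(1) fin(1)] nn_integral_PInf_AE[OF pq(2) fin(2)] by auto
  have ip: "(\<integral>\<^sup>+x. ennreal (enn2real (p x)) \<partial>M) = (\<integral>\<^sup>+x. p x \<partial>M)"
    using AEp by (intro nn_integral_cong_AE) (auto simp: less_top)
  have iq: "(\<integral>\<^sup>+x. ennreal (enn2real (q x)) \<partial>M) = (\<integral>\<^sup>+x. q x \<partial>M)"
    using AEq by (intro nn_integral_cong_AE) (auto simp: less_top)
  have intp: "integrable M (\<lambda>x. enn2real (p x))" and intq: "integrable M (\<lambda>x. enn2real (q x))"
    using fin ip iq by (auto intro!: integrableI_nonneg simp: less_top)
  have "integral\<^sup>L (M \<bind> N) f = enn2real (\<integral>\<^sup>+x. p x \<partial>M) - enn2real (\<integral>\<^sup>+x. q x \<partial>M)"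
    using real_lebesgue_integral_def[OF int] P Q by simp
  also have "\<dots> = (\<integral>x. enn2real (p x) \<partial>M) - (\<integral>x. enn2real (q x) \<partial>M)"
    by (subst (1 2) integral_eq_nn_integral) (auto simp: ip iq)
  also have "\<dots> = (\<integral>x. enn2real (p x) - enn2real (q x) \<partial>M)"
    using intp intq by simp
  also have "\<dots> = (\<integral>x. integral\<^sup>L (N x) f \<partial>M)"
  proof (rule integral_cong_AE)
    show "(\<lambda>x. integral\<^sup>L (N x) f) \<in> borel_measurable M"
      by (rule measurable_compose[OF N integral_measurable_subprob_algebra]) simp
    show "AE x in M. enn2real (p x) - enn2real (q x) = integral\<^sup>L (N x) f"
      using AEp AEq AE_space
    proof eventually_elim
      case (elim x)
      have "f \<in> borel_measurable (N x)"
        using setsN[OF elim(3)] by (simp cong: measurable_cong_sets)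
      then have "integrable (N x) f"
        using elim by (simp add: real_integrable_def p_def q_def)
      then show ?case
        by (simp add: real_lebesgue_integral_def p_def q_def)
    qed
  qed simp
  finally show ?thesis .
qed

text \<open>Indicators alone would determine total variation, but the operators P_t and Q_t do not
  preserve them; they do preserve this class.\<close>

definition unit_fun :: "('a::topological_space \<Rightarrow> real) set" where
  "unit_fun = {f. f \<in> borel_measurable borel \<and> (\<forall>x. 0 \<le> f x \<and> f x \<le> 1)}"

lemma unit_funD:
  assumes "f \<in> unit_fun"
  shows "f \<in> borel_measurable borel" "0 \<le> f x" "f x \<le> 1"
  using assms by (auto simp: unit_fun_def)

lemma indicator_unit_fun: "A \<in> sets borel \<Longrightarrow> indicator A \<in> unit_fun"
  by (auto simp: unit_fun_def indicator_def)

lemma unit_fun_integrable: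
  assumes "f \<in> unit_fun" "prob_space M" "sets M = sets borel"
  shows "integrable M f"
proof -
  interpret prob_space M by fact
  show ?thesis
    using unit_funD[OF assms(1)] assms(3)
    by (intro integrable_const_bound[where B=1]) (auto cong: measurable_cong_sets)
qed

lemma unit_fun_integral_bounds:
  assumes f: "f \<in> unit_fun" and "prob_space M" "sets M = sets borel"
  shows "0 \<le> integral\<^sup>L M f" "integral\<^sup>L M f \<le> 1"
proof -
  interpret prob_space M by fact
  show "0 \<le> integral\<^sup>L M f"
    using unit_funD[OF f] by (intro Bochner_Integration.integral_nonneg) auto
  show "integral\<^sup>L M f \<le> 1"
    using integral_mono[OF unit_fun_integrable[OF assms] integrable_const[of 1]] unit_funD[OF f]
    by (simp add: prob_space)
qed

section \<open>Averaging over a uniformly distributed time\<close>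

definition unif_time :: "real \<Rightarrow> real measure" where
  "unif_time t = uniform_measure lborel {0<..<t}"

lemma unif_time_simps [simp]:
  "space (unif_time t) = UNIV" "sets (unif_time t) = sets borel"
  by (auto simp: unif_time_def)

lemma sets_unif_time_cong [measurable_cong]: "sets (unif_time t) = sets borel"
  by simp

lemma prob_space_unif_time: "0 < t \<Longrightarrow> prob_space (unif_time t)"
  unfolding unif_time_def by (intro prob_space_uniform_measure) auto

lemma AE_unif_time: "0 < t \<Longrightarrow> AE s in unif_time t. 0 < s \<and> s < t"
  unfolding unif_time_def by (intro AE_uniform_measureI) auto

lemma integral_unif_time:
  fixes F :: "real \<Rightarrow> real"
  assumes t: "0 < t" and F[measurable]: "F \<in> borel_measurable borel"
  shows "(\<integral>s. F s \<partial>unif_time t) = (1 / t) * (LBINT s:{0<..<t}. F s)"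
proof -
  have d: "unif_time t = density lborel (\<lambda>s. ennreal (indicator {0<..<t} s / t))"
    unfolding unif_time_def uniform_measure_def using t
    by (intro density_cong) (auto simp: divide_ennreal[symmetric] indicator_def)
  have "(\<integral>s. F s \<partial>unif_time t) = (\<integral>s. (indicator {0<..<t} s / t) * F s \<partial>lborel)"
    unfolding d using t by (subst integral_density) (auto simp: indicator_def)
  also have "\<dots> = (\<integral>s. (1 / t) * (indicator {0<..<t} s * F s) \<partial>lborel)"
    by (intro Bochner_Integration.integral_cong) auto
  also have "\<dots> = (1 / t) * (LBINT s:{0<..<t}. F s)"
    by (simp add: set_lebesgue_integral_def)
  finally show ?thesis .
qed

text \<open>The windows (u, t + u) and (0, t) differ by two pieces of length at most u, which enter
  with opposite signs. As \<open>F\<close> takes values in [0, 1], each sign alone contributes at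
  most u, so the difference of the integrals is bounded by u and not 2 * u.\<close>

lemma integral_unif_time_shift:
  fixes F :: "real \<Rightarrow> real"
  assumes t: "0 < t" and u: "0 \<le> u" and F[measurable]: "F \<in> borel_measurable borel"
    and F01: "\<And>s. 0 \<le> F s \<and> F s \<le> 1"
  shows "\<bar>(\<integral>s. F (u + s) \<partial>unif_time t) - (\<integral>s. F s \<partial>unif_time t)\<bar> \<le> u / t"
proof -
  have intF: "integrable lborel (\<lambda>s. indicator {a<..<b} s * F s)" for a b :: real
  proof (rule Bochner_Integration.integrable_bound[of _ "indicator {a<..<b} :: real \<Rightarrow> real"])
    show "integrable lborel (indicator {a<..<b} :: real \<Rightarrow> real)"
      by (cases "a \<le> b") auto
  qed (use F01 in \<open>auto simp: indicator_def abs_le_iff intro: order_trans[of _ 0]\<close>)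
  have "(LBINT s:{0<..<t}. F (u + s)) = (\<integral>s. indicator {u<..<t+u} (u + 1 * s) * F (u + 1 * s) \<partial>lborel)"
    unfolding set_lebesgue_integral_def
    by (intro Bochner_Integration.integral_cong) (auto simp: indicator_def)
  also have "\<dots> = (\<integral>s. indicator {u<..<t+u} s * F s \<partial>lborel)"
    using lborel_integral_real_affine[of 1 "\<lambda>s. indicator {u<..<t+u} s * F s" u] by simp
  finally have e: "(LBINT s:{0<..<t}. F (u + s)) = (\<integral>s. indicator {u<..<t+u} s * F s \<partial>lborel)" .
  have e2: "(LBINT s:{0<..<t}. F s) = (\<integral>s. indicator {0<..<t} s * F s \<partial>lborel)"
    by (simp add: set_lebesgue_integral_def)
  define D where "D = (\<integral>s. indicator {u<..<t+u} s * F s \<partial>lborel) - (\<integral>s. indicator {0<..<t} s * F s \<partial>lborel)"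
  have D: "D = (\<integral>s. indicator {u<..<t+u} s * F s - indicator {0<..<t} s * F s \<partial>lborel)"
    unfolding D_def using intF[of u "t+u"] intF[of 0 t] by simp
  have iI: "integrable lborel (indicator {a..b} :: real \<Rightarrow> real)" for a b :: real
    by (cases "a \<le> b") auto
  have "D \<le> (\<integral>s. indicator {t..t+u} s \<partial>lborel)"
    unfolding D using intF[of u "t+u"] intF[of 0 t] iI
    by (intro integral_mono Bochner_Integration.integrable_diff iI) (use u F01 in \<open>auto simp: indicator_def\<close>)
  also have "\<dots> = u" using u by simp
  finally have D1: "D \<le> u" .
  have "- u = (\<integral>s. - indicator {0..u} s \<partial>lborel)" using u by simp
  also have "\<dots> \<le> D"
    unfolding D using intF[of u "t+u"] intF[of 0 t] iI
    by (intro integral_mono Bochner_Integration.integrable_diff Bochner_Integration.integrable_minus iI)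
       (use u F01 in \<open>auto simp: indicator_def split: if_splits\<close>)
  finally have D2: "- u \<le> D" .
  have "(\<integral>s. F (u + s) \<partial>unif_time t) - (\<integral>s. F s \<partial>unif_time t) = D / t"
    using t by (subst (1 2) integral_unif_time) (auto simp: D_def e e2 diff_divide_distrib)
  then show ?thesis
    using D1 D2 t by (simp add: abs_le_iff field_simps)
qed

text \<open>Time ranges over all reals so that kernels can be mixed over a distribution on the real
  line; the semigroup law is asked for nonnegative times. The process enters later as
  \<open>kernel Pr Phi (max 0 s) x\<close>, whose values at negative \<open>s\<close> are immaterial
  because \<open>unif_time t\<close> lives on (0, t).\<close>

locale markov_semigroup =
  fixes K :: "real \<Rightarrow> 'a::polish_space \<Rightarrow> 'a measure"
  assumes K_measurable: "(\<lambda>(s, x). K s x) \<in> borel \<Otimes>\<^sub>M borel \<rightarrow>\<^sub>M subprob_algebra borel"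
    and prob_K: "prob_space (K s x)"
    and K_add: "0 \<le> s \<Longrightarrow> 0 \<le> t \<Longrightarrow> K (s + t) x = K s x \<bind> K t"
begin

lemma K_meas [measurable (raw)]:
  assumes "f \<in> M \<rightarrow>\<^sub>M borel" "g \<in> M \<rightarrow>\<^sub>M borel"
  shows "(\<lambda>w. K (f w) (g w)) \<in> M \<rightarrow>\<^sub>M subprob_algebra borel"
  using measurable_compose[OF measurable_Pair[OF assms] K_measurable] by simp

lemma K_meas2: "K t \<in> borel \<rightarrow>\<^sub>M subprob_algebra borel"
  by measurable

lemma sets_K [simp]: "sets (K s x) = sets borel"
  using sets_kernel[OF K_meas2] by simp

lemma space_K [simp]: "space (K s x) = UNIV"
  using sets_eq_imp_space_eq[OF sets_K[of s x]] by simp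

lemma sets_K_cong [measurable_cong]: "sets (K s x) = sets borel"
  by simp

text \<open>The measure Q_t(x, .) as a mixture of kernels over a random time, so that integrals
  against it are iterated integrals. It is meaningful for positive \<open>t\<close>.\<close>

definition cesaro :: "real \<Rightarrow> 'a \<Rightarrow> 'a measure" where
  "cesaro t x = unif_time t \<bind> (\<lambda>s. K s x)"

lemma sets_cesaro [simp]: "sets (cesaro t x) = sets borel"
  unfolding cesaro_def by (rule sets_bind) auto

lemma space_cesaro [simp]: "space (cesaro t x) = UNIV"
  using sets_eq_imp_space_eq[OF sets_cesaro[of t x]] by simp

lemma sets_cesaro_cong [measurable_cong]: "sets (cesaro t x) = sets borel"
  by simp

lemma prob_space_cesaro: "0 < t \<Longrightarrow> prob_space (cesaro t x)"
  unfolding cesaro_def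
  by (rule prob_space.prob_space_bind[OF prob_space_unif_time, of _ _ borel]) (auto simp: prob_K)

lemma cesaro_measurable: "0 < t \<Longrightarrow> cesaro t \<in> borel \<rightarrow>\<^sub>M subprob_algebra borel"
proof -
  assume t: "0 < t"
  interpret U: prob_space "unif_time t" using t by (rule prob_space_unif_time)
  have "unif_time t \<in> space (subprob_algebra borel)"
    by (simp add: space_subprob_algebra U.subprob_space_axioms)
  then have "(\<lambda>x. unif_time t \<bind> (\<lambda>s. K s x)) \<in> borel \<rightarrow>\<^sub>M subprob_algebra borel"
    by (intro measurable_bind[where N=borel] measurable_const) measurable
  then show ?thesis unfolding cesaro_def[abs_def] .
qed

lemma K_unit_fun: "f \<in> unit_fun \<Longrightarrow> (\<lambda>y. integral\<^sup>L (K u y) f) \<in> unit_fun"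
  using unit_fun_integral_bounds[OF _ prob_K sets_K]
    measurable_compose[OF K_meas2 integral_measurable_subprob_algebra] unit_funD(1)
  by (auto simp: unit_fun_def)

lemma cesaro_unit_fun: "f \<in> unit_fun \<Longrightarrow> 0 < t \<Longrightarrow> (\<lambda>y. integral\<^sup>L (cesaro t y) f) \<in> unit_fun"
  using unit_fun_integral_bounds[OF _ prob_space_cesaro sets_cesaro]
    measurable_compose[OF cesaro_measurable integral_measurable_subprob_algebra] unit_funD(1)
  by (auto simp: unit_fun_def)

lemma integral_cesaro:
  fixes f :: "'a \<Rightarrow> real"
  assumes "f \<in> borel_measurable borel" "integrable (cesaro t x) f"
  shows "integral\<^sup>L (cesaro t x) f = (\<integral>s. integral\<^sup>L (K s x) f \<partial>unif_time t)"
proof -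
  have "(\<lambda>s. K s x) \<in> unif_time t \<rightarrow>\<^sub>M subprob_algebra borel" by measurable
  then show ?thesis
    using assms unfolding cesaro_def by (intro integral_bind_integrable[of _ _ borel]) auto
qed

lemma K_time_measurable:
  fixes f :: "'a \<Rightarrow> real"
  assumes [measurable]: "f \<in> borel_measurable borel"
  shows "(\<lambda>s. integral\<^sup>L (K s x) f) \<in> borel_measurable borel"
    and "(\<lambda>(s, y). integral\<^sup>L (K s y) f) \<in> borel_measurable (borel \<Otimes>\<^sub>M borel)"
proof -
  have "(\<lambda>s. K s x) \<in> borel \<rightarrow>\<^sub>M subprob_algebra borel" by measurable
  from measurable_compose[OF this integral_measurable_subprob_algebra[OF assms]]
  show "(\<lambda>s. integral\<^sup>L (K s x) f) \<in> borel_measurable borel" .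
  from measurable_compose[OF K_measurable integral_measurable_subprob_algebra[OF assms]]
  show "(\<lambda>(s, y). integral\<^sup>L (K s y) f) \<in> borel_measurable (borel \<Otimes>\<^sub>M borel)"
    by (simp add: split_def)
qed

lemma integral_K_add:
  assumes f: "f \<in> unit_fun" and "0 \<le> s" "0 \<le> u"
  shows "(\<integral>y. integral\<^sup>L (K u y) f \<partial>K s x) = integral\<^sup>L (K (s + u) x) f"
proof -
  have eq: "K (s + u) x = K s x \<bind> K u"
    using assms by (intro K_add) auto
  have "integrable (K (s + u) x) f"
    using f prob_K by (intro unit_fun_integrable) auto
  then show ?thesis
    unfolding eq using unit_funD(1)[OF f] K_meas2[of u]
    by (intro integral_bind_integrable[symmetric, of _ _ borel])
       (auto cong: measurable_cong_sets)
qed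

lemma Fubini_unif_time:
  assumes f: "f \<in> unit_fun" and t: "0 < t" and M: "prob_space M" "sets M = sets borel"
  shows "(\<integral>y. integral\<^sup>L (cesaro t y) f \<partial>M) = (\<integral>s. (\<integral>y. integral\<^sup>L (K s y) f \<partial>M) \<partial>unif_time t)"
proof -
  interpret U: prob_space "unif_time t" using t by (rule prob_space_unif_time)
  interpret M: prob_space M by fact
  interpret UM: pair_prob_space "unif_time t" M ..
  note [measurable] = K_time_measurable[OF unit_funD(1)[OF f]]
  note [measurable_cong] = M(2)
  have "(\<integral>y. integral\<^sup>L (cesaro t y) f \<partial>M) = (\<integral>y. (\<integral>s. integral\<^sup>L (K s y) f \<partial>unif_time t) \<partial>M)"
    using unit_funD(1)[OF f] unit_fun_integrable[OF f prob_space_cesaro[OF t] sets_cesaro]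
    by (simp add: integral_cesaro)
  also have "\<dots> = (\<integral>s. (\<integral>y. integral\<^sup>L (K s y) f \<partial>M) \<partial>unif_time t)"
  proof (rule UM.Fubini_integral)
    show "integrable (unif_time t \<Otimes>\<^sub>M M) (\<lambda>(s, y). integral\<^sup>L (K s y) f)"
      using unit_fun_integral_bounds[OF f prob_K sets_K]
      by (intro UM.P.integrable_const_bound[where B=1]) (auto simp: split_def abs_le_iff intro: order_trans[of _ 0])
  qed
  finally show ?thesis .
qed

text \<open>Running the process for time s before averaging only shifts the time window by s. Thus
  P_s Q_t f and Q_t f agree up to s / t, which makes Q_t f asymptotically harmonic.\<close>

lemma K_cesaro_close:
  assumes f: "f \<in> unit_fun" and t: "0 < t" and s: "0 \<le> s"
  shows "\<bar>(\<integral>y. integral\<^sup>L (cesaro t y) f \<partial>K s x) - integral\<^sup>L (cesaro t x) f\<bar> \<le> s / t"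
proof -
  note [measurable] = K_time_measurable[OF unit_funD(1)[OF f]]
  have "(\<integral>y. integral\<^sup>L (cesaro t y) f \<partial>K s x) = (\<integral>u. (\<integral>y. integral\<^sup>L (K u y) f \<partial>K s x) \<partial>unif_time t)"
    using f t prob_K by (intro Fubini_unif_time) auto
  also have "\<dots> = (\<integral>u. integral\<^sup>L (K (s + u) x) f \<partial>unif_time t)"
  proof (rule integral_cong_AE)
    show "(\<lambda>u. \<integral>y. integral\<^sup>L (K u y) f \<partial>K s x) \<in> borel_measurable (unif_time t)"
    proof -
      interpret prob_space "K s x" by (rule prob_K)
      show ?thesis by measurable
    qed
    show "AE u in unif_time t. (\<integral>y. integral\<^sup>L (K u y) f \<partial>K s x) = integral\<^sup>L (K (s + u) x) f"
      using AE_unif_time[OF t] by eventually_elim (use f s in \<open>simp add: integral_K_add\<close>)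
  qed measurable
  finally show ?thesis
    using integral_unif_time_shift[OF t s K_time_measurable(1)[OF unit_funD(1)[OF f]]]
      unit_fun_integral_bounds[OF f prob_K sets_K]
      integral_cesaro[OF unit_funD(1)[OF f] unit_fun_integrable[OF f prob_space_cesaro[OF t] sets_cesaro]]
    by simp
qed

text \<open>Here P_u acts on the test function instead of the starting point; the semigroup law
  produces the same shifted window. In this form the estimate makes limits of Q_t(x)
  invariant.\<close>

lemma cesaro_K_close:
  assumes f: "f \<in> unit_fun" and t: "0 < t" and u: "0 \<le> u"
  shows "\<bar>(\<integral>y. integral\<^sup>L (K u y) f \<partial>cesaro t x) - integral\<^sup>L (cesaro t x) f\<bar> \<le> u / t"
proof -
  note [measurable] = K_time_measurable[OF unit_funD(1)[OF f]]
  note g = K_unit_fun[OF f, of u]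
  have "(\<integral>y. integral\<^sup>L (K u y) f \<partial>cesaro t x) = (\<integral>s. (\<integral>y. integral\<^sup>L (K u y) f \<partial>K s x) \<partial>unif_time t)"
    using unit_fun_integrable[OF g prob_space_cesaro[OF t] sets_cesaro] unit_funD(1)[OF g]
    by (rule integral_cesaro[rotated])
  also have "\<dots> = (\<integral>s. integral\<^sup>L (K (u + s) x) f \<partial>unif_time t)"
  proof (rule integral_cong_AE)
    show "(\<lambda>s. \<integral>y. integral\<^sup>L (K u y) f \<partial>K s x) \<in> borel_measurable (unif_time t)"
      using K_time_measurable(1)[OF unit_funD(1)[OF g]] by simp
    show "AE s in unif_time t. (\<integral>y. integral\<^sup>L (K u y) f \<partial>K s x) = integral\<^sup>L (K (u + s) x) f"
      using AE_unif_time[OF t] by eventually_elim (use f u in \<open>simp add: integral_K_add add.commute\<close>)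
  qed measurable
  finally show ?thesis
    using integral_unif_time_shift[OF t u K_time_measurable(1)[OF unit_funD(1)[OF f]]]
      unit_fun_integral_bounds[OF f prob_K sets_K]
      integral_cesaro[OF unit_funD(1)[OF f] unit_fun_integrable[OF f prob_space_cesaro[OF t] sets_cesaro]]
    by simp
qed

text \<open>The previous estimate averaged over 0 < u < N. It allows Q_t(x), for large t, to be
  replaced by a mixture of the measures Q_N(y) at one fixed N.\<close>

lemma cesaro_cesaro_close:
  assumes f: "f \<in> unit_fun" and t: "0 < t" and N: "0 < N"
  shows "\<bar>(\<integral>y. integral\<^sup>L (cesaro N y) f \<partial>cesaro t x) - integral\<^sup>L (cesaro t x) f\<bar> \<le> N / t"
proof -
  interpret U: prob_space "unif_time N" using N by (rule prob_space_unif_time)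
  interpret C: prob_space "cesaro t x" using t by (rule prob_space_cesaro)
  note [measurable] = K_time_measurable[OF unit_funD(1)[OF f]]
  let ?g = "\<lambda>u. \<integral>y. integral\<^sup>L (K u y) f \<partial>cesaro t x"
  let ?c = "integral\<^sup>L (cesaro t x) f"
  have gm[measurable]: "?g \<in> borel_measurable borel" by measurable
  have g01: "0 \<le> ?g u" "?g u \<le> 1" for u
    using unit_fun_integral_bounds[OF K_unit_fun[OF f] prob_space_cesaro[OF t] sets_cesaro] by auto
  have intg: "integrable (unif_time N) ?g"
    using g01 by (intro U.integrable_const_bound[where B=1]) auto
  have eq: "(\<integral>y. integral\<^sup>L (cesaro N y) f \<partial>cesaro t x) = (\<integral>u. ?g u \<partial>unif_time N)"
    using f N prob_space_cesaro[OF t] by (intro Fubini_unif_time) auto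
  have AE: "AE u in unif_time N. \<bar>?g u - ?c\<bar> \<le> N / t"
    using AE_unif_time[OF N]
  proof eventually_elim
    case (elim u)
    then show ?case
      using cesaro_K_close[OF f t, of u x] t
      by (auto intro: order_trans simp: divide_right_mono)
  qed
  have "(\<integral>u. ?g u \<partial>unif_time N) - ?c = (\<integral>u. ?g u - ?c \<partial>unif_time N)"
    using intg U.prob_space by simp
  also have "\<bar>\<dots>\<bar> \<le> (\<integral>u. \<bar>?g u - ?c\<bar> \<partial>unif_time N)"
    by (rule integral_abs_bound)
  also have "\<dots> \<le> (\<integral>u. N / t \<partial>unif_time N)"
    using AE intg by (intro integral_mono_AE) auto
  also have "\<dots> = N / t" using U.prob_space by simp
  finally show ?thesis unfolding eq .
qed

end

subsection \<open>Merging of Cesaro means\<close>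

text \<open>A failure of the uniform statement produces times tending to infinity together with bad
  test functions, that is, a single sequence. Fatou and dominated convergence then apply although
  \<open>F\<close> may be uncountable and \<open>t\<close> is continuous.\<close>

lemma eventually_at_top_unif_of_seq:
  fixes H :: "real \<Rightarrow> 'b \<Rightarrow> real"
  assumes seq: "\<And>t f. filterlim t at_top sequentially \<Longrightarrow> (\<And>n. 0 < t n) \<Longrightarrow> (\<And>n. f n \<in> F) \<Longrightarrow>
      (\<lambda>n. H (t n) (f n)) \<longlonglongrightarrow> 0" and e: "0 < e"
  shows "eventually (\<lambda>t. \<forall>f\<in>F. \<bar>H t f\<bar> < e) at_top"
proof (rule ccontr)
  assume "\<not> ?thesis"
  then have "\<forall>N. \<exists>t\<ge>N. \<exists>f\<in>F. \<not> \<bar>H t f\<bar> < e"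
    unfolding eventually_at_top_linorder by blast
  \<comment> \<open>The summand 1 makes even the first time positive.\<close>
  then have "\<forall>n::nat. \<exists>t f. t \<ge> real n + 1 \<and> f \<in> F \<and> \<not> \<bar>H t f\<bar> < e"
    by meson
  then obtain t f where tf: "\<And>n::nat. t n \<ge> real n + 1 \<and> f n \<in> F \<and> \<not> \<bar>H (t n) (f n)\<bar> < e"
    by metis
  have "filterlim t at_top sequentially"
    by (rule filterlim_at_top_mono[OF filterlim_real_sequentially])
       (use tf in \<open>smt (verit) always_eventually\<close>)
  then have "(\<lambda>n. H (t n) (f n)) \<longlonglongrightarrow> 0"
  proof (rule seq)
    show "0 < t n" for n using tf[of n] by linarith
  qed (use tf in auto)
  then have "eventually (\<lambda>n. \<bar>H (t n) (f n)\<bar> < e) sequentially"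
    using e by (auto dest!: tendstoD[of _ _ _ e] simp: dist_real_def)
  then show False
    using tf by (auto simp: eventually_sequentially)
qed

context markov_semigroup
begin

abbreviation Qf :: "real \<Rightarrow> ('a \<Rightarrow> real) \<Rightarrow> 'a \<Rightarrow> real" where
  "Qf t f x \<equiv> integral\<^sup>L (cesaro t x) f"

text \<open>Up to normalisation this says that the total variation distance of Q_t(x) and Q_t(z)
  tends to 0, written with test functions to avoid signed measures.\<close>

definition merges :: "'a \<Rightarrow> 'a \<Rightarrow> bool" where
  "merges x z \<longleftrightarrow> (\<forall>e>0. eventually (\<lambda>t. \<forall>f\<in>unit_fun. \<bar>Qf t f x - Qf t f z\<bar> < e) at_top)"

lemma mergesD:
  assumes "merges x z" and t: "filterlim t at_top sequentially" and f: "\<And>n. f n \<in> unit_fun"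
  shows "(\<lambda>n. Qf (t n) (f n) x - Qf (t n) (f n) z) \<longlonglongrightarrow> 0"
proof (rule tendstoI)
  fix e :: real assume "0 < e"
  then have "eventually (\<lambda>t. \<forall>f\<in>unit_fun. \<bar>Qf t f x - Qf t f z\<bar> < e) at_top"
    using assms(1) by (auto simp: merges_def)
  from eventually_compose_filterlim[OF this t]
  show "\<forall>\<^sub>F n in sequentially. dist (Qf (t n) (f n) x - Qf (t n) (f n) z) 0 < e"
    by eventually_elim (use f in \<open>auto simp: dist_real_def\<close>)
qed

text \<open>Testing along sequences \<open>(t\<^sub>n, f\<^sub>n)\<close> circumvents the measurability of a supremum over uncountably
  many test functions.\<close>

lemma merges_of_local_closeness:
  assumes close: "\<And>e. 0 < e \<Longrightarrow> \<exists>r>0. \<forall>y\<in>ball z r.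
      eventually (\<lambda>t. \<forall>f\<in>unit_fun. \<bar>Qf t f y - Qf t f z\<bar> \<le> e) at_top"
    and hit: "\<And>r. 0 < r \<Longrightarrow> \<exists>c>0. \<forall>x. \<exists>s\<ge>0. c \<le> measure (K s x) (ball z r)"
  shows "merges x z"
  unfolding merges_def
proof (intro allI impI eventually_at_top_unif_of_seq[where H="\<lambda>t f. Qf t f x - Qf t f z"])
  fix t :: "nat \<Rightarrow> real" and f :: "nat \<Rightarrow> 'a \<Rightarrow> real"
  assume t: "filterlim t at_top sequentially" and tpos: "\<And>n. 0 < t n" and f: "\<And>n. f n \<in> unit_fun"
  define g where "g n y = \<bar>Qf (t n) (f n) y - Qf (t n) (f n) z\<bar>" for n y
  define e where "e y = limsup (\<lambda>n. ennreal (g n y))" for y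
  have Qm: "(\<lambda>y. Qf (t n) (f n) y) \<in> unit_fun" for n
    using cesaro_unit_fun[OF f tpos] .
  note [measurable] = unit_funD(1)[OF Qm]
  have gm[measurable]: "g n \<in> borel_measurable borel" for n
    unfolding g_def by measurable
  have em[measurable]: "e \<in> borel_measurable borel"
    unfolding e_def by measurable
  have g01: "0 \<le> g n y" "g n y \<le> 1" for n y
    using unit_funD(2,3)[OF Qm, of n y] unit_funD(2,3)[OF Qm, of n z] by (auto simp: g_def)
  have e1: "e y \<le> 1" for y
    unfolding e_def using g01 by (intro Limsup_bounded) (auto simp: ennreal_le_1)
  \<comment> \<open>Subharmonicity of \<open>e\<close>: asymptotic harmonicity bounds
    \<open>g n x\<close> by the integral of \<open>g n\<close> up to an error s / t n, and the
    reverse Fatou lemma with the constant bound 1 moves the limsup inside.\<close>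
  have sub: "e x \<le> (\<integral>\<^sup>+y. e y \<partial>K s x)" if s: "0 \<le> s" for s x
  proof (rule ennreal_le_epsilon)
    fix d :: real assume d: "0 < d"
    interpret KP: prob_space "K s x" by (rule prob_K)
    have intg: "integrable (K s x) (g n)" for n
      using g01 by (intro KP.integrable_const_bound[where B=1]) auto
    have "((\<lambda>n. s / t n) \<longlongrightarrow> 0) sequentially"
      using t by (rule tendsto_divide_0[OF tendsto_const filterlim_at_top_imp_at_infinity])
    then have "eventually (\<lambda>n. s / t n < d) sequentially"
      using d order_tendstoD(2) by blast
    then have "eventually (\<lambda>n. ennreal (g n x) \<le> ennreal d + (\<integral>\<^sup>+y. ennreal (g n y) \<partial>K s x)) sequentially"
    proof eventually_elim
      case (elim n)
      have iQ: "integrable (K s x) (\<lambda>y. Qf (t n) (f n) y)"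
        using Qm prob_K by (intro unit_fun_integrable) auto
      have "\<bar>(\<integral>y. Qf (t n) (f n) y \<partial>K s x) - Qf (t n) (f n) z\<bar> = \<bar>\<integral>y. Qf (t n) (f n) y - Qf (t n) (f n) z \<partial>K s x\<bar>"
        using iQ KP.prob_space by simp
      also have "\<dots> \<le> (\<integral>y. g n y \<partial>K s x)"
        unfolding g_def by (rule integral_abs_bound)
      finally have "g n x \<le> s / t n + (\<integral>y. g n y \<partial>K s x)"
        using K_cesaro_close[OF f[of n] tpos[of n] s, of x] unfolding g_def by linarith
      then have "g n x \<le> d + (\<integral>y. g n y \<partial>K s x)" using elim by linarith
      then have "ennreal (g n x) \<le> ennreal (d + (\<integral>y. g n y \<partial>K s x))" by (rule ennreal_leI)
      also have "\<dots> = ennreal d + ennreal (\<integral>y. g n y \<partial>K s x)"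
        using d g01 by (intro ennreal_plus) (auto intro!: Bochner_Integration.integral_nonneg)
      also have "ennreal (\<integral>y. g n y \<partial>K s x) = (\<integral>\<^sup>+y. ennreal (g n y) \<partial>K s x)"
        using intg g01 by (intro nn_integral_eq_integral[symmetric]) auto
      finally show ?case .
    qed
    then have "e x \<le> limsup (\<lambda>n. ennreal d + (\<integral>\<^sup>+y. ennreal (g n y) \<partial>K s x))"
      unfolding e_def by (rule Limsup_mono)
    also have "\<dots> = ennreal d + limsup (\<lambda>n. \<integral>\<^sup>+y. ennreal (g n y) \<partial>K s x)"
      by (intro Limsup_const_add) auto
    also have "limsup (\<lambda>n. \<integral>\<^sup>+y. ennreal (g n y) \<partial>K s x) \<le> (\<integral>\<^sup>+y. e y \<partial>K s x)"
      unfolding e_def using g01 KP.emeasure_space_1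
      by (intro nn_integral_limsup[where w="\<lambda>_. 1"]) (auto simp: ennreal_le_1)
    finally show "e x \<le> (\<integral>\<^sup>+y. e y \<partial>K s x) + ennreal d"
      by (simp add: add.commute add_left_mono)
  qed
  define E where "E = (SUP y. e y)"
  have E1: "E \<le> 1" unfolding E_def using e1 by (intro SUP_least) auto
  define E' where "E' = enn2real E"
  have "E < top" using E1 ennreal_one_less_top by (rule le_less_trans)
  then have E': "E = ennreal E'" "0 \<le> E'"
    unfolding E'_def by simp_all
  \<comment> \<open>If the supremum \<open>E'\<close> exceeded \<open>d\<close>, each starting point
    could be run until mass at least \<open>c\<close> lies in the ball, where \<open>e\<close> is at
    most \<open>d\<close>. Subharmonicity then gives the bound E' - c * (E' - d) for
    \<open>e\<close> everywhere, with \<open>c\<close> independent of the starting point, so the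
    supremum would be smaller than itself.\<close>
  have "E' \<le> d" if d: "0 < d" for d
  proof (rule ccontr)
    assume nd: "\<not> E' \<le> d"
    from close[OF d] obtain r where r: "0 < r" and
      cl: "\<And>y. y \<in> ball z r \<Longrightarrow> eventually (\<lambda>t. \<forall>f\<in>unit_fun. \<bar>Qf t f y - Qf t f z\<bar> \<le> d) at_top" by blast
    from hit[OF r] obtain c where c: "0 < c" "\<And>x. \<exists>s\<ge>0. c \<le> measure (K s x) (ball z r)" by blast
    have eB: "e y \<le> ennreal d" if "y \<in> ball z r" for y
      unfolding e_def
    proof (rule Limsup_bounded)
      from eventually_compose_filterlim[OF cl[OF that] t]
      show "\<forall>\<^sub>F n in sequentially. ennreal (g n y) \<le> ennreal d"
        by eventually_elim (use f in \<open>auto simp: g_def intro: ennreal_leI\<close>)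
    qed
    have eE: "e y \<le> ennreal (E' - c * (E' - d))" for y
    proof -
      from c(2)[of y] obtain s where s: "0 \<le> s" "c \<le> measure (K s y) (ball z r)" by blast
      interpret KP: prob_space "K s y" by (rule prob_K)
      let ?B = "ball z r" and ?p = "measure (K s y) (ball z r)"
      have p1: "?p \<le> 1" by simp
      have "e y \<le> (\<integral>\<^sup>+x. e x \<partial>K s y)" by (rule sub[OF s(1)])
      also have "\<dots> \<le> (\<integral>\<^sup>+x. ennreal d * indicator ?B x + ennreal E' * indicator (- ?B) x \<partial>K s y)"
        using eB by (intro nn_integral_mono) (auto simp: indicator_def E'(1)[symmetric] E_def intro: SUP_upper)
      also have "\<dots> = ennreal d * emeasure (K s y) ?B + ennreal E' * emeasure (K s y) (- ?B)"
        by (subst nn_integral_add) (measurable, auto simp: nn_integral_cmult_indicator)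
      also have "emeasure (K s y) (- ?B) = ennreal (1 - ?p)"
        using KP.prob_compl[of ?B] by (simp add: KP.emeasure_eq_measure Compl_eq_Diff_UNIV)
      also have "emeasure (K s y) ?B = ennreal ?p" by (simp add: KP.emeasure_eq_measure)
      also have "ennreal d * ennreal ?p + ennreal E' * ennreal (1 - ?p) = ennreal (d * ?p + E' * (1 - ?p))"
        using d E'(2) p1 by (simp add: ennreal_mult[symmetric] ennreal_plus[symmetric] del: ennreal_plus)
      also have "\<dots> \<le> ennreal (E' - c * (E' - d))"
      proof (rule ennreal_leI)
        have "c * (E' - d) \<le> ?p * (E' - d)" using s(2) nd by (intro mult_right_mono) auto
        then show "d * ?p + E' * (1 - ?p) \<le> E' - c * (E' - d)" by (simp add: algebra_simps)
      qed
      finally show ?thesis .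
    qed
    \<comment> \<open>This makes E' - c * (E' - d) nonnegative. Since \<open>ennreal\<close> sends
      negative reals to 0, the comparison could otherwise not be carried back to the reals.\<close>
    have "c \<le> 1"
    proof -
      from c(2)[of z] obtain s where "c \<le> measure (K s z) (ball z r)" by blast
      also have "\<dots> \<le> 1" using prob_space.prob_le_1[OF prob_K] .
      finally show ?thesis .
    qed
    then have "c * (E' - d) \<le> 1 * (E' - d)" using nd by (intro mult_right_mono) auto
    then have nn: "0 \<le> E' - c * (E' - d)" using d by simp
    have "E \<le> ennreal (E' - c * (E' - d))"
      unfolding E_def using eE by (intro SUP_least) auto
    then have "E' \<le> E' - c * (E' - d)"
      using E'(1) nn by (simp add: ennreal_le_iff)
    moreover have "0 < c * (E' - d)" using c(1) nd by simp
    ultimately show False by linarith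
  qed
  then have "E' = 0" using E'(2) by (meson dense_ge order_antisym)
  then have "e x = 0" using E'(1) SUP_upper[of x UNIV e] unfolding E_def by simp
  have "(\<lambda>n. ennreal (g n x)) \<longlonglongrightarrow> 0"
    by (rule tendsto_0_if_Limsup_eq_0_ennreal) (use \<open>e x = 0\<close> in \<open>simp add: e_def\<close>)
  then have "(\<lambda>n. g n x) \<longlonglongrightarrow> 0"
    using tendsto_ennreal_iff[of "\<lambda>n. g n x" sequentially 0] g01 by simp
  then show "(\<lambda>n. Qf (t n) (f n) x - Qf (t n) (f n) z) \<longlonglongrightarrow> 0"
    unfolding g_def by (rule tendsto_rabs_zero_cancel)
qed

section \<open>Invariant probabilities: convergence to them and uniqueness\<close>

definition invariant :: "'a measure \<Rightarrow> bool" where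
  "invariant \<mu> \<longleftrightarrow> prob_space \<mu> \<and> sets \<mu> = sets borel \<and> (\<forall>t\<ge>0. \<mu> \<bind> K t = \<mu>)"

lemma invariant_integral_cesaro:
  assumes inv: "invariant \<mu>" and f: "f \<in> unit_fun" and t: "0 < t"
  shows "(\<integral>y. Qf t f y \<partial>\<mu>) = integral\<^sup>L \<mu> f"
proof -
  interpret mu: prob_space \<mu> using inv by (simp add: invariant_def)
  interpret U: prob_space "unif_time t" using t by (rule prob_space_unif_time)
  have smu[simp, measurable_cong]: "sets \<mu> = sets borel" using inv by (simp add: invariant_def)
  note [measurable] = K_time_measurable[OF unit_funD(1)[OF f]]
  have "(\<integral>y. Qf t f y \<partial>\<mu>) = (\<integral>s. (\<integral>y. integral\<^sup>L (K s y) f \<partial>\<mu>) \<partial>unif_time t)"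
    using f t mu.prob_space_axioms by (intro Fubini_unif_time) auto
  also have "\<dots> = (\<integral>s. integral\<^sup>L \<mu> f \<partial>unif_time t)"
  proof (rule integral_cong_AE)
    show "AE s in unif_time t. (\<integral>y. integral\<^sup>L (K s y) f \<partial>\<mu>) = integral\<^sup>L \<mu> f"
      using AE_unif_time[OF t]
    proof eventually_elim
      case (elim s)
      have eq: "\<mu> \<bind> K s = \<mu>" using inv elim by (simp add: invariant_def)
      have "integral\<^sup>L (\<mu> \<bind> K s) f = (\<integral>y. integral\<^sup>L (K s y) f \<partial>\<mu>)"
        using unit_funD(1)[OF f] K_meas2[of s] mu.not_empty unit_fun_integrable[OF f mu.prob_space_axioms smu] eq
        by (intro integral_bind_integrable[of _ _ borel]) (auto cong: measurable_cong_sets)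
      then show ?case by (simp add: eq)
    qed
  qed measurable
  also have "\<dots> = integral\<^sup>L \<mu> f" using U.prob_space by simp
  finally show ?thesis .
qed

text \<open>Integrating Q_t f(x) - Q_t f(y) over y with respect to \<mu> gives Q_t f(x) minus the
  integral of f, by invariance. Merging sends the integrand to 0 for each y, and it is bounded by
  1.\<close>

lemma cesaro_tendsto_invariant:
  assumes merge: "\<And>x. merges x z" and inv: "invariant \<mu>" and e: "0 < e"
  shows "eventually (\<lambda>t. \<forall>f\<in>unit_fun. \<bar>Qf t f x - integral\<^sup>L \<mu> f\<bar> < e) at_top"
proof (rule eventually_at_top_unif_of_seq[OF _ e, where H="\<lambda>t f. Qf t f x - integral\<^sup>L \<mu> f"])
  fix t :: "nat \<Rightarrow> real" and f :: "nat \<Rightarrow> 'a \<Rightarrow> real"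
  assume t: "filterlim t at_top sequentially" and tpos: "\<And>n. 0 < t n" and f: "\<And>n. f n \<in> unit_fun"
  interpret mu: prob_space \<mu> using inv by (simp add: invariant_def)
  have smu[simp, measurable_cong]: "sets \<mu> = sets borel" using inv by (simp add: invariant_def)
  have Qm: "(\<lambda>y. Qf (t n) (f n) y) \<in> unit_fun" for n
    using cesaro_unit_fun[OF f tpos] .
  note [measurable] = unit_funD(1)[OF Qm]
  have "(\<lambda>n. \<integral>y. Qf (t n) (f n) x - Qf (t n) (f n) y \<partial>\<mu>) \<longlonglongrightarrow> (\<integral>y. 0 \<partial>\<mu>)"
  proof (rule integral_dominated_convergence[where w="\<lambda>_. 1"])
    show "AE y in \<mu>. (\<lambda>n. Qf (t n) (f n) x - Qf (t n) (f n) y) \<longlonglongrightarrow> 0"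
    proof (rule AE_I2)
      fix y
      from tendsto_diff[OF mergesD[of x z t f] mergesD[of y z t f]] merge t f
      show "(\<lambda>n. Qf (t n) (f n) x - Qf (t n) (f n) y) \<longlonglongrightarrow> 0" by simp
    qed
    show "AE y in \<mu>. norm (Qf (t n) (f n) x - Qf (t n) (f n) y) \<le> 1" for n
    proof (rule AE_I2)
      fix y
      show "norm (Qf (t n) (f n) x - Qf (t n) (f n) y) \<le> 1"
        using unit_funD(2,3)[OF Qm, of n x] unit_funD(2,3)[OF Qm, of n y] by (auto simp: abs_le_iff)
    qed
  qed auto
  moreover have "(\<integral>y. Qf (t n) (f n) x - Qf (t n) (f n) y \<partial>\<mu>) = Qf (t n) (f n) x - integral\<^sup>L \<mu> (f n)" for n
    using unit_fun_integrable[OF Qm mu.prob_space_axioms smu, of n] invariant_integral_cesaro[OF inv f[of n] tpos[of n]] mu.prob_space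
    by simp
  ultimately show "(\<lambda>n. Qf (t n) (f n) x - integral\<^sup>L \<mu> (f n)) \<longlonglongrightarrow> 0" by simp
qed

text \<open>The average of Q_t 1_B over an invariant \<nu> is \<nu>(B) for every t, whereas
  dominated convergence gives \<mu>(B) in the limit.\<close>

lemma invariant_unique:
  assumes conv: "\<And>x B. B \<in> sets borel \<Longrightarrow> ((\<lambda>t. Qf t (indicator B) x) \<longlongrightarrow> measure \<mu> B) at_top"
    and mu: "invariant \<mu>" and nu: "invariant \<nu>"
  shows "\<nu> = \<mu>"
proof -
  interpret mu: prob_space \<mu> using mu by (simp add: invariant_def)
  interpret nu: prob_space \<nu> using nu by (simp add: invariant_def)
  have smu[simp, measurable_cong]: "sets \<mu> = sets borel" using mu by (simp add: invariant_def)
  have snu[simp, measurable_cong]: "sets \<nu> = sets borel" using nu by (simp add: invariant_def)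
  show ?thesis
  proof (rule measure_eqI)
    show "sets \<nu> = sets \<mu>" by simp
    fix B assume "B \<in> sets \<nu>"
    then have B: "B \<in> sets borel" by simp
    define t where "t n = real (Suc n)" for n
    have t: "filterlim t at_top sequentially"
      unfolding t_def by (rule filterlim_compose[OF filterlim_real_sequentially filterlim_Suc])
    have tpos: "0 < t n" for n by (simp add: t_def)
    have iB: "(indicator B :: 'a \<Rightarrow> real) \<in> unit_fun" using B by (rule indicator_unit_fun)
    have Qm: "(\<lambda>y. Qf (t n) (indicator B) y) \<in> unit_fun" for n
      using cesaro_unit_fun[OF iB tpos] .
    note [measurable] = unit_funD(1)[OF Qm]
    have "(\<lambda>n. \<integral>y. Qf (t n) (indicator B) y \<partial>\<nu>) \<longlonglongrightarrow> (\<integral>y. measure \<mu> B \<partial>\<nu>)"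
    proof (rule integral_dominated_convergence[where w="\<lambda>_. 1"])
      show "AE y in \<nu>. (\<lambda>n. Qf (t n) (indicator B) y) \<longlonglongrightarrow> measure \<mu> B"
        using filterlim_compose[OF conv[OF B] t] by (intro AE_I2) simp
      show "AE y in \<nu>. norm (Qf (t n) (indicator B) y) \<le> 1" for n
      proof (rule AE_I2)
        fix y
        show "norm (Qf (t n) (indicator B) y) \<le> 1"
          using unit_funD(2,3)[OF Qm, of n y] by auto
      qed
    show "(\<lambda>y. Qf (t n) (indicator B) y) \<in> borel_measurable \<nu>" for n by measurable
    qed auto
    moreover have "(\<integral>y. Qf (t n) (indicator B) y \<partial>\<nu>) = measure \<nu> B" for n
      using invariant_integral_cesaro[OF nu iB tpos[of n]] B by simp
    ultimately have "(\<lambda>n::nat. measure \<nu> B) \<longlonglongrightarrow> measure \<mu> B"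
      using nu.prob_space by simp
    then have "measure \<nu> B = measure \<mu> B" by (simp add: LIMSEQ_const_iff)
    then show "emeasure \<nu> B = emeasure \<mu> B"
      by (simp add: mu.emeasure_eq_measure nu.emeasure_eq_measure)
  qed
qed

end

subsection \<open>Finitely additive means\<close>

text \<open>Tychonoff's theorem for the cube of all functions into [0, 1]. The index set is
  uncountable in the application, so no convergent subsequence can be expected and the limit is
  taken along a finer filter.\<close>

lemma bounded_pointwise_cluster:
  fixes \<phi> :: "nat \<Rightarrow> 'b \<Rightarrow> real"
  assumes "\<And>n b. \<phi> n b \<in> {0..1}"
  obtains m F where "F \<noteq> bot" "F \<le> sequentially" "\<And>b. ((\<lambda>n. \<phi> n b) \<longlongrightarrow> m b) F"
proof -
  have "compactin (product_topology (\<lambda>_::'b. euclidean) UNIV) (PiE UNIV (\<lambda>_::'b. {0..1::real}))"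
    by (subst compactin_PiE) auto
  then have comp: "compact (PiE UNIV (\<lambda>_::'b. {0..1::real}))"
    by (simp add: euclidean_product_topology)
  have "filtermap \<phi> sequentially \<noteq> bot" by (simp add: filtermap_bot_iff)
  moreover have "eventually (\<lambda>g. g \<in> PiE UNIV (\<lambda>_. {0..1})) (filtermap \<phi> sequentially)"
    using assms by (auto simp: eventually_filtermap PiE_def)
  ultimately obtain m where m: "inf (nhds m) (filtermap \<phi> sequentially) \<noteq> bot"
    using comp unfolding compact_filter by meson
  \<comment> \<open>The filter of large indices whose \<open>\<phi> n\<close> is near
    \<open>m\<close>; it is proper because \<open>m\<close> is a cluster point.\<close>
  define F where "F = inf (filtercomap \<phi> (nhds m)) sequentially"
  have "F \<noteq> bot"
  proof
    assume "F = bot"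
    then have "eventually (\<lambda>_. False) F" by simp
    then obtain P Q where P: "eventually P (filtercomap \<phi> (nhds m))" and Q: "eventually Q sequentially"
      and PQ: "\<And>n. P n \<Longrightarrow> Q n \<Longrightarrow> False"
      unfolding F_def eventually_inf by auto
    from P obtain P' where P': "eventually P' (nhds m)" "\<And>n. P' (\<phi> n) \<Longrightarrow> P n"
      unfolding eventually_filtercomap by auto
    have "eventually (\<lambda>g. \<not> P' g) (filtermap \<phi> sequentially)"
      unfolding eventually_filtermap using Q by eventually_elim (use PQ P' in blast)
    with P'(1) have "eventually (\<lambda>_. False) (inf (nhds m) (filtermap \<phi> sequentially))"
      unfolding eventually_inf by blast
    with m show False by (simp add: trivial_limit_def)
  qed
  moreover have "F \<le> sequentially" by (simp add: F_def)
  moreover have "((\<lambda>n. \<phi> n b) \<longlongrightarrow> m b) F" for b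
  proof -
    have lim: "(\<phi> \<longlongrightarrow> m) F"
      unfolding F_def by (rule filterlim_mono[OF filterlim_filtercomap order_refl]) simp
    show ?thesis
    proof (rule topological_tendstoI)
      fix U :: "real set" assume U: "open U" "m b \<in> U"
      have "open ((\<lambda>g :: 'b \<Rightarrow> real. g b) -` U)"
        using U(1) by (rule open_vimage) simp
      from topological_tendstoD[OF lim this] U(2)
      show "eventually (\<lambda>n. \<phi> n b \<in> U) F" by simp
    qed
  qed
  ultimately show ?thesis by (rule that)
qed

text \<open>By inner regularity the set may be taken compact, and the indicator of a compact set is
  a limit of continuous functions from above; testing with these loses only \<open>d\<close>. The
  lemma recovers Borel sets from closeness known for continuous functions alone.\<close>

lemma measure_ge_of_continuous_close:
  fixes M1 M2 :: "'a::polish_space measure"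
  assumes M1: "prob_space M1" "sets M1 = sets borel" and M2: "prob_space M2" "sets M2 = sets borel"
    and close: "\<And>f. continuous_on UNIV f \<Longrightarrow> f \<in> unit_fun \<Longrightarrow> \<bar>integral\<^sup>L M1 f - integral\<^sup>L M2 f\<bar> \<le> d"
    and A: "A \<in> sets borel" and d: "0 \<le> d"
  shows "measure M2 A - d \<le> measure M1 A"
proof (rule field_le_epsilon)
  interpret M1: prob_space M1 by fact
  interpret M2: prob_space M2 by fact
  note [measurable_cong] = M1(2) M2(2)
  fix e :: real assume e: "0 < e"
  have "\<exists>C. C \<subseteq> A \<and> compact C \<and> measure M2 A \<le> measure M2 C + e"
  proof (rule ccontr)
    assume no: "\<not> ?thesis"
    have "emeasure M2 A = (SUP C \<in> {C. C \<subseteq> A \<and> compact C}. emeasure M2 C)"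
      using M2 A M2.emeasure_space_1 by (intro inner_regular) auto
    also have "\<dots> \<le> ennreal (measure M2 A - e)"
    proof (rule SUP_least)
      fix C assume "C \<in> {C. C \<subseteq> A \<and> compact C}"
      then have "measure M2 C \<le> measure M2 A - e" using no by force
      then show "emeasure M2 C \<le> ennreal (measure M2 A - e)"
        by (simp add: M2.emeasure_eq_measure ennreal_leI)
    qed
    finally have "ennreal (measure M2 A) \<le> ennreal (measure M2 A - e)"
      by (simp add: M2.emeasure_eq_measure)
    moreover have "0 \<le> measure M2 A - e"
    proof -
      have "\<not> (measure M2 A \<le> measure M2 {} + e)" using no compact_empty by blast
      then show ?thesis by simp
    qed
    ultimately show False using e by (simp add: ennreal_le_iff)
  qed
  then obtain C where C: "C \<subseteq> A" "compact C" "measure M2 A \<le> measure M2 C + e" by blast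
  have clC: "closed C" using C(2) by (rule compact_imp_closed)
  then have Cm[measurable]: "C \<in> sets borel" by simp
  have "measure M2 C - d \<le> measure M1 C"
  \<comment> \<open>The empty set is separate since \<open>infdist y {}\<close> is 0, so that the
    functions below would be constantly 1.\<close>
  proof (cases "C = {}")
    case False
    define f where "f k y = max 0 (1 - real k * infdist y C)" for k :: nat and y
    have fc: "continuous_on UNIV (f k)" for k
      unfolding f_def by (intro continuous_intros)
    have fm[measurable]: "f k \<in> borel_measurable borel" for k
      using fc by (rule borel_measurable_continuous_onI)
    have fU: "f k \<in> unit_fun" for k
      using fm infdist_nonneg[of _ C] by (auto simp: unit_fun_def f_def)
    have fi: "indicator C y \<le> f k y" for k y
      by (auto simp: f_def indicator_def)
    have lim: "(\<lambda>k. f k y) \<longlonglongrightarrow> indicator C y" for y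
    proof (cases "y \<in> C")
      case True then show ?thesis by (simp add: f_def)
    next
      case out: False
      have pos: "0 < infdist y C"
        using clC False out by (simp add: infdist_pos_not_in_closed)
      obtain k0 :: nat where k0: "1 < real k0 * infdist y C" using reals_Archimedean3[OF pos] by blast
      have "f k y = 0" if "k \<ge> k0" for k
      proof -
        have "real k0 * infdist y C \<le> real k * infdist y C" using that pos by (intro mult_right_mono) auto
        then show ?thesis using k0 by (simp add: f_def)
      qed
      then have "eventually (\<lambda>k. f k y = 0) sequentially"
        by (auto simp: eventually_sequentially)
      then show ?thesis using out by (simp add: tendsto_eventually)
    qed
    have "(\<lambda>k. integral\<^sup>L M1 (f k)) \<longlonglongrightarrow> integral\<^sup>L M1 (indicator C)"
      using lim unit_funD(2,3)[OF fU]
      by (intro integral_dominated_convergence[where w="\<lambda>_. 1"]) auto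
    then have lim1: "(\<lambda>k. integral\<^sup>L M1 (f k)) \<longlonglongrightarrow> measure M1 C"
      using Cm M1(2) by simp
    have "measure M2 C - d \<le> integral\<^sup>L M1 (f k)" for k
    proof -
      have "measure M2 C = integral\<^sup>L M2 (indicator C)" using Cm M2(2) by simp
      also have "\<dots> \<le> integral\<^sup>L M2 (f k)"
        using fi unit_fun_integrable[OF fU M2] unit_fun_integrable[OF indicator_unit_fun[OF Cm] M2]
        by (intro integral_mono) auto
      finally show ?thesis using close[OF fc fU, of k] by linarith
    qed
    then show ?thesis using lim1 by (intro LIMSEQ_le_const) auto
  qed (use d in simp)
  moreover have "measure M1 C \<le> measure M1 A"
    using C(1) A M1(2) by (intro M1.finite_measure_mono) auto
  ultimately show "measure M2 A - d \<le> measure M1 A + e" using C(3) by linarith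
qed

text \<open>Additivity is required only when the sum stays in \<open>unit_fun\<close>, because a
  limit of the Q_t(z) is controlled only on that class.\<close>

locale unit_mean =
  fixes m :: "('a::topological_space \<Rightarrow> real) \<Rightarrow> real"
  assumes m_nonneg: "f \<in> unit_fun \<Longrightarrow> 0 \<le> m f"
    and m_add: "f \<in> unit_fun \<Longrightarrow> g \<in> unit_fun \<Longrightarrow> (\<lambda>x. f x + g x) \<in> unit_fun \<Longrightarrow> m (\<lambda>x. f x + g x) = m f + m g"
    and m_scale: "f \<in> unit_fun \<Longrightarrow> 0 \<le> c \<Longrightarrow> c \<le> 1 \<Longrightarrow> m (\<lambda>x. c * f x) = c * m f"
begin

definition charge :: "'a set \<Rightarrow> ennreal" where
  "charge A = ennreal (m (indicator A))"

text \<open>The set function \<open>charge\<close> is only finitely additive, so its outer measure does not extend it but is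
  the largest countably additive minorant.\<close>

definition ca_part :: "'a measure" where
  "ca_part = measure_of UNIV (sets borel) (outer_measure (sets borel) charge)"

lemma zero_unit_fun: "(\<lambda>_. 0) \<in> unit_fun"
  by (simp add: unit_fun_def)

lemma m_zero: "m (\<lambda>_. 0) = 0"
  using m_scale[OF zero_unit_fun, of 0] by simp

lemma m_mono:
  assumes f: "f \<in> unit_fun" and g: "g \<in> unit_fun" and le: "\<And>x. f x \<le> g x"
  shows "m f \<le> m g"
proof -
  have d: "(\<lambda>x. g x - f x) \<in> unit_fun"
    unfolding unit_fun_def
  proof (intro CollectI conjI allI)
    show "(\<lambda>x. g x - f x) \<in> borel_measurable borel"
      using unit_funD(1)[OF f] unit_funD(1)[OF g] by simp
    fix x
    show "0 \<le> g x - f x" using le[of x] by simp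
    show "g x - f x \<le> 1" using unit_funD(2)[OF f, of x] unit_funD(3)[OF g, of x] by linarith
  qed
  have "m (\<lambda>x. f x + (g x - f x)) = m f + m (\<lambda>x. g x - f x)"
    using f g d by (intro m_add) auto
  then show ?thesis using m_nonneg[OF d] by simp
qed

lemma charge_positive: "positive (sets borel) charge"
proof -
  have "(indicator {} :: 'a \<Rightarrow> real) = (\<lambda>_. 0)" by auto
  then show ?thesis using m_zero by (simp add: positive_def charge_def)
qed

lemma charge_additive: "additive (sets borel) charge"
unfolding additive_def
proof safe
  fix A B :: "'a set" assume A: "A \<in> sets borel" and B: "B \<in> sets borel" and disj: "A \<inter> B = {}"
  have eq: "(indicator (A \<union> B) :: 'a \<Rightarrow> real) = (\<lambda>x. indicator A x + indicator B x)"
    using disj by (auto simp: indicator_def fun_eq_iff)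
  have "m (indicator (A \<union> B)) = m (indicator A) + m (indicator B)"
    unfolding eq using A B indicator_unit_fun[of "A \<union> B"]
    by (intro m_add indicator_unit_fun) (simp_all add: eq)
  then show "charge (A \<union> B) = charge A + charge B"
    using m_nonneg A B by (simp add: charge_def indicator_unit_fun)
qed

lemma charge_increasing: "increasing (sets borel) charge"
  by (auto simp: increasing_def charge_def indicator_def intro!: ennreal_leI m_mono indicator_unit_fun)

lemma sets_ca_part [simp, measurable_cong]: "sets ca_part = sets borel"
  unfolding ca_part_def using sets.sigma_sets_eq[of "borel::'a measure"] by simp

lemma space_ca_part [simp]: "space ca_part = UNIV"
  unfolding ca_part_def by (simp add: space_measure_of_conv)

text \<open>Finite additivity of \<open>charge\<close> is enough for every Borel set to split the
  outer measure additively. Caratheodory's theorem then makes the outer measure countably additive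
  on Borel sets.\<close>

lemma emeasure_ca_part:
  assumes "A \<in> sets borel"
  shows "emeasure ca_part A = outer_measure (sets borel) charge A"
proof -
  interpret R: sigma_algebra "UNIV :: 'a set" "sets borel"
    using sets.sigma_algebra_axioms[of "borel :: 'a measure"] by simp
  let ?O = "outer_measure (sets borel) charge"
  have "measure_space UNIV (lambda_system UNIV (Pow UNIV) ?O) ?O"
    using sigma_algebra.caratheodory_lemma[OF sigma_algebra_Pow
        R.outer_measure_space_outer_measure[OF charge_positive charge_increasing]] .
  from measure_down[OF this R.sigma_algebra_axioms
      R.algebra_subset_lambda_system[OF charge_positive charge_increasing charge_additive]]
  have "measure_space UNIV (sets borel) ?O" .
  then show ?thesis
    unfolding ca_part_def using assms
    by (intro emeasure_measure_of_sigma) (auto simp: measure_space_def)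
qed

lemma ca_part_le_charge:
  assumes A: "A \<in> sets borel" shows "emeasure ca_part A \<le> charge A"
proof -
  have "outer_measure (sets borel) charge A \<le> (\<Sum>i. charge (if i = 0 then A else {}))"
    unfolding outer_measure_def
    by (rule INF_lower2[of "\<lambda>i. if i = 0 then A else {}"]) (auto simp: A disjoint_family_on_def split: if_splits)
  also have "\<dots> = charge A"
    using charge_positive by (subst suminf_finite[of "{0}"]) (auto simp: positive_def)
  finally show ?thesis using emeasure_ca_part[OF A] by simp
qed

lemma finite_measure_ca_part: "finite_measure ca_part"
proof (rule finite_measureI)
  have "emeasure ca_part UNIV \<le> charge UNIV" by (rule ca_part_le_charge) simp
  then show "emeasure ca_part (space ca_part) \<noteq> \<infinity>"
    by (auto simp: charge_def top_unique)
qed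

text \<open>A countably additive \<open>N\<close> below \<open>charge\<close> is at most the sum of
  \<open>charge\<close> over any countable cover, hence at most the infimum of these sums.\<close>

lemma ca_part_greatest:
  assumes N: "sets N = sets borel" and le: "\<And>A. A \<in> sets borel \<Longrightarrow> emeasure N A \<le> charge A"
    and A: "A \<in> sets borel"
  shows "emeasure N A \<le> emeasure ca_part A"
  unfolding emeasure_ca_part[OF A] outer_measure_def
proof (safe intro!: INF_greatest)
  fix B :: "nat \<Rightarrow> 'a set" assume B: "range B \<subseteq> sets borel" "A \<subseteq> (\<Union>i. B i)"
  have "emeasure N A \<le> emeasure N (\<Union>i. B i)"
    using A B N by (intro emeasure_mono) auto
  also have "\<dots> \<le> (\<Sum>i. emeasure N (B i))"
    using B N by (intro emeasure_subadditive_countably) auto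
  also have "\<dots> \<le> (\<Sum>i. charge (B i))"
    using B le by (intro suminf_le) auto
  finally show "emeasure N A \<le> (\<Sum>i. charge (B i))" .
qed

text \<open>One level set is peeled off at a time. Setting the function to 0 outside
  \<open>Y\<close> keeps every partial sum in \<open>unit_fun\<close>, where \<open>m\<close> is
  additive.\<close>

lemma m_finite_valued:
  assumes h: "h \<in> unit_fun" and Y: "finite Y" "Y \<subseteq> {0..1}"
  shows "m (\<lambda>x. if h x \<in> Y then h x else 0) = (\<Sum>y\<in>Y. y * m (indicator (h -` {y})))"
  using Y
proof (induction Y rule: finite_induct)
  case empty
  then show ?case by (simp add: m_zero)
next
  case (insert y Y)
  note [measurable] = unit_funD(1)[OF h]
  have s: "h -` {y} \<in> sets borel" using measurable_sets[of h borel borel "{y}"] by simp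
  have i: "indicator (h -` {y}) \<in> (unit_fun :: ('a \<Rightarrow> real) set)" using s by (rule indicator_unit_fun)
  have hY: "h -` Y \<in> sets borel" if "finite Y" for Y
    using measurable_sets[of h borel borel Y] that by (simp add: finite_imp_closed)
  have cut: "(\<lambda>x. if h x \<in> Y then h x else 0) \<in> unit_fun" if "finite Y" for Y
  proof -
    have "(\<lambda>x. if h x \<in> Y then h x else 0) = (\<lambda>x. indicator (h -` Y) x * h x)"
      by (auto simp: indicator_def)
    then show ?thesis
      using unit_funD[OF h] hY[OF that] by (auto simp: unit_fun_def split: split_indicator)
  qed
  have yi: "(\<lambda>x. y * indicator (h -` {y}) x) \<in> unit_fun"
    using insert.prems s by (auto simp: unit_fun_def indicator_def)
  have eq: "(\<lambda>x. if h x \<in> insert y Y then h x else 0) =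
      (\<lambda>x. y * indicator (h -` {y}) x + (if h x \<in> Y then h x else 0))"
    using insert.hyps by (auto simp: indicator_def)
  have "m (\<lambda>x. if h x \<in> insert y Y then h x else 0) =
      m (\<lambda>x. y * indicator (h -` {y}) x) + m (\<lambda>x. if h x \<in> Y then h x else 0)"
    unfolding eq by (intro m_add yi cut insert.hyps) (use cut[of "insert y Y"] insert.hyps in \<open>simp only: eq[symmetric] finite_insert\<close>)
  also have "m (\<lambda>x. y * indicator (h -` {y}) x) = y * m (indicator (h -` {y}))"
    using insert.prems by (intro m_scale i) auto
  finally show ?case using insert by simp
qed

text \<open>Domination on sets extends to functions by rounding \<open>f\<close> down to multiples
  of 1 / k. For the rounded function both sides are finite sums over level sets; monotonicity of
  \<open>m\<close> undoes the rounding on the right, and on the left it costs at most the total mass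
  divided by k.\<close>

lemma integral_ca_part_le:
  assumes f: "f \<in> unit_fun"
  shows "integral\<^sup>L ca_part f \<le> m f"
proof (rule field_le_epsilon)
  fix e :: real assume e: "0 < e"
  interpret C: finite_measure ca_part by (rule finite_measure_ca_part)
  \<comment> \<open>Chosen so that the rounding error is at most \<open>e\<close>;
    \<open>Suc\<close> keeps \<open>k\<close> positive when the mass is 0.\<close>
  define k where "k = Suc (nat \<lceil>measure ca_part UNIV / e\<rceil>)"
  have k: "0 < real k" "measure ca_part UNIV / real k \<le> e"
  proof -
    show k0: "0 < real k" by (simp add: k_def)
    have "measure ca_part UNIV / e \<le> real k" unfolding k_def by linarith
    then show "measure ca_part UNIV / real k \<le> e" using e k0 by (simp add: field_simps)
  qed
  define h where "h x = real_of_int \<lfloor>real k * f x\<rfloor> / real k" for x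
  note [measurable] = unit_funD(1)[OF f]
  have hm[measurable]: "h \<in> borel_measurable borel" unfolding h_def by measurable
  have hle: "h x \<le> f x" "f x \<le> h x + 1 / real k" "0 \<le> h x" for x
  proof -
    have "real_of_int \<lfloor>real k * f x\<rfloor> \<le> real k * f x" by linarith
    then show "h x \<le> f x" unfolding h_def using k(1) by (simp add: field_simps)
    have "real k * f x \<le> real_of_int \<lfloor>real k * f x\<rfloor> + 1" by linarith
    then show "f x \<le> h x + 1 / real k" unfolding h_def using k(1) by (simp add: field_simps)
    show "0 \<le> h x" unfolding h_def using unit_funD(2)[OF f, of x] k(1) by simp
  qed
  have h: "h \<in> unit_fun"
    using hm hle(3) order_trans[OF hle(1) unit_funD(3)[OF f]] by (auto simp: unit_fun_def)
  define Y where "Y = (\<lambda>j. real j / real k) ` {..k}"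
  have Y: "finite Y" "Y \<subseteq> {0..1}" using k(1) by (auto simp: Y_def)
  have hY: "h x \<in> Y" for x
  proof -
    have "0 \<le> \<lfloor>real k * f x\<rfloor>" using unit_funD(2)[OF f, of x] by simp
    moreover have "\<lfloor>real k * f x\<rfloor> \<le> int k"
    proof -
      have "real k * f x \<le> real k" using unit_funD(3)[OF f, of x] k(1) by (simp add: mult_left_le)
      then show ?thesis by linarith
    qed
    ultimately have "h x = real (nat \<lfloor>real k * f x\<rfloor>) / real k" "nat \<lfloor>real k * f x\<rfloor> \<le> k"
      by (auto simp: h_def)
    then show ?thesis unfolding Y_def by blast
  qed
  have hi: "h -` {y} \<in> sets borel" for y using measurable_sets[OF hm, of "{y}"] by simp
  have mh: "m h = (\<Sum>y\<in>Y. y * m (indicator (h -` {y})))"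
    using m_finite_valued[OF h Y] hY by simp
  have inti: "integrable ca_part (\<lambda>x. y * indicator (h -` {y}) x :: real)" for y
    using hi C.emeasure_finite[of "h -` {y}"] by (auto simp: less_top[symmetric])
  have heq: "h = (\<lambda>x. \<Sum>y\<in>Y. y * indicator (h -` {y}) x)"
  proof
    fix x
    have "(\<Sum>y\<in>Y. y * indicator (h -` {y}) x) = (\<Sum>y\<in>Y. if y = h x then y else 0)"
      by (intro sum.cong) (auto simp: indicator_def)
    also have "\<dots> = h x" using hY[of x] Y(1) by (simp add: sum.delta)
    finally show "h x = (\<Sum>y\<in>Y. y * indicator (h -` {y}) x)" by simp
  qed
  have "integral\<^sup>L ca_part h = integral\<^sup>L ca_part (\<lambda>x. \<Sum>y\<in>Y. y * indicator (h -` {y}) x)"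
    using heq by (rule arg_cong)
  also have "\<dots> = (\<Sum>y\<in>Y. integral\<^sup>L ca_part (\<lambda>x. y * indicator (h -` {y}) x))"
    by (rule Bochner_Integration.integral_sum) (rule inti)
  also have "\<dots> = (\<Sum>y\<in>Y. y * measure ca_part (h -` {y}))"
    using hi by (intro sum.cong) auto
  also have "\<dots> \<le> (\<Sum>y\<in>Y. y * m (indicator (h -` {y})))"
  proof (rule sum_mono)
    fix y assume "y \<in> Y"
    have "ennreal (measure ca_part (h -` {y})) \<le> ennreal (m (indicator (h -` {y})))"
      using ca_part_le_charge[OF hi, of y] by (simp add: charge_def C.emeasure_eq_measure)
    then have "measure ca_part (h -` {y}) \<le> m (indicator (h -` {y}))"
      using m_nonneg[OF indicator_unit_fun[OF hi]] by (simp add: ennreal_le_iff)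
    then show "y * measure ca_part (h -` {y}) \<le> y * m (indicator (h -` {y}))"
      using \<open>y \<in> Y\<close> Y(2) by (intro mult_left_mono) auto
  qed
  also have "\<dots> \<le> m f" unfolding mh[symmetric] using h f hle(1) by (rule m_mono)
  finally have 1: "integral\<^sup>L ca_part h \<le> m f" .
  have inth: "integrable ca_part h"
    using unit_funD(2,3)[OF h] by (intro C.integrable_const_bound[where B=1]) auto
  have intf: "integrable ca_part f"
    using unit_funD(2,3)[OF f] by (intro C.integrable_const_bound[where B=1]) auto
  have "integral\<^sup>L ca_part f \<le> (\<integral>x. h x + 1 / real k \<partial>ca_part)"
    using hle(2) inth intf by (intro integral_mono) auto
  also have "\<dots> = integral\<^sup>L ca_part h + measure ca_part UNIV / real k"
    using inth by simp
  finally show "integral\<^sup>L ca_part f \<le> m f + e" using 1 k(2) by linarith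
qed

text \<open>For a disjoint countable cover the measure \<rho> of the finite unions tends to 1, and
  finite additivity bounds the partial sums of \<open>charge\<close> from below through
  \<open>low\<close>. The countable additivity of \<rho> thus supplies what \<open>charge\<close>
  lacks: no such cover has total less than a * (1 - d).\<close>

lemma ca_part_UNIV_ge:
  assumes rho: "prob_space \<rho>" "sets \<rho> = sets borel" and a: "0 < a" and d: "0 \<le> d" "d < 1"
    and low: "\<And>A. A \<in> sets borel \<Longrightarrow> a * (measure \<rho> A - d) \<le> m (indicator A)"
  shows "ennreal (a * (1 - d)) \<le> emeasure ca_part UNIV"
proof -
  interpret rho: prob_space \<rho> by fact
  interpret R: sigma_algebra "UNIV :: 'a set" "sets borel"
    using sets.sigma_algebra_axioms[of "borel :: 'a measure"] by simp
  have "ennreal (a * (1 - d)) \<le> (\<Sum>i. charge (B i))"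
    if B: "range B \<subseteq> sets borel" "disjoint_family B" "UNIV \<subseteq> (\<Union>i. B i)" for B :: "nat \<Rightarrow> 'a set"
  proof -
    have Un: "(\<Union>i<k. B i) \<in> sets borel" for k using B(1) by auto
    have "(\<lambda>k. measure \<rho> (\<Union>i<k. B i)) \<longlonglongrightarrow> measure \<rho> (\<Union>k. \<Union>i<k. B i)"
      using Un rho(2) by (intro rho.finite_Lim_measure_incseq) (auto simp: incseq_def intro: less_le_trans)
    also have "(\<Union>k. \<Union>i<k. B i) = space \<rho>"
      using B(3) sets_eq_imp_space_eq[OF rho(2)] by (auto simp: subset_eq) (metis lessThan_iff lessI)
    finally have "(\<lambda>k. ennreal (a * (measure \<rho> (\<Union>i<k. B i) - d))) \<longlonglongrightarrow> ennreal (a * (1 - d))"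
      using rho.prob_space by (auto intro!: tendsto_intros tendsto_ennrealI)
    moreover have "ennreal (a * (measure \<rho> (\<Union>i<k. B i) - d)) \<le> (\<Sum>i. charge (B i))" for k
    proof -
      have "ennreal (a * (measure \<rho> (\<Union>i<k. B i) - d)) \<le> charge (\<Union>i<k. B i)"
        unfolding charge_def using low[OF Un] by (rule ennreal_leI)
      also have "\<dots> = (\<Sum>i<k. charge (B i))"
      proof -
        have "disjoint_family_on B {..<k}" using B(2) by (rule disjoint_family_on_mono[rotated]) simp
        moreover have "B ` {..<k} \<subseteq> sets borel" using B(1) by auto
        ultimately show ?thesis
          using R.additive_sum[OF charge_positive charge_additive, of "{..<k}" B] by simp
      qed
      also have "\<dots> \<le> (\<Sum>i. charge (B i))" by (intro sum_le_suminf) auto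
      finally show ?thesis .
    qed
    ultimately show ?thesis by (intro LIMSEQ_le_const2) auto
  qed
  then show ?thesis
    by (subst emeasure_ca_part) (auto simp: outer_measure_def intro!: INF_greatest)
qed

end

text \<open>The image of \<open>ca_part\<close> under P_u is countably additive and lies below
  \<open>charge\<close>, because \<open>m\<close> is invariant; by maximality it lies below
  \<open>ca_part\<close>. The total masses agree, so the same inequality on complements gives
  equality, and dividing by the positive mass yields a probability.\<close>

lemma (in markov_semigroup) invariant_of_mean:
  assumes "unit_mean m"
    and m_inv: "\<And>f u. f \<in> unit_fun \<Longrightarrow> 0 \<le> u \<Longrightarrow> m (\<lambda>y. integral\<^sup>L (K u y) f) = m f"
    and pos: "emeasure (unit_mean.ca_part m) UNIV > 0"
  shows "\<exists>\<mu>. invariant \<mu>"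
proof -
  interpret unit_mean m by fact
  interpret C: finite_measure ca_part by (rule finite_measure_ca_part)
  have Cfin: "emeasure ca_part UNIV \<noteq> \<infinity>" using C.emeasure_finite by simp
  have step: "emeasure (ca_part \<bind> K u) A = emeasure ca_part A" if u: "0 \<le> u" and A: "A \<in> sets borel" for u A
  proof -
    let ?N = "ca_part \<bind> K u"
    have KC: "K u \<in> ca_part \<rightarrow>\<^sub>M subprob_algebra borel"
      using K_meas2[of u] by (simp cong: measurable_cong_sets)
    have sN: "sets ?N = sets borel" by (rule sets_bind) auto
    have eN: "emeasure ?N A = (\<integral>\<^sup>+y. emeasure (K u y) A \<partial>ca_part)" if "A \<in> sets borel" for A
      using that KC by (intro emeasure_bind) auto
    have "emeasure ?N A \<le> charge A" if A: "A \<in> sets borel" for A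
    proof -
      note iA = indicator_unit_fun[OF A]
      note g = K_unit_fun[OF iA, of u]
      have "emeasure ?N A = (\<integral>\<^sup>+y. ennreal (integral\<^sup>L (K u y) (indicator A)) \<partial>ca_part)"
        unfolding eN[OF A] using A
        by (intro nn_integral_cong) (auto simp: finite_measure.emeasure_eq_measure[OF prob_space.finite_measure[OF prob_K]])
      also have "\<dots> = ennreal (\<integral>y. integral\<^sup>L (K u y) (indicator A) \<partial>ca_part)"
        using unit_funD[OF g]
        by (intro nn_integral_eq_integral C.integrable_const_bound[where B=1] AE_I2) auto
      also have "\<dots> \<le> ennreal (m (\<lambda>y. integral\<^sup>L (K u y) (indicator A)))"
        by (intro ennreal_leI integral_ca_part_le g)
      also have "\<dots> = charge A" using m_inv[OF iA u] by (simp add: charge_def)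
      finally show ?thesis .
    qed
    then have le: "emeasure ?N A \<le> emeasure ca_part A" if "A \<in> sets borel" for A
      using ca_part_greatest[OF sN _ that] by blast
    have tot: "emeasure ?N UNIV = emeasure ca_part UNIV"
      using eN[of UNIV] prob_space.emeasure_space_1[OF prob_K] by simp
    have "emeasure ca_part A = emeasure ca_part UNIV - emeasure ca_part (- A)"
      using A emeasure_compl[of "- A" ca_part] C.emeasure_finite[of "- A"] by (simp add: Compl_eq_Diff_UNIV[symmetric] Diff_Compl)
    also have "\<dots> \<le> emeasure ?N UNIV - emeasure ?N (- A)"
      unfolding tot using le[of "- A"] A by (intro ennreal_minus_mono) auto
    also have "\<dots> = emeasure ?N A"
    proof -
      have fin: "emeasure ?N (- A) \<noteq> \<infinity>"
        using le[of "- A"] A C.emeasure_finite[of "- A"] by (auto simp: top_unique)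
      have "space ?N = UNIV" using sets_eq_imp_space_eq[OF sN] by simp
      then show ?thesis
        using A sN emeasure_compl[of "- A" ?N] fin by (simp add: Compl_eq_Diff_UNIV[symmetric] Diff_Compl)
    qed
    finally show ?thesis using le[OF A] by (intro antisym)
  qed
  define \<mu> where "\<mu> = uniform_measure ca_part UNIV"
  have smu[simp]: "sets \<mu> = sets borel" by (simp add: \<mu>_def)
  have spmu[simp]: "space \<mu> = UNIV" using sets_eq_imp_space_eq[OF smu] by simp
  have pmu: "prob_space \<mu>"
    unfolding \<mu>_def using pos Cfin by (intro prob_space_uniform_measure) auto
  have "\<mu> \<bind> K u = \<mu>" if u: "0 \<le> u" for u
  proof (rule measure_eqI)
    have KM: "K u \<in> \<mu> \<rightarrow>\<^sub>M subprob_algebra borel" "K u \<in> ca_part \<rightarrow>\<^sub>M subprob_algebra borel"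
      using K_meas2[of u] by (simp_all cong: measurable_cong_sets)
    have sN: "sets (\<mu> \<bind> K u) = sets borel" by (rule sets_bind) auto
    then show "sets (\<mu> \<bind> K u) = sets \<mu>" by simp
    fix A assume "A \<in> sets (\<mu> \<bind> K u)"
    then have A: "A \<in> sets borel" using sN by simp
    have Km: "(\<lambda>y. emeasure (K u y) A) \<in> borel_measurable ca_part"
      using measurable_compose[OF KM(2) measurable_emeasure_subprob_algebra[OF A]] .
    have "emeasure (\<mu> \<bind> K u) A = (\<integral>\<^sup>+y. emeasure (K u y) A \<partial>\<mu>)"
      using A KM by (intro emeasure_bind) auto
    also have "\<dots> = (\<integral>\<^sup>+y. emeasure (K u y) A \<partial>ca_part) / emeasure ca_part UNIV"
      unfolding \<mu>_def using Km by (subst nn_integral_uniform_measure) auto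
    also have "(\<integral>\<^sup>+y. emeasure (K u y) A \<partial>ca_part) = emeasure (ca_part \<bind> K u) A"
      using A KM by (intro emeasure_bind[symmetric]) auto
    also have "\<dots> = emeasure ca_part A" by (rule step[OF u A])
    also have "emeasure ca_part A / emeasure ca_part UNIV = emeasure \<mu> A"
      unfolding \<mu>_def using A by simp
    finally show "emeasure (\<mu> \<bind> K u) A = emeasure \<mu> A" .
  qed
  then have "invariant \<mu>" using pmu by (simp add: invariant_def)
  then show ?thesis ..
qed

subsection \<open>Existence of an invariant probability\<close>

locale feller_semigroup = markov_semigroup +
  assumes feller: "0 \<le> t \<Longrightarrow> continuous_on UNIV f \<Longrightarrow> f \<in> unit_fun \<Longrightarrow>
      continuous_on UNIV (\<lambda>x. integral\<^sup>L (K t x) f)"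
begin

lemma cesaro_continuous:
  assumes t: "0 < t" and fc: "continuous_on UNIV f" and f: "f \<in> unit_fun"
  shows "continuous_on UNIV (\<lambda>x. Qf t f x)"
proof (rule continuous_on_sequentiallyI)
  fix u :: "nat \<Rightarrow> 'a" and a assume u: "u \<longlonglongrightarrow> a"
  interpret U: prob_space "unif_time t" using t by (rule prob_space_unif_time)
  note [measurable] = K_time_measurable[OF unit_funD(1)[OF f]]
  have Q: "Qf t f x = (\<integral>s. integral\<^sup>L (K s x) f \<partial>unif_time t)" for x
    using unit_funD(1)[OF f] unit_fun_integrable[OF f prob_space_cesaro[OF t] sets_cesaro]
    by (rule integral_cesaro)
  show "(\<lambda>n. Qf t f (u n)) \<longlonglongrightarrow> Qf t f a"
    unfolding Q
  proof (rule integral_dominated_convergence[where w="\<lambda>_. 1"])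
    show "AE s in unif_time t. (\<lambda>n. integral\<^sup>L (K s (u n)) f) \<longlonglongrightarrow> integral\<^sup>L (K s a) f"
      using AE_unif_time[OF t]
    proof eventually_elim
      case (elim s)
      then have "continuous_on UNIV (\<lambda>x. integral\<^sup>L (K s x) f)" using fc f by (intro feller) auto
      then show ?case using u by (auto simp: continuous_on_sequentially comp_def)
    qed
    show "AE s in unif_time t. norm (integral\<^sup>L (K s (u n)) f) \<le> 1" for n
      using unit_fun_integral_bounds[OF f prob_K sets_K] by (intro AE_I2) auto
  qed (simp_all add: K_time_measurable(1)[OF unit_funD(1)[OF f]])
qed

text \<open>Points w with limsup Q_t(z, B(w, r)) > 0 for all r > 0. Baire's theorem has to produce a
  ball that Q_t(z) keeps charging, so it is applied among these points only.\<close>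

definition recurrent_set :: "'a \<Rightarrow> 'a set" where
  "recurrent_set z = {w. \<forall>r>0. \<exists>c>0. \<exists>\<^sub>F t in at_top. c < measure (cesaro t z) (ball w r)}"

lemma closed_recurrent_set: "closed (recurrent_set z)"
  unfolding closed_def open_contains_ball
proof
  fix w assume "w \<in> - recurrent_set z"
  then obtain r where r: "0 < r" "\<And>c. 0 < c \<Longrightarrow> \<not> (\<exists>\<^sub>F t in at_top. c < measure (cesaro t z) (ball w r))"
    by (auto simp: recurrent_set_def)
  have "ball w (r/2) \<subseteq> - recurrent_set z"
  proof
    fix v assume v: "v \<in> ball w (r/2)"
    have sub: "ball v (r/2) \<subseteq> ball w r"
    proof
      fix y assume "y \<in> ball v (r/2)"
      then show "y \<in> ball w r" using v dist_triangle[of w y v] by (simp add: dist_commute)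
    qed
    have "\<not> (\<exists>\<^sub>F t in at_top. c < measure (cesaro t z) (ball v (r/2)))" if "0 < c" for c
    proof
      assume "\<exists>\<^sub>F t in at_top. c < measure (cesaro t z) (ball v (r/2))"
      then have "\<exists>\<^sub>F t in at_top. c < measure (cesaro t z) (ball v (r/2)) \<and> 0 < t"
        using eventually_gt_at_top by (rule frequently_eventually_frequently)
      then have "\<exists>\<^sub>F t in at_top. c < measure (cesaro t z) (ball w r)"
      proof (rule frequently_elim1)
        fix t assume t: "c < measure (cesaro t z) (ball v (r/2)) \<and> 0 < t"
        then interpret C: prob_space "cesaro t z" by (intro prob_space_cesaro) simp
        show "c < measure (cesaro t z) (ball w r)"
          using t C.finite_measure_mono[OF sub] by simp
      qed
      then show False using r(2)[OF that] by simp
    qed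
    then show "v \<in> - recurrent_set z"
      using r(1) by (auto simp: recurrent_set_def intro!: exI[of _ "r/2"])
  qed
  then show "\<exists>e>0. ball w e \<subseteq> - recurrent_set z" using r(1) by (intro exI[of _ "r/2"]) simp
qed

text \<open>Suppose P_s(z, .) charged every neighbourhood of a nonrecurrent w. By the Feller
  property it would charge a given one uniformly from all starting points near z, where Q_t(z) has
  mass above some a > 0 at arbitrarily large t. As Q_t P_s is nearly Q_t, that neighbourhood of w
  would keep a positive share of Q_t(z). Hence nonrecurrent points have null balls, and by Lindelof
  countably many of them suffice.\<close>

lemma K_recurrent_set:
  assumes z: "z \<in> recurrent_set z" and s: "0 \<le> s"
  shows "emeasure (K s z) (- recurrent_set z) = 0"
proof -
  interpret KP: prob_space "K s z" by (rule prob_K)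
  have ball0: "\<exists>r>0. ball w r \<in> null_sets (K s z)" if w: "w \<notin> recurrent_set z" for w
  proof -
    from w obtain r where r: "0 < r" "\<And>c. 0 < c \<Longrightarrow> \<not> (\<exists>\<^sub>F t in at_top. c < measure (cesaro t z) (ball w r))"
      by (auto simp: recurrent_set_def)
    \<comment> \<open>Continuous, positive exactly on the ball and below its indicator: the Feller
      property applies to \<open>f\<close>, while its integral still detects whether the ball is
      null.\<close>
    define f where "f y = max 0 (min 1 (r - dist w y))" for y
    have fc: "continuous_on UNIV f" unfolding f_def by (intro continuous_intros)
    have fU: "f \<in> unit_fun"
      using borel_measurable_continuous_onI[OF fc] by (auto simp: unit_fun_def f_def)
    have fpos: "0 < f y \<longleftrightarrow> y \<in> ball w r" for y by (auto simp: f_def)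
    have fle: "f y \<le> indicator (ball w r) y" for y
      by (auto simp: f_def indicator_def)
    have "integral\<^sup>L (K s z) f = 0"
    proof (rule ccontr)
      assume n0: "integral\<^sup>L (K s z) f \<noteq> 0"
      define c where "c = integral\<^sup>L (K s z) f"
      have c: "0 < c" using n0 unit_fun_integral_bounds(1)[OF fU prob_K sets_K, of s z] by (simp add: c_def)
      note g = K_unit_fun[OF fU, of s]
      have "continuous_on UNIV (\<lambda>y. integral\<^sup>L (K s y) f)" using s fc fU by (rule feller)
      then have "\<exists>\<delta>>0. \<forall>y. dist y z < \<delta> \<longrightarrow> dist (integral\<^sup>L (K s y) f) (integral\<^sup>L (K s z) f) < c / 2"
        using c unfolding continuous_on_iff by (metis UNIV_I half_gt_zero)
      then obtain \<delta> where \<delta>: "0 < \<delta>" "\<And>y. dist y z < \<delta> \<Longrightarrow> dist (integral\<^sup>L (K s y) f) (integral\<^sup>L (K s z) f) < c / 2"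
        by blast
      have low: "c / 2 * indicator (ball z \<delta>) y \<le> integral\<^sup>L (K s y) f" for y
      proof (cases "y \<in> ball z \<delta>")
        case True
        then have "dist (integral\<^sup>L (K s y) f) c < c / 2" using \<delta>(2)[of y] by (simp add: dist_commute c_def)
        then have "c / 2 \<le> integral\<^sup>L (K s y) f" unfolding dist_real_def by linarith
        then show ?thesis using True by simp
      next
        case False
        then show ?thesis using unit_funD(2)[OF g, of y] by simp
      qed
      from z \<delta>(1) obtain a where a: "0 < a" "\<exists>\<^sub>F t in at_top. a < measure (cesaro t z) (ball z \<delta>)"
        unfolding recurrent_set_def by blast
      \<comment> \<open>Mass above \<open>a\<close> and values at least c / 2 give at least c * a /
        2 on one side. The two errors, the mass near \<open>w\<close> and s / t, are allowed c * a /
        8 each, together only c * a / 4.\<close>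
      have "0 < c * a / 8" using a c by simp
      from r(2)[OF this] have e1: "\<forall>\<^sub>F t in at_top. measure (cesaro t z) (ball w r) \<le> c * a / 8"
        by (simp add: not_frequently not_less)
      have "((\<lambda>t. s / t) \<longlongrightarrow> 0) at_top"
        by (rule tendsto_divide_0[OF tendsto_const filterlim_at_top_imp_at_infinity[OF filterlim_ident]])
      then have e2: "\<forall>\<^sub>F t in at_top. s / t < c * a / 8"
        using \<open>0 < c * a / 8\<close> order_tendstoD(2) by blast
      have "\<exists>\<^sub>F t in at_top. a < measure (cesaro t z) (ball z \<delta>) \<and>
          (measure (cesaro t z) (ball w r) \<le> c * a / 8 \<and> s / t < c * a / 8 \<and> 0 < t)"
        using a(2) eventually_conj[OF e1 eventually_conj[OF e2 eventually_gt_at_top[of "0::real"]]]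
        by (rule frequently_eventually_frequently)
      then obtain t where t: "a < measure (cesaro t z) (ball z \<delta>)" "measure (cesaro t z) (ball w r) \<le> c * a / 8"
          "s / t < c * a / 8" "0 < t"
        by (auto dest: frequently_ex)
      interpret C: prob_space "cesaro t z" using t(4) by (rule prob_space_cesaro)
      have "c / 2 * measure (cesaro t z) (ball z \<delta>) = (\<integral>y. c / 2 * indicator (ball z \<delta>) y \<partial>cesaro t z)"
        by simp
      also have "\<dots> \<le> (\<integral>y. integral\<^sup>L (K s y) f \<partial>cesaro t z)"
        using low unit_fun_integrable[OF g C.prob_space_axioms sets_cesaro]
        by (intro integral_mono) (auto simp: C.emeasure_finite less_top[symmetric])
      also have "\<dots> \<le> Qf t f z + s / t"
        using cesaro_K_close[OF fU t(4) s, of z] by linarith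
      also have "Qf t f z \<le> (\<integral>y. indicator (ball w r) y \<partial>cesaro t z)"
        using fle unit_fun_integrable[OF fU C.prob_space_axioms sets_cesaro]
        by (intro integral_mono) (auto simp: C.emeasure_finite less_top[symmetric])
      also have "\<dots> = measure (cesaro t z) (ball w r)" by simp
      finally have "c / 2 * measure (cesaro t z) (ball z \<delta>) \<le> c * a / 4" using t(2,3) by linarith
      moreover have "c / 2 * a \<le> c / 2 * measure (cesaro t z) (ball z \<delta>)"
        using t(1) c by (intro mult_left_mono) auto
      ultimately have "c / 2 * a \<le> c * a / 4" by linarith
      then show False using mult_pos_pos[OF c a(1)] by linarith
    qed
    then have "AE y in K s z. f y = 0"
      using unit_fun_integrable[OF fU prob_K sets_K] unit_funD(2)[OF fU]
      by (subst (asm) integral_nonneg_eq_0_iff_AE) auto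
    then have "AE y in K s z. y \<notin> ball w r"
      by eventually_elim (use fpos in force)
    then have "ball w r \<in> null_sets (K s z)"
      by (subst AE_iff_null_sets) auto
    then show ?thesis using r(1) by blast
  qed
  then obtain rr where rr: "\<And>w. w \<notin> recurrent_set z \<Longrightarrow> 0 < rr w \<and> ball w (rr w) \<in> null_sets (K s z)"
    by metis
  obtain \<F> where F: "\<F> \<subseteq> (\<lambda>w. ball w (rr w)) ` (- recurrent_set z)" "countable \<F>"
      "\<Union>\<F> = \<Union>((\<lambda>w. ball w (rr w)) ` (- recurrent_set z))"
    using Lindelof[of "(\<lambda>w. ball w (rr w)) ` (- recurrent_set z)"] by blast
  have "(\<Union>U\<in>\<F>. U) \<in> null_sets (K s z)"
    using F(1,2) rr by (intro null_sets_UN') auto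
  moreover have "- recurrent_set z \<subseteq> (\<Union>U\<in>\<F>. U)" using F(3) rr by force
  ultimately show ?thesis
    by (metis emeasure_mono le_zero_eq null_setsD1 null_setsD2)
qed

lemma AE_cesaro_recurrent_set:
  assumes z: "z \<in> recurrent_set z" and t: "0 < t"
  shows "AE y in cesaro t z. y \<in> recurrent_set z"
proof -
  have S: "recurrent_set z \<in> sets borel" using closed_recurrent_set by simp
  have "(\<lambda>s. K s z) \<in> unif_time t \<rightarrow>\<^sub>M subprob_algebra borel" by measurable
  moreover have "Measurable.pred borel (\<lambda>y. y \<in> recurrent_set z)" using S by simp
  ultimately have "(AE y in cesaro t z. y \<in> recurrent_set z) \<longleftrightarrow>
      (AE s in unif_time t. AE y in K s z. y \<in> recurrent_set z)"
    unfolding cesaro_def by (rule AE_bind)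
  also have "\<dots>"
    using AE_unif_time[OF t]
  proof eventually_elim
    case (elim s)
    show ?case
      by (rule AE_I[of _ _ "- recurrent_set z"]) (use K_recurrent_set[OF z, of s] elim S in auto)
  qed
  finally show ?thesis .
qed

text \<open>Baire's theorem is applied inside \<open>recurrent_set z\<close>, which carries all \<open>Q\<^sub>t(z)\<close>. The cluster point
  then dominates a multiple of \<open>Q\<^sub>T(z) - 1/2\<close>, so that its countably additive part is nonzero.\<close>

lemma invariant_exists:
  assumes z: "z \<in> recurrent_set z" and merge: "\<And>x. merges x z"
  shows "\<exists>\<mu>. invariant \<mu>"
proof -
  let ?S = "recurrent_set z"
  \<comment> \<open>Only continuous \<open>f\<close> are tested, so each \<open>G N\<close> is an
    intersection of closed sets; Borel sets are recovered by
    \<open>measure_ge_of_continuous_close\<close>. The offset 1 keeps all times positive, including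
    the time \<open>T\<close> used below.\<close>
  define G where "G N = {y. \<forall>t\<ge>real N + 1. \<forall>f. continuous_on UNIV f \<longrightarrow> f \<in> unit_fun \<longrightarrow>
      \<bar>Qf t f y - Qf t f z\<bar> \<le> 1/2}" for N :: nat
  have closed_G: "closed (G N)" for N
  proof -
    have "G N = (\<Inter>t\<in>{real N + 1..}. \<Inter>f\<in>{f. continuous_on UNIV f \<and> f \<in> unit_fun}.
        {y. \<bar>Qf t f y - Qf t f z\<bar> \<le> 1/2})"
      by (auto simp: G_def)
    moreover have "closed {y. \<bar>Qf t f y - Qf t f z\<bar> \<le> 1/2}"
      if "t \<ge> real N + 1" "continuous_on UNIV f" "f \<in> unit_fun" for t f
      using that by (intro closed_Collect_le continuous_intros cesaro_continuous) auto
    ultimately show ?thesis by (auto intro!: closed_INT)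
  qed
  have cover: "\<exists>N. y \<in> G N" for y
  proof -
    have "eventually (\<lambda>t. \<forall>f\<in>unit_fun. \<bar>Qf t f y - Qf t f z\<bar> < 1/2) at_top"
      using merge[of y] unfolding merges_def by (meson half_gt_zero zero_less_one)
    then obtain T where T: "\<And>t f. t \<ge> T \<Longrightarrow> f \<in> unit_fun \<Longrightarrow> \<bar>Qf t f y - Qf t f z\<bar> < 1/2"
      unfolding eventually_at_top_linorder by blast
    have "y \<in> G (nat \<lceil>T\<rceil>)"
      unfolding G_def
    proof (intro CollectI allI impI)
      fix t :: real and f :: "'a \<Rightarrow> real" assume "real (nat \<lceil>T\<rceil>) + 1 \<le> t" and f: "f \<in> unit_fun"
      then have "T \<le> t" by linarith
      from T[OF this f] show "\<bar>Qf t f y - Qf t f z\<bar> \<le> 1/2" by simp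
    qed
    then show ?thesis ..
  qed
  \<comment> \<open>A closed subset of a Polish space is completely metrizable, so some
    \<open>G N\<close> has interior relative to \<open>recurrent_set z\<close>. Relative interior
    suffices because Q_t(z) gives no mass to the complement.\<close>
  have "\<exists>N. top_of_set ?S interior_of (?S \<inter> G N) \<noteq> {}"
  proof (rule ccontr)
    assume "\<not> ?thesis"
    then have "top_of_set ?S interior_of \<Union>(range (\<lambda>N. ?S \<inter> G N)) = {}"
      using closed_G closed_recurrent_set[of z]
      by (intro Baire_category_alt disjI1 completely_metrizable_space_closedin completely_metrizable_space_euclidean)
         (auto intro: closedin_closed_Int simp: closed_closedin[symmetric])
    moreover have "\<Union>(range (\<lambda>N. ?S \<inter> G N)) = ?S" using cover by auto
    ultimately have "?S = {}" using interior_of_topspace[of "top_of_set ?S"] by simp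
    then show False using z by simp
  qed
  then obtain N w where "w \<in> top_of_set ?S interior_of (?S \<inter> G N)" by blast
  then obtain W where W: "openin (top_of_set ?S) W" "w \<in> W" "W \<subseteq> ?S \<inter> G N"
    unfolding interior_of_def by blast
  then obtain r where r: "0 < r" "ball w r \<inter> ?S \<subseteq> W"
    unfolding openin_contains_ball by blast
  have wS: "w \<in> ?S" using W by blast
  define T where "T = real N + 1"
  have T: "0 < T" by (simp add: T_def)
  from wS r(1) obtain a where a: "0 < a" "\<exists>\<^sub>F t in at_top. a < measure (cesaro t z) (ball w r)"
    unfolding recurrent_set_def by blast
  have "\<exists>t\<ge>real n + 1. a < measure (cesaro t z) (ball w r)" for n
    using a(2) unfolding frequently_def eventually_at_top_linorder by blast
  then obtain t where t: "\<And>n::nat. t n \<ge> real n + 1" "\<And>n. a < measure (cesaro (t n) z) (ball w r)" by metis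
  have tpos: "0 < t n" for n using t(1)[of n] by linarith
  have tlim: "filterlim t at_top sequentially"
  proof (rule filterlim_at_top_mono[OF filterlim_real_sequentially])
    show "\<forall>\<^sub>F n in sequentially. real n \<le> t n"
    proof (intro always_eventually allI)
      fix n show "real n \<le> t n" using t(1)[of n] by linarith
    qed
  qed
  \<comment> \<open>The default 0 outside \<open>unit_fun\<close> keeps all values in [0, 1], so
    that compactness applies to all functions at once.\<close>
  define \<phi> where "\<phi> n f = (if f \<in> unit_fun then Qf (t n) f z else 0)" for n f
  have "\<phi> n f \<in> {0..1}" for n f
    using unit_fun_integral_bounds[OF _ prob_space_cesaro[OF tpos] sets_cesaro] by (auto simp: \<phi>_def)
  then obtain m F where F: "F \<noteq> bot" "F \<le> sequentially" "\<And>f. ((\<lambda>n. \<phi> n f) \<longlongrightarrow> m f) F"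
    using bounded_pointwise_cluster[of \<phi>] by blast
  have mlim: "((\<lambda>n. Qf (t n) f z) \<longlongrightarrow> m f) F" if "f \<in> unit_fun" for f
    using F(3)[of f] that by (simp add: \<phi>_def)
  have int: "integrable (cesaro (t n) z) f" if "f \<in> unit_fun" for f n
    using that prob_space_cesaro[OF tpos] by (rule unit_fun_integrable) simp
  have inv_t: "((\<lambda>n. c / t n) \<longlongrightarrow> 0) F" for c
    by (rule tendsto_mono[OF F(2) tendsto_divide_0[OF tendsto_const filterlim_at_top_imp_at_infinity[OF tlim]]])
  have mean: "unit_mean m"
  proof
    fix f :: "'a \<Rightarrow> real" assume f: "f \<in> unit_fun"
    show "0 \<le> m f"
      using unit_fun_integral_bounds(1)[OF f prob_space_cesaro[OF tpos] sets_cesaro]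
      by (intro tendsto_lowerbound[OF mlim[OF f] _ F(1)]) auto
    fix g assume g: "g \<in> unit_fun" and fg: "(\<lambda>x. f x + g x) \<in> unit_fun"
    have "((\<lambda>n. Qf (t n) (\<lambda>x. f x + g x) z) \<longlongrightarrow> m f + m g) F"
      using tendsto_add[OF mlim[OF f] mlim[OF g]] int[OF f] int[OF g] by simp
    from tendsto_unique[OF F(1) mlim[OF fg] this]
    show "m (\<lambda>x. f x + g x) = m f + m g" .
  next
    fix f :: "'a \<Rightarrow> real" and c :: real assume f: "f \<in> unit_fun" and c: "0 \<le> c" "c \<le> 1"
    have cf: "(\<lambda>x. c * f x) \<in> unit_fun"
      using unit_funD[OF f] c by (auto simp: unit_fun_def intro: mult_le_one)
    have "((\<lambda>n. Qf (t n) (\<lambda>x. c * f x) z) \<longlongrightarrow> c * m f) F"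
      using tendsto_mult[OF tendsto_const mlim[OF f], of c] by simp
    from tendsto_unique[OF F(1) mlim[OF cf] this]
    show "m (\<lambda>x. c * f x) = c * m f" .
  qed
  have m_inv: "m (\<lambda>y. integral\<^sup>L (K u y) f) = m f" if f: "f \<in> unit_fun" and u: "0 \<le> u" for f u
  proof -
    have "((\<lambda>n. Qf (t n) (\<lambda>y. integral\<^sup>L (K u y) f) z - Qf (t n) f z) \<longlongrightarrow> 0) F"
      using cesaro_K_close[OF f tpos u]
      by (intro Lim_null_comparison[OF _ inv_t[of u]]) (auto intro: always_eventually)
    moreover have "((\<lambda>n. Qf (t n) (\<lambda>y. integral\<^sup>L (K u y) f) z - Qf (t n) f z) \<longlongrightarrow>
        m (\<lambda>y. integral\<^sup>L (K u y) f) - m f) F"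
      using mlim[OF K_unit_fun[OF f, of u]] mlim[OF f] by (rule tendsto_diff)
    ultimately show ?thesis using tendsto_unique[OF F(1)] by fastforce
  qed
  \<comment> \<open>For large n, Q_t(z) with t = t n is nearly a mixture of the Q_T(y) over y
    distributed as Q_t(z). More than \<open>a\<close> of the mass of y lies in the ball, where
    Q_T(y) gives \<open>A\<close> at least Q_T(z)(A) - 1/2, and the other y contribute
    nonnegatively. If that difference is not positive, the claim is trivial.\<close>
  have low: "a * (measure (cesaro T z) A - 1/2) \<le> m (indicator A)" if A: "A \<in> sets borel" for A
  proof (cases "measure (cesaro T z) A \<le> 1/2")
    case True
    have "0 \<le> m (indicator A)" using unit_mean.m_nonneg[OF mean indicator_unit_fun[OF A]] .
    moreover have "a * (measure (cesaro T z) A - 1/2) \<le> 0" using True a(1) by (simp add: mult_nonneg_nonpos)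
    ultimately show ?thesis by linarith
  next
    case False
    define b where "b = measure (cesaro T z) A - 1/2"
    have b: "0 < b" using False by (simp add: b_def)
    have iA: "(indicator A :: 'a \<Rightarrow> real) \<in> unit_fun" using A by (rule indicator_unit_fun)
    note g = cesaro_unit_fun[OF iA T]
    have bd: "a * b - T / t n \<le> Qf (t n) (indicator A) z" for n
    proof -
      interpret C: prob_space "cesaro (t n) z" using tpos by (rule prob_space_cesaro)
      have "b * a \<le> b * measure (cesaro (t n) z) (ball w r)"
        using b t(2)[of n] by (intro mult_left_mono) auto
      also have "\<dots> = (\<integral>y. b * indicator (ball w r) y \<partial>cesaro (t n) z)" by simp
      also have "\<dots> \<le> (\<integral>y. Qf T (indicator A) y \<partial>cesaro (t n) z)"
      proof (rule integral_mono_AE)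
        show "integrable (cesaro (t n) z) (\<lambda>y. b * indicator (ball w r) y)"
          by (auto simp: C.emeasure_finite less_top[symmetric])
        show "integrable (cesaro (t n) z) (\<lambda>y. Qf T (indicator A) y)" using int[OF g] .
        show "AE y in cesaro (t n) z. b * indicator (ball w r) y \<le> Qf T (indicator A) y"
          using AE_cesaro_recurrent_set[OF z tpos[of n]]
        proof eventually_elim
          case (elim y)
          show ?case
          proof (cases "y \<in> ball w r")
            case True
            then have "y \<in> G N" using elim r(2) W(3) by blast
            then have "\<bar>integral\<^sup>L (cesaro T y) f - integral\<^sup>L (cesaro T z) f\<bar> \<le> 1/2"
              if "continuous_on UNIV f" "f \<in> unit_fun" for f
              using that by (auto simp: G_def T_def)
            then have "b \<le> measure (cesaro T y) A"
              unfolding b_def using A prob_space_cesaro[OF T]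
              by (intro measure_ge_of_continuous_close) auto
            then show ?thesis using True A by simp
          next
            case False
            then show ?thesis using unit_funD(2)[OF g, of y] by simp
          qed
        qed
      qed
      also have "\<dots> \<le> Qf (t n) (indicator A) z + T / t n"
        using cesaro_cesaro_close[OF iA tpos T, of n z] by linarith
      finally show ?thesis by (simp add: mult.commute)
    qed
    have "((\<lambda>n. a * b - T / t n) \<longlongrightarrow> a * b - 0) F"
      by (intro tendsto_intros inv_t)
    then have "a * b - 0 \<le> m (indicator A)"
      by (rule tendsto_le[OF F(1) mlim[OF iA]]) (use bd in auto)
    then show ?thesis by (simp add: b_def)
  qed
  have "ennreal (a * (1 - 1/2)) \<le> emeasure (unit_mean.ca_part m) UNIV"
    by (rule unit_mean.ca_part_UNIV_ge[OF mean prob_space_cesaro[OF T] sets_cesaro a(1) _ _ low]) auto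
  moreover have "0 < ennreal (a * (1 - 1/2))" using a(1) by simp
  ultimately have "0 < emeasure (unit_mean.ca_part m) UNIV" by (rule less_le_trans[rotated])
  with mean m_inv show ?thesis by (rule invariant_of_mean)
qed

end

subsection \<open>Weighted total variation and couplings\<close>

definition add_measure :: "'b measure \<Rightarrow> 'b measure \<Rightarrow> 'b measure" where
  "add_measure A B = measure_of (space A) (sets A) (\<lambda>E. emeasure A E + emeasure B E)"

lemma sets_add_measure [simp, measurable_cong]: "sets (add_measure A B) = sets A"
  by (simp add: add_measure_def sets.sigma_sets_eq sets.space_closed)

lemma space_add_measure [simp]: "space (add_measure A B) = space A"
  by (simp add: add_measure_def space_measure_of_conv)

lemma emeasure_add_measure:
  assumes sets: "sets B = sets A" and E: "E \<in> sets A"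
  shows "emeasure (add_measure A B) E = emeasure A E + emeasure B E"
  unfolding add_measure_def
proof (rule emeasure_measure_of_sigma)
  show "sigma_algebra (space A) (sets A)" ..
  show "positive (sets A) (\<lambda>E. emeasure A E + emeasure B E)" by (simp add: positive_def)
  show "countably_additive (sets A) (\<lambda>E. emeasure A E + emeasure B E)"
  proof (rule countably_additiveI)
    fix F :: "nat \<Rightarrow> _" assume F: "range F \<subseteq> sets A" "disjoint_family F"
    have "(\<Sum>i. emeasure A (F i) + emeasure B (F i)) = (\<Sum>i. emeasure A (F i)) + (\<Sum>i. emeasure B (F i))"
      by (rule suminf_add[symmetric]) auto
    also have "(\<Sum>i. emeasure A (F i)) = emeasure A (\<Union>i. F i)" using F by (rule suminf_emeasure)
    also have "(\<Sum>i. emeasure B (F i)) = emeasure B (\<Union>i. F i)" using F sets by (intro suminf_emeasure) auto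
    finally show "(\<Sum>i. emeasure A (F i) + emeasure B (F i)) = emeasure A (\<Union>i. F i) + emeasure B (\<Union>i. F i)" .
  qed
qed fact

lemma nn_integral_add_measure:
  assumes sets[measurable_cong]: "sets B = sets A" and f: "f \<in> borel_measurable A"
  shows "(\<integral>\<^sup>+x. f x \<partial>add_measure A B) = (\<integral>\<^sup>+x. f x \<partial>A) + (\<integral>\<^sup>+x. f x \<partial>B)"
  using f
proof induct
  case (cong f g)
  then show ?case
    using sets_eq_imp_space_eq[OF sets] by (auto cong: nn_integral_cong_simp)
next
  case (set E)
  then show ?case using sets by (simp add: emeasure_add_measure)
next
  case (mult u c)
  then show ?case by (simp add: nn_integral_cmult distrib_left)
next
  case (add u v)
  then show ?case by (simp add: nn_integral_add ac_simps)
next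
  case (seq U)
  have m: "U i \<in> borel_measurable B" "U i \<in> borel_measurable (add_measure A B)" for i using seq(1) by simp_all
  have inc: "incseq (\<lambda>i. \<integral>\<^sup>+x. U i x \<partial>A)" "incseq (\<lambda>i. \<integral>\<^sup>+x. U i x \<partial>B)"
    using \<open>incseq U\<close> by (auto simp: incseq_def le_fun_def intro!: nn_integral_mono)
  have "(\<integral>\<^sup>+x. (SUP i. U i x) \<partial>add_measure A B) = (SUP i. \<integral>\<^sup>+x. U i x \<partial>add_measure A B)"
    using \<open>incseq U\<close> m by (intro nn_integral_monotone_convergence_SUP) auto
  also have "\<dots> = (SUP i. (\<integral>\<^sup>+x. U i x \<partial>A) + (\<integral>\<^sup>+x. U i x \<partial>B))" using seq by simp
  also have "\<dots> = (SUP i. \<integral>\<^sup>+x. U i x \<partial>A) + (SUP i. \<integral>\<^sup>+x. U i x \<partial>B)"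
    using inc by (rule ennreal_SUP_add)
  also have "(SUP i. \<integral>\<^sup>+x. U i x \<partial>A) = (\<integral>\<^sup>+x. (SUP i. U i x) \<partial>A)"
    using seq(1) \<open>incseq U\<close> by (intro nn_integral_monotone_convergence_SUP[symmetric]) auto
  also have "(SUP i. \<integral>\<^sup>+x. U i x \<partial>B) = (\<integral>\<^sup>+x. (SUP i. U i x) \<partial>B)"
    using \<open>incseq U\<close> m by (intro nn_integral_monotone_convergence_SUP[symmetric]) auto
  finally show ?case by (simp add: image_comp)
qed

text \<open>For every coupling the difference is the integral of f(x) - f(y), which vanishes on the
  diagonal and is at most 2 + V(x) + V(y) off it. This is the easy half of Kantorovich
  duality.\<close>

lemma integral_diff_le_dV:
  fixes V :: "'a::polish_space \<Rightarrow> real"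
  assumes Vnn: "\<And>x. 0 \<le> V x" and fm[measurable]: "f \<in> borel_measurable borel" and fV: "\<And>x. \<bar>f x\<bar> \<le> 1 + V x"
    and int: "integrable \<mu> f" "integrable \<nu> f"
  shows "ennreal \<bar>integral\<^sup>L \<mu> f - integral\<^sup>L \<nu> f\<bar> \<le> dV V \<mu> \<nu>"
  unfolding dV_def
proof (rule INF_greatest)
  fix \<pi> :: "('a \<times> 'a) measure" assume "\<pi> \<in> couplings \<mu> \<nu>"
  then have p: "prob_space \<pi>" and s[measurable_cong]: "sets \<pi> = sets (borel \<Otimes>\<^sub>M borel)"
    and m: "distr \<pi> borel fst = \<mu>" "distr \<pi> borel snd = \<nu>"
    by (auto simp: couplings_def)
  have fs[measurable]: "fst \<in> \<pi> \<rightarrow>\<^sub>M borel" "snd \<in> \<pi> \<rightarrow>\<^sub>M borel" by measurable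
  have i1: "integrable \<pi> (\<lambda>p. f (fst p))" and i2: "integrable \<pi> (\<lambda>p. f (snd p))"
    using int unfolding m[symmetric] by (auto simp: integrable_distr_eq)
  have "integral\<^sup>L \<mu> f - integral\<^sup>L \<nu> f = (\<integral>p. f (fst p) - f (snd p) \<partial>\<pi>)"
    unfolding m[symmetric] using i1 i2 by (simp add: integral_distr)
  then have "ennreal \<bar>integral\<^sup>L \<mu> f - integral\<^sup>L \<nu> f\<bar> \<le> (\<integral>\<^sup>+p. norm (f (fst p) - f (snd p)) \<partial>\<pi>)"
    using integral_norm_bound_ennreal[of \<pi> "\<lambda>p. f (fst p) - f (snd p)"] i1 i2 by simp
  also have "\<dots> \<le> (\<integral>\<^sup>+p. indicator {p. fst p \<noteq> snd p} p * ennreal (2 + V (fst p) + V (snd p)) \<partial>\<pi>)"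
  proof (rule nn_integral_mono)
    fix p
    show "ennreal (norm (f (fst p) - f (snd p))) \<le> indicator {p. fst p \<noteq> snd p} p * ennreal (2 + V (fst p) + V (snd p))"
      using fV[of "fst p"] fV[of "snd p"] by (auto simp: indicator_def intro!: ennreal_leI)
  qed
  finally show "ennreal \<bar>integral\<^sup>L \<mu> f - integral\<^sup>L \<nu> f\<bar> \<le>
      (\<integral>\<^sup>+p. indicator {p. fst p \<noteq> snd p} p * ennreal (2 + V (fst p) + V (snd p)) \<partial>\<pi>)" .
qed

text \<open>The coupling puts the common part of \<open>\<mu>\<close> and \<open>\<nu>\<close> (read off a Hahn decomposition) on the
  diagonal and makes the remainders independent. If the remainders vanish then the scaling factor
  is \<open>1 / 0 = \<infinity>\<close>, which is harmless because it multiplies the zero measure.\<close>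

lemma dV_le_tails:
  fixes V :: "'a::polish_space \<Rightarrow> real"
  assumes V[measurable]: "V \<in> borel_measurable borel" and Vnn: "\<And>x. 0 \<le> V x"
    and mu: "prob_space \<mu>" "sets \<mu> = sets borel" and nu: "prob_space \<nu>" "sets \<nu> = sets borel"
    and tv: "\<And>A. A \<in> sets borel \<Longrightarrow> \<bar>measure \<mu> A - measure \<nu> A\<bar> \<le> d" and L: "0 \<le> L"
  shows "dV V \<mu> \<nu> \<le> ennreal (2 * L * d) +
    ((\<integral>\<^sup>+x. ennreal (1 + V x) * indicator {x. L \<le> 1 + V x} x \<partial>\<mu>) +
     (\<integral>\<^sup>+x. ennreal (1 + V x) * indicator {x. L \<le> 1 + V x} x \<partial>\<nu>))"
proof -
  interpret mu: prob_space \<mu> by fact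
  interpret nu: prob_space \<nu> by fact
  note [measurable_cong] = mu(2) nu(2)
  have sp: "space \<mu> = UNIV" "space \<nu> = UNIV"
    using sets_eq_imp_space_eq[OF mu(2)] sets_eq_imp_space_eq[OF nu(2)] by auto
  obtain Y where Ym: "Y \<in> sets \<mu>" and Y1: "\<And>X. X \<in> sets \<mu> \<Longrightarrow> X \<subseteq> Y \<Longrightarrow> emeasure \<nu> X \<le> emeasure \<mu> X"
    and Y2: "\<And>X. X \<in> sets \<mu> \<Longrightarrow> X \<inter> Y = {} \<Longrightarrow> emeasure \<mu> X \<le> emeasure \<nu> X"
    using finite_unsigned_Hahn_decomposition[OF mu.finite_measure_axioms nu.finite_measure_axioms] mu(2) nu(2) by auto
  have Y[measurable]: "Y \<in> sets borel" using Ym mu(2) by simp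
  \<comment> \<open>With \<open>Y\<close> the set on which \<mu> dominates \<nu>, these are the
    positive and the negative part of \<mu> - \<nu>, living on \<open>Y\<close> and its complement,
    and the minimum of \<mu> and \<nu>.\<close>
  define \<alpha> where "\<alpha> = diff_measure (density \<mu> (indicator Y)) (density \<nu> (indicator Y))"
  define \<beta> where "\<beta> = diff_measure (density \<nu> (indicator (- Y))) (density \<mu> (indicator (- Y)))"
  define \<gamma> where "\<gamma> = add_measure (density \<nu> (indicator Y)) (density \<mu> (indicator (- Y)))"
  have dens: "emeasure (density N (indicator B)) A = emeasure N (A \<inter> B)"
    if "N = \<mu> \<or> N = \<nu>" "A \<in> sets borel" "B \<in> sets borel" for N A B
  proof -
    have s: "sets N = sets borel" using that mu(2) nu(2) by auto
    have "emeasure (density N (indicator B)) A = (\<integral>\<^sup>+x. indicator B x * indicator A x \<partial>N)"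
      using that s by (intro emeasure_density) (auto cong: measurable_cong_sets)
    also have "\<dots> = (\<integral>\<^sup>+x. indicator (A \<inter> B) x \<partial>N)"
      by (intro nn_integral_cong) (auto split: split_indicator)
    also have "\<dots> = emeasure N (A \<inter> B)" using that s by (intro nn_integral_indicator) auto
    finally show ?thesis .
  qed
  have finD: "finite_measure (density N (indicator B))" if "N = \<mu> \<or> N = \<nu>" "B \<in> sets borel" for N B
    using that sp dens[of N UNIV B] mu.emeasure_finite[of B] nu.emeasure_finite[of B]
    by (intro finite_measureI) auto
  have ea: "emeasure \<alpha> A = emeasure \<mu> (A \<inter> Y) - emeasure \<nu> (A \<inter> Y)" if A: "A \<in> sets borel" for A
    unfolding \<alpha>_def
    using A finD[of \<mu> Y] finD[of \<nu> Y] mu(2) nu(2) Y1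
    by (subst emeasure_diff_measure) (auto simp: dens)
  have eb: "emeasure \<beta> A = emeasure \<nu> (A \<inter> - Y) - emeasure \<mu> (A \<inter> - Y)" if A: "A \<in> sets borel" for A
    unfolding \<beta>_def
    using A finD[of \<mu> "- Y"] finD[of \<nu> "- Y"] mu(2) nu(2) Y2
    by (subst emeasure_diff_measure) (auto simp: dens)
  have eg: "emeasure \<gamma> A = emeasure \<nu> (A \<inter> Y) + emeasure \<mu> (A \<inter> - Y)" if A: "A \<in> sets borel" for A
    unfolding \<gamma>_def using A mu(2) nu(2) by (subst emeasure_add_measure) (auto simp: dens)
  have sets_abg[simp, measurable_cong]: "sets \<alpha> = sets borel" "sets \<beta> = sets borel" "sets \<gamma> = sets borel"
    using mu(2) nu(2) by (auto simp: \<alpha>_def \<beta>_def \<gamma>_def)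
  have space_abg[simp]: "space \<alpha> = UNIV" "space \<beta> = UNIV" "space \<gamma> = UNIV"
    using sets_eq_imp_space_eq[OF sets_abg(1)] sets_eq_imp_space_eq[OF sets_abg(2)]
      sets_eq_imp_space_eq[OF sets_abg(3)] by auto
  have split_mu: "emeasure \<mu> (A \<inter> Y) + emeasure \<mu> (A \<inter> - Y) = emeasure \<mu> A" if "A \<in> sets borel" for A
    using that mu(2) by (subst plus_emeasure) (auto simp: Int_Un_distrib[symmetric])
  have split_nu: "emeasure \<nu> (A \<inter> Y) + emeasure \<nu> (A \<inter> - Y) = emeasure \<nu> A" if "A \<in> sets borel" for A
    using that nu(2) by (subst plus_emeasure) (auto simp: Int_Un_distrib[symmetric])
  have ga: "emeasure \<gamma> A + emeasure \<alpha> A = emeasure \<mu> A" if A: "A \<in> sets borel" for A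
  proof -
    have "emeasure \<nu> (A \<inter> Y) + (emeasure \<mu> (A \<inter> Y) - emeasure \<nu> (A \<inter> Y)) = emeasure \<mu> (A \<inter> Y)"
      using Y1[of "A \<inter> Y"] A mu(2) by (intro add_diff_inverse_ennreal) auto
    then show ?thesis unfolding ea[OF A] eg[OF A] split_mu[OF A, symmetric] by (metis add.assoc add.commute)
  qed
  have gb: "emeasure \<gamma> A + emeasure \<beta> A = emeasure \<nu> A" if A: "A \<in> sets borel" for A
  proof -
    have "emeasure \<mu> (A \<inter> - Y) + (emeasure \<nu> (A \<inter> - Y) - emeasure \<mu> (A \<inter> - Y)) = emeasure \<nu> (A \<inter> - Y)"
      using Y2[of "A \<inter> - Y"] A mu(2) by (intro add_diff_inverse_ennreal) auto
    then show ?thesis unfolding eb[OF A] eg[OF A] split_nu[OF A, symmetric] by (metis add.assoc)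
  qed
  have a_le: "emeasure \<alpha> A \<le> emeasure \<mu> A" and b_le: "emeasure \<beta> A \<le> emeasure \<nu> A" for A
  proof -
    show "emeasure \<alpha> A \<le> emeasure \<mu> A"
    proof (cases "A \<in> sets borel")
      case True
      show ?thesis unfolding ga[OF True, symmetric] by simp
    qed (simp add: emeasure_notin_sets)
    show "emeasure \<beta> A \<le> emeasure \<nu> A"
    proof (cases "A \<in> sets borel")
      case True
      show ?thesis unfolding gb[OF True, symmetric] by simp
    qed (simp add: emeasure_notin_sets)
  qed
  have fina: "finite_measure \<alpha>" and finb: "finite_measure \<beta>"
    using a_le[of UNIV] b_le[of UNIV] mu.emeasure_finite[of UNIV] nu.emeasure_finite[of UNIV]
    by (auto intro!: finite_measureI simp: top_unique)
  interpret a: finite_measure \<alpha> by fact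
  interpret b: finite_measure \<beta> by fact
  interpret ab: pair_sigma_finite \<alpha> \<beta> ..
  define \<delta> where "\<delta> = emeasure \<alpha> UNIV"
  have mass_b: "emeasure \<beta> UNIV = \<delta>"
  proof -
    have g_fin: "emeasure \<gamma> UNIV \<noteq> top"
    proof
      assume "emeasure \<gamma> UNIV = top"
      then have "emeasure \<mu> UNIV = top" using ga[of UNIV] by simp
      then show False using mu.emeasure_finite[of UNIV] by simp
    qed
    have "emeasure \<gamma> UNIV + emeasure \<alpha> UNIV = emeasure \<gamma> UNIV + emeasure \<beta> UNIV"
      using ga[of UNIV] gb[of UNIV] mu.emeasure_space_1 nu.emeasure_space_1 sp by simp
    then show ?thesis using g_fin unfolding \<delta>_def by (simp add: ennreal_add_left_cancel)
  qed
  have d_fin: "\<delta> \<noteq> top" unfolding \<delta>_def using a.emeasure_finite by simp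
  \<comment> \<open>For \<delta> = 0 the left side is 0 whatever \<open>X\<close> is, so
    cancellation is only an inequality in general. This suffices for the cost; the marginals need
    equality, which holds when \<open>X\<close> is at most \<delta>.\<close>
  have canc: "inverse \<delta> * (\<delta> * X) \<le> X" for X
  proof (cases "\<delta> = 0")
    case False
    then have "inverse \<delta> * \<delta> = 1" using ennreal_divide_self[of \<delta>] d_fin by (simp add: divide_ennreal_def less_top mult.commute)
    then show ?thesis by (simp add: mult.assoc[symmetric])
  qed simp
  have canc_eq: "inverse \<delta> * (\<delta> * X) = X" if "X \<le> \<delta>" for X
  proof (cases "\<delta> = 0")
    case True then show ?thesis using that by simp
  next
    case False
    then have "inverse \<delta> * \<delta> = 1" using ennreal_divide_self[of \<delta>] d_fin by (simp add: divide_ennreal_def less_top mult.commute)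
    then show ?thesis by (simp add: mult.assoc[symmetric])
  qed
  define D where "D = distr \<gamma> (borel \<Otimes>\<^sub>M borel) (\<lambda>x. (x, x))"
  define P where "P = scale_measure (inverse \<delta>) (\<alpha> \<Otimes>\<^sub>M \<beta>)"
  define \<pi> where "\<pi> = add_measure D P"
  have sDP: "sets P = sets D" "sets D = sets (borel \<Otimes>\<^sub>M borel)"
    unfolding D_def P_def by (auto intro!: sets_pair_measure_cong)
  have spi[measurable_cong]: "sets \<pi> = sets (borel \<Otimes>\<^sub>M borel)" using sDP by (simp add: \<pi>_def)
  have spp: "space \<pi> = UNIV" using sets_eq_imp_space_eq[OF spi] by (simp add: space_pair_measure)
  have rect: "emeasure \<pi> (A \<times> B) = emeasure \<gamma> (A \<inter> B) + inverse \<delta> * (emeasure \<alpha> A * emeasure \<beta> B)"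
    if A: "A \<in> sets borel" and B: "B \<in> sets borel" for A B
  proof -
    have "emeasure \<pi> (A \<times> B) = emeasure D (A \<times> B) + emeasure P (A \<times> B)"
      unfolding \<pi>_def using A B sDP by (intro emeasure_add_measure) auto
    also have "emeasure D (A \<times> B) = emeasure \<gamma> (A \<inter> B)"
      unfolding D_def using A B by (subst emeasure_distr) (auto intro!: arg_cong[where f="emeasure \<gamma>"])
    also have "emeasure P (A \<times> B) = inverse \<delta> * (emeasure \<alpha> A * emeasure \<beta> B)"
      unfolding P_def using A B by (simp add: b.emeasure_pair_measure_Times)
    finally show ?thesis .
  qed
  have a_d: "emeasure \<alpha> A \<le> \<delta>" and b_d: "emeasure \<beta> A \<le> \<delta>" for A
    using emeasure_space[of \<alpha> A] emeasure_space[of \<beta> A] mass_b by (auto simp: \<delta>_def)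
  have m1: "distr \<pi> borel fst = \<mu>"
  proof (rule measure_eqI)
    fix A assume "A \<in> sets (distr \<pi> borel fst)"
    then have A: "A \<in> sets borel" by simp
    have "emeasure (distr \<pi> borel fst) A = emeasure \<pi> (A \<times> UNIV)"
      using A by (subst emeasure_distr) (auto simp: spp intro!: arg_cong[where f="emeasure \<pi>"])
    also have "\<dots> = emeasure \<gamma> A + inverse \<delta> * (\<delta> * emeasure \<alpha> A)"
      using rect[OF A, of UNIV] by (simp add: mass_b mult.commute)
    finally show "emeasure (distr \<pi> borel fst) A = emeasure \<mu> A"
      using canc_eq[OF a_d] ga[OF A] by simp
  qed (simp add: mu(2))
  have m2: "distr \<pi> borel snd = \<nu>"
  proof (rule measure_eqI)
    fix A assume "A \<in> sets (distr \<pi> borel snd)"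
    then have A: "A \<in> sets borel" by simp
    have "emeasure (distr \<pi> borel snd) A = emeasure \<pi> (UNIV \<times> A)"
      using A by (subst emeasure_distr) (auto simp: spp intro!: arg_cong[where f="emeasure \<pi>"])
    also have "\<dots> = emeasure \<gamma> A + inverse \<delta> * (\<delta> * emeasure \<beta> A)"
      using rect[of UNIV A] A by (simp add: \<delta>_def)
    finally show "emeasure (distr \<pi> borel snd) A = emeasure \<nu> A"
      using canc_eq[OF b_d] gb[OF A] by simp
  qed (simp add: nu(2))
  have "prob_space \<pi>"
  proof (rule prob_spaceI)
    have "emeasure \<pi> UNIV = emeasure (distr \<pi> borel fst) UNIV"
      by (subst emeasure_distr) (auto simp: spp)
    then show "emeasure \<pi> (space \<pi>) = 1" using mu.emeasure_space_1 sp by (simp add: m1 spp)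
  qed
  then have coup: "\<pi> \<in> couplings \<mu> \<nu>" using spi m1 m2 by (simp add: couplings_def)
  define c :: "'a \<times> 'a \<Rightarrow> ennreal" where
    "c p = indicator {p. fst p \<noteq> snd p} p * ennreal (2 + V (fst p) + V (snd p))" for p
  have diag[measurable]: "{p :: 'a \<times> 'a. fst p \<noteq> snd p} \<in> sets (borel \<Otimes>\<^sub>M borel)"
    unfolding borel_prod by (intro borel_open open_Collect_neq continuous_intros)
  have cm[measurable]: "c \<in> borel_measurable (borel \<Otimes>\<^sub>M borel)" unfolding c_def by measurable
  define g where "g x = ennreal (1 + V x)" for x
  have gm[measurable]: "g \<in> borel_measurable borel" unfolding g_def by measurable
  have "(\<integral>\<^sup>+p. c p \<partial>\<pi>) = (\<integral>\<^sup>+p. c p \<partial>D) + (\<integral>\<^sup>+p. c p \<partial>P)"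
    unfolding \<pi>_def using sDP cm by (intro nn_integral_add_measure) (auto cong: measurable_cong_sets)
  also have "(\<integral>\<^sup>+p. c p \<partial>D) = 0"
    unfolding D_def by (subst nn_integral_distr) (auto simp: c_def)
  also have "(\<integral>\<^sup>+p. c p \<partial>P) = inverse \<delta> * (\<integral>\<^sup>+p. c p \<partial>(\<alpha> \<Otimes>\<^sub>M \<beta>))"
    unfolding P_def by (rule nn_integral_scale_measure) measurable
  also have "(\<integral>\<^sup>+p. c p \<partial>(\<alpha> \<Otimes>\<^sub>M \<beta>)) \<le> (\<integral>\<^sup>+p. g (fst p) + g (snd p) \<partial>(\<alpha> \<Otimes>\<^sub>M \<beta>))"
  proof (rule nn_integral_mono)
    fix p
    have "g (fst p) + g (snd p) = ennreal (2 + V (fst p) + V (snd p))"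
      unfolding g_def using Vnn by (subst ennreal_plus[symmetric]) auto
    then show "c p \<le> g (fst p) + g (snd p)" unfolding c_def by (simp add: indicator_def)
  qed
  also have "\<dots> = (\<integral>\<^sup>+x. \<integral>\<^sup>+y. g x + g y \<partial>\<beta> \<partial>\<alpha>)"
    by (subst b.nn_integral_fst[symmetric]) simp_all
  also have "\<dots> = (\<integral>\<^sup>+x. g x * \<delta> + (\<integral>\<^sup>+y. g y \<partial>\<beta>) \<partial>\<alpha>)"
    by (intro nn_integral_cong) (simp add: nn_integral_add mass_b)
  also have "\<dots> = (\<integral>\<^sup>+x. g x \<partial>\<alpha>) * \<delta> + (\<integral>\<^sup>+y. g y \<partial>\<beta>) * \<delta>"
    by (simp add: nn_integral_add nn_integral_multc \<delta>_def)
  also have "inverse \<delta> * ((\<integral>\<^sup>+x. g x \<partial>\<alpha>) * \<delta> + (\<integral>\<^sup>+y. g y \<partial>\<beta>) * \<delta>) \<le> (\<integral>\<^sup>+x. g x \<partial>\<alpha>) + (\<integral>\<^sup>+y. g y \<partial>\<beta>)"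
    using canc[of "(\<integral>\<^sup>+x. g x \<partial>\<alpha>) + (\<integral>\<^sup>+y. g y \<partial>\<beta>)"] by (simp add: distrib_left mult.commute)
  finally have cost: "(\<integral>\<^sup>+p. c p \<partial>\<pi>) \<le> (\<integral>\<^sup>+x. g x \<partial>\<alpha>) + (\<integral>\<^sup>+y. g y \<partial>\<beta>)"
    by (simp add: mult_left_mono)
  \<comment> \<open>Below the level \<open>L\<close> the weight is bounded by \<open>L\<close> and
    the remainder has mass \<delta>; above it the remainder is replaced by the full measure. Doing
    this for both remainders is the source of the factor 2 in 2 * L * d.\<close>
  have trunc: "(\<integral>\<^sup>+x. g x \<partial>M) \<le> ennreal L * \<delta> + (\<integral>\<^sup>+x. g x * indicator {x. L \<le> 1 + V x} x \<partial>N)"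
    if MN: "sets M = sets borel" "sets N = sets borel" "emeasure M UNIV = \<delta>" "\<And>A. emeasure M A \<le> emeasure N A" for M N
  proof -
    note [measurable_cong] = MN(1,2)
    have spM: "space M = UNIV" using sets_eq_imp_space_eq[OF MN(1)] by simp
    have "(\<integral>\<^sup>+x. g x \<partial>M) \<le> (\<integral>\<^sup>+x. ennreal L + g x * indicator {x. L \<le> 1 + V x} x \<partial>M)"
      by (intro nn_integral_mono) (auto simp: g_def indicator_def intro: ennreal_leI)
    also have "\<dots> = ennreal L * \<delta> + (\<integral>\<^sup>+x. g x * indicator {x. L \<le> 1 + V x} x \<partial>M)"
      using MN(3) spM by (subst nn_integral_add) auto
    also have "(\<integral>\<^sup>+x. g x * indicator {x. L \<le> 1 + V x} x \<partial>M) \<le> (\<integral>\<^sup>+x. g x * indicator {x. L \<le> 1 + V x} x \<partial>N)"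
      using MN by (intro nn_integral_mono_measure) (auto simp: le_measure)
    finally show ?thesis by (simp add: add_left_mono)
  qed
  have d_le: "\<delta> \<le> ennreal d"
  proof -
    have "\<delta> = ennreal (measure \<mu> Y) - ennreal (measure \<nu> Y)"
      unfolding \<delta>_def using ea[of UNIV] by (simp add: mu.emeasure_eq_measure nu.emeasure_eq_measure)
    also have "\<dots> = ennreal (measure \<mu> Y - measure \<nu> Y)" by (simp add: ennreal_minus)
    also have "\<dots> \<le> ennreal d" using tv[OF Y] by (intro ennreal_leI) linarith
    finally show ?thesis .
  qed
  have d0: "0 \<le> d" using tv[of "{}"] by simp
  have "dV V \<mu> \<nu> \<le> (\<integral>\<^sup>+p. c p \<partial>\<pi>)"
    unfolding dV_def c_def using coup by (rule INF_lower)
  also note cost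
  also have "(\<integral>\<^sup>+x. g x \<partial>\<alpha>) + (\<integral>\<^sup>+y. g y \<partial>\<beta>) \<le>
      (ennreal L * \<delta> + (\<integral>\<^sup>+x. g x * indicator {x. L \<le> 1 + V x} x \<partial>\<mu>)) +
      (ennreal L * \<delta> + (\<integral>\<^sup>+x. g x * indicator {x. L \<le> 1 + V x} x \<partial>\<nu>))"
    using mu(2) nu(2) a_le b_le mass_b by (intro add_mono trunc) (auto simp: \<delta>_def)
  also have "\<dots> = (ennreal L * \<delta> + ennreal L * \<delta>) + ((\<integral>\<^sup>+x. g x * indicator {x. L \<le> 1 + V x} x \<partial>\<mu>) +
      (\<integral>\<^sup>+x. g x * indicator {x. L \<le> 1 + V x} x \<partial>\<nu>))" by (simp add: ac_simps)
  also have "ennreal L * \<delta> + ennreal L * \<delta> \<le> ennreal L * ennreal d + ennreal L * ennreal d"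
    using d_le by (intro add_mono mult_left_mono) auto
  also have "\<dots> = ennreal (2 * L * d)"
    using L d0 by (simp add: ennreal_mult[symmetric] ennreal_plus[symmetric] del: ennreal_plus)
  finally show ?thesis unfolding g_def by (simp add: add_right_mono)
qed

subsection \<open>Cadlag Feller processes\<close>

lemma frequently_of_less_Limsup:
  fixes X :: "'b \<Rightarrow> 'c::complete_linorder"
  assumes "c < Limsup F X"
  shows "\<exists>\<^sub>F t in F. c < X t"
proof (rule ccontr)
  assume "\<not> ?thesis"
  then have "eventually (\<lambda>t. X t \<le> c) F" by (simp add: not_frequently not_less)
  from Limsup_bounded[OF this] assms show False by simp
qed

text \<open>Otherwise null balls would cover the space, countably many of them by Lindelof. The
  point obtained is the one at which \<open>C2\<close> will be verified.\<close>

lemma prob_space_support_point: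
  fixes \<mu> :: "'a::polish_space measure"
  assumes "prob_space \<mu>" "sets \<mu> = sets borel"
  shows "\<exists>z. \<forall>r>0. 0 < measure \<mu> (ball z r)"
proof (rule ccontr)
  interpret prob_space \<mu> by fact
  assume "\<not> ?thesis"
  then have "\<forall>z. \<exists>r>0. measure \<mu> (ball z r) = 0"
    by (auto simp: zero_less_measure_iff)
  then obtain r where r: "\<And>z. 0 < r z" "\<And>z. measure \<mu> (ball z (r z)) = 0" by metis
  obtain \<F> where F: "\<F> \<subseteq> range (\<lambda>z. ball z (r z))" "countable \<F>" "\<Union>\<F> = \<Union>(range (\<lambda>z. ball z (r z)))"
    using Lindelof[of "range (\<lambda>z. ball z (r z))"] by blast
  have "(\<Union>U\<in>\<F>. U) \<in> null_sets \<mu>"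
    using F(1,2) r assms(2) by (intro null_sets_UN') (auto simp: null_sets_def emeasure_eq_measure)
  moreover have "(\<Union>U\<in>\<F>. U) = space \<mu>"
    using F(3) r(1) sets_eq_imp_space_eq[OF assms(2)] by force
  ultimately show False using emeasure_space_1 by (auto simp: null_sets_def)
qed

text \<open>The process is approximated by ones evaluated on a countable grid of times to the right,
  which are jointly measurable; right continuity of the paths gives the pointwise limit. Joint
  measurability is what permits averaging over time.\<close>

lemma measurable_right_continuous_process:
  fixes Phi :: "real \<Rightarrow> 'w \<Rightarrow> 'a::metric_space"
  assumes meas: "\<And>t. 0 \<le> t \<Longrightarrow> Phi t \<in> borel_measurable M"
    and cont: "\<And>w t. w \<in> space M \<Longrightarrow> 0 \<le> t \<Longrightarrow> continuous (at_right t) (\<lambda>s. Phi s w)"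
  shows "(\<lambda>(s, w). Phi (max 0 s) w) \<in> borel_measurable (borel \<Otimes>\<^sub>M M)"
proof (rule borel_measurable_LIMSEQ_metric)
  \<comment> \<open>A grid point of mesh 1 / (n + 1) strictly to the right of the time: the added 1
    excludes equality, so that convergence takes place within \<open>at_right s\<close>.\<close>
  define q where "q n s = (real (nat \<lfloor>real (Suc n) * max 0 s\<rfloor>) + 1) / real (Suc n)" for n and s :: real
  show "(\<lambda>p. Phi (q n (fst p)) (snd p)) \<in> borel_measurable (borel \<Otimes>\<^sub>M M)" for n
    unfolding q_def
  proof (rule measurable_compose_countable[where g="\<lambda>p. nat \<lfloor>real (Suc n) * max 0 (fst p)\<rfloor>"
        and f="\<lambda>i p. Phi ((real i + 1) / real (Suc n)) (snd p)"])
    show "(\<lambda>p. Phi ((real i + 1) / real (Suc n)) (snd p)) \<in> borel_measurable (borel \<Otimes>\<^sub>M M)" for i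
      by (rule measurable_compose[OF measurable_snd meas]) simp
  qed measurable
  fix p :: "real \<times> 'w" assume p: "p \<in> space (borel \<Otimes>\<^sub>M M)"
  define s where "s = max 0 (fst p)"
  have s0: "0 \<le> s" by (simp add: s_def)
  have bd: "s < q n (fst p)" "q n (fst p) \<le> s + 1 / real (Suc n)" for n
  proof -
    have fl: "real (nat \<lfloor>real (Suc n) * s\<rfloor>) \<le> real (Suc n) * s" "real (Suc n) * s < real (nat \<lfloor>real (Suc n) * s\<rfloor>) + 1"
      using s0 by (auto simp: of_nat_nat)
    show "s < q n (fst p)" unfolding q_def s_def[symmetric] using fl(2) by (simp add: pos_less_divide_eq mult.commute)
    have "real (nat \<lfloor>real (Suc n) * s\<rfloor>) + 1 \<le> (s + 1 / real (Suc n)) * real (Suc n)"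
    proof -
      have "(s + 1 / real (Suc n)) * real (Suc n) = real (Suc n) * s + 1" by (simp add: field_simps)
      then show ?thesis using fl(1) by linarith
    qed
    then show "q n (fst p) \<le> s + 1 / real (Suc n)" unfolding q_def s_def[symmetric]
      by (simp add: pos_divide_le_eq)
  qed
  have "(\<lambda>n. q n (fst p)) \<longlonglongrightarrow> s"
  proof (rule tendsto_sandwich[of "\<lambda>_. s" _ _ "\<lambda>n. s + 1 / real (Suc n)"])
    show "(\<lambda>n. s + 1 / real (Suc n)) \<longlonglongrightarrow> s"
      using tendsto_add[OF tendsto_const[of s] LIMSEQ_Suc[OF lim_1_over_n]] by simp
  qed (use bd in \<open>auto intro!: always_eventually less_imp_le\<close>)
  then have "filterlim (\<lambda>n. q n (fst p)) (at_right s) sequentially"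
    using bd(1) less_imp_neq[OF bd(1), symmetric] by (auto simp: filterlim_at)
  moreover have "((\<lambda>u. Phi u (snd p)) \<longlongrightarrow> Phi s (snd p)) (at_right s)"
    using cont[of "snd p" s] p s0 by (auto simp: continuous_within space_pair_measure)
  ultimately have "(\<lambda>n. Phi (q n (fst p)) (snd p)) \<longlonglongrightarrow> Phi s (snd p)"
    by (rule filterlim_compose[rotated])
  then show "(\<lambda>n. Phi (q n (fst p)) (snd p)) \<longlonglongrightarrow> (case p of (s, w) \<Rightarrow> Phi (max 0 s) w)"
    by (simp add: s_def split_def)
qed

lemma feller_semigroup_kernel:
  fixes M :: "'w measure" and Pr :: "'a::polish_space \<Rightarrow> 'w measure"
  assumes proc: "cadlag_feller_markov M Pr Phi"
  shows "feller_semigroup (\<lambda>s x. kernel Pr Phi (max 0 s) x)"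
proof -
  have prob: "prob_space (Pr x)" and sets_Pr[measurable_cong]: "sets (Pr x) = sets M" for x
    using proc by (auto simp: cadlag_feller_markov_def)
  have sp: "space (Pr x) = space M" for x using sets_eq_imp_space_eq[OF sets_Pr] .
  have Phim: "Phi t \<in> borel_measurable M" if "0 \<le> t" for t
    using proc that by (auto simp: cadlag_feller_markov_def)
  have Phim': "Phi t \<in> borel_measurable (Pr x)" if "0 \<le> t" for t x
    using Phim[OF that] by (simp cong: measurable_cong_sets add: sets_Pr)
  have joint: "(\<lambda>(s, w). Phi (max 0 s) w) \<in> borel_measurable (borel \<Otimes>\<^sub>M M)"
    using proc by (intro measurable_right_continuous_process) (auto simp: cadlag_feller_markov_def)
  have Prm: "Pr \<in> borel \<rightarrow>\<^sub>M subprob_algebra M"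
    using proc prob sets_Pr
    by (intro measurable_subprob_algebra) (auto simp: cadlag_feller_markov_def prob_space_imp_subprob_space)
  have j2: "case_prod (\<lambda>p w. Phi (max 0 (fst p)) w) \<in> (borel \<Otimes>\<^sub>M borel) \<Otimes>\<^sub>M M \<rightarrow>\<^sub>M borel"
    using measurable_compose[OF _ joint, of "\<lambda>p. (fst (fst p), snd p)" "(borel \<Otimes>\<^sub>M borel) \<Otimes>\<^sub>M M"] by (simp add: split_def)
  have Km: "(\<lambda>(s, x). kernel Pr Phi (max 0 s) x) \<in> borel \<Otimes>\<^sub>M borel \<rightarrow>\<^sub>M subprob_algebra borel"
    using measurable_distr2[OF j2 measurable_compose[OF measurable_snd Prm]]
    by (simp add: kernel_def split_def)
  have Kprob: "prob_space (kernel Pr Phi (max 0 s) x)" for s x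
    unfolding kernel_def using prob Phim' by (intro prob_space.prob_space_distr) auto
  have K1: "kernel Pr Phi t \<in> borel \<rightarrow>\<^sub>M subprob_algebra borel" if "0 \<le> t" for t
    using measurable_compose[OF _ Km, of "\<lambda>x. (t, x)" borel] that by simp
  have add: "kernel Pr Phi (max 0 (s + t)) x = kernel Pr Phi (max 0 s) x \<bind> kernel Pr Phi (max 0 t)"
    if st: "0 \<le> s" "0 \<le> t" for s t x
  proof -
    have K1': "kernel Pr Phi t \<in> kernel Pr Phi s x \<rightarrow>\<^sub>M subprob_algebra borel"
      using K1[OF st(2)] by (simp cong: measurable_cong_sets add: kernel_def)
    have ne: "space (kernel Pr Phi s x) \<noteq> {}" by (simp add: kernel_def)
    have "kernel Pr Phi (s + t) x = kernel Pr Phi s x \<bind> kernel Pr Phi t"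
    proof (rule measure_eqI)
      show eqs: "sets (kernel Pr Phi (s + t) x) = sets (kernel Pr Phi s x \<bind> kernel Pr Phi t)"
        using sets_bind[OF _ ne, of "kernel Pr Phi t" borel] by (simp add: kernel_def)
      fix A assume "A \<in> sets (kernel Pr Phi (s + t) x)"
      then have A: "A \<in> sets borel" by (simp add: kernel_def)
      \<comment> \<open>With the whole space as conditioning event, the Markov property becomes the
        Chapman-Kolmogorov equation.\<close>
      have "space M \<in> natural_filtration M Phi s"
        unfolding natural_filtration_def by (rule sigma_sets_top)
      then have "emeasure (Pr x) (space M \<inter> Phi (s + t) -` A) =
          (\<integral>\<^sup>+ \<omega>. indicator (space M) \<omega> * emeasure (kernel Pr Phi t (Phi s \<omega>)) A \<partial>Pr x)"
        using proc st A unfolding cadlag_feller_markov_def by blast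
      also have "\<dots> = (\<integral>\<^sup>+ \<omega>. emeasure (kernel Pr Phi t (Phi s \<omega>)) A \<partial>Pr x)"
        by (intro nn_integral_cong) (simp add: sp)
      also have "\<dots> = (\<integral>\<^sup>+ y. emeasure (kernel Pr Phi t y) A \<partial>kernel Pr Phi s x)"
        unfolding kernel_def[of Pr Phi s x]
        using measurable_compose[OF K1[OF st(2)] measurable_emeasure_subprob_algebra[OF A]] Phim'[OF st(1)]
        by (subst nn_integral_distr) auto
      also have "\<dots> = emeasure (kernel Pr Phi s x \<bind> kernel Pr Phi t) A"
        using ne K1' A by (rule emeasure_bind[symmetric])
      finally show "emeasure (kernel Pr Phi (s + t) x) A = emeasure (kernel Pr Phi s x \<bind> kernel Pr Phi t) A"
        unfolding kernel_def[of Pr Phi "s + t"] using A st Phim'[of "s + t" x]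
        by (simp add: emeasure_distr sp Int_commute)
    qed
    then show ?thesis using st by (simp add: max_def)
  qed
  have cont: "continuous_on UNIV (\<lambda>x. integral\<^sup>L (kernel Pr Phi (max 0 t) x) f)"
    if t: "0 \<le> t" and fc: "continuous_on UNIV f" and f: "f \<in> unit_fun" for t f
  proof -
    have "bounded (range f)"
      using unit_funD(2,3)[OF f] by (auto simp: bounded_iff intro!: exI[of _ 1])
    then show ?thesis
      using proc t fc by (simp add: cadlag_feller_markov_def max_def)
  qed
  show ?thesis
    by (intro feller_semigroup.intro markov_semigroup.intro feller_semigroup_axioms.intro)
       (fact Km Kprob add cont)+
qed

locale weighted_feller_process =
  fixes M :: "'w measure" and Pr :: "'a::polish_space \<Rightarrow> 'w measure"
    and Phi :: "real \<Rightarrow> 'w \<Rightarrow> 'a" and V :: "'a \<Rightarrow> real"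
  assumes proc: "cadlag_feller_markov M Pr Phi"
    and Vnn: "\<And>x. 0 \<le> V x" and Vcont: "continuous_on UNIV V"
    and H2: "H2 Pr Phi (Ffam V)"

sublocale weighted_feller_process \<subseteq> feller_semigroup "\<lambda>s x. kernel Pr Phi (max 0 s) x"
  using proc by (rule feller_semigroup_kernel)

context weighted_feller_process
begin

section \<open>The weight \<open>1 + V\<close> and uniform integrability\<close>

lemma V_measurable [measurable]: "V \<in> borel_measurable borel"
  using Vcont by (rule borel_measurable_continuous_onI)

text \<open>Through this inclusion, eventual continuity with respect to the weighted family controls
  total variation.\<close>

lemma unit_fun_Ffam: "f \<in> unit_fun \<Longrightarrow> f \<in> Ffam V"
proof -
  assume f: "f \<in> unit_fun"
  have "\<bar>f x\<bar> \<le> 1 + V x" for x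
    using unit_funD(2,3)[OF f, of x] Vnn[of x] by simp
  then show ?thesis using unit_funD(1)[OF f] by (simp add: Ffam_def)
qed

text \<open>The weight is 1 + V because the coupling cost off the diagonal is (1 + V(x)) + (1 +
  V(y)); this is the tail term of \<open>dV_le_tails\<close>.\<close>

definition tail :: "'a measure \<Rightarrow> real \<Rightarrow> ennreal" where
  "tail \<mu> L = (\<integral>\<^sup>+y. ennreal (1 + V y) * indicator {y. L \<le> 1 + V y} y \<partial>\<mu>)"

lemma tail_integrand_measurable [measurable]:
  "(\<lambda>y. ennreal (1 + V y) * indicator {y. L \<le> 1 + V y} y) \<in> borel_measurable borel"
  by measurable

text \<open>The function 1 + V belongs to \<open>Ffam V\<close>, so the dominating function in
  \<open>H2\<close> bounds it, and the tails of that function bound those of 1 + V uniformly in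
  time. Averages over time obey the same bound.\<close>

lemma cesaro_tails:
  "\<exists>\<tau>. (\<tau> \<longlongrightarrow> 0) at_top \<and> (\<forall>t>0. \<forall>L. tail (cesaro t x) L \<le> \<tau> L)"
proof -
  from H2 obtain Vt where Vt: "Vt \<in> classA Pr Phi" "\<And>f x. f \<in> Ffam V \<Longrightarrow> \<bar>f x\<bar> \<le> Vt x"
      "unif_integrable_along Pr Phi Vt x"
    unfolding H2_def by blast
  define \<tau> where "\<tau> L = (SUP t\<in>{0..}. \<integral>\<^sup>+ \<omega>. ennreal \<bar>Vt (Phi t \<omega>)\<bar> *
         indicator {\<omega>. \<bar>Vt (Phi t \<omega>)\<bar> \<ge> L} \<omega> \<partial>Pr x)" for L :: real
  have lim: "(\<tau> \<longlongrightarrow> 0) at_top" using Vt(3) unfolding unif_integrable_along_def \<tau>_def .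
  have "(\<lambda>x. 1 + V x) \<in> Ffam V" using Vnn by (auto simp: Ffam_def)
  from Vt(2)[OF this] have Vle: "1 + V y \<le> \<bar>Vt y\<bar>" for y
    by (meson abs_ge_self order_trans)
  have K_tail: "tail (kernel Pr Phi (max 0 s) x) L \<le> \<tau> L" for s L
  proof -
    have Ph: "Phi (max 0 s) \<in> borel_measurable (Pr x)"
      using proc by (auto simp: cadlag_feller_markov_def cong: measurable_cong_sets)
    have "tail (kernel Pr Phi (max 0 s) x) L =
        (\<integral>\<^sup>+\<omega>. ennreal (1 + V (Phi (max 0 s) \<omega>)) * indicator {y. L \<le> 1 + V y} (Phi (max 0 s) \<omega>) \<partial>Pr x)"
      unfolding tail_def kernel_def using Ph tail_integrand_measurable by (subst nn_integral_distr) auto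
    also have "\<dots> \<le> (\<integral>\<^sup>+ \<omega>. ennreal \<bar>Vt (Phi (max 0 s) \<omega>)\<bar> *
         indicator {\<omega>. \<bar>Vt (Phi (max 0 s) \<omega>)\<bar> \<ge> L} \<omega> \<partial>Pr x)"
    proof (rule nn_integral_mono)
      fix \<omega>
      show "ennreal (1 + V (Phi (max 0 s) \<omega>)) * indicator {y. L \<le> 1 + V y} (Phi (max 0 s) \<omega>)
          \<le> ennreal \<bar>Vt (Phi (max 0 s) \<omega>)\<bar> * indicator {\<omega>. \<bar>Vt (Phi (max 0 s) \<omega>)\<bar> \<ge> L} \<omega>"
        using Vle[of "Phi (max 0 s) \<omega>"] by (auto simp: indicator_def intro!: ennreal_leI)
    qed
    also have "\<dots> \<le> \<tau> L" unfolding \<tau>_def by (intro SUP_upper) simp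
    finally show ?thesis .
  qed
  have "tail (cesaro t x) L \<le> \<tau> L" if t: "0 < t" for t L
  proof -
    interpret U: prob_space "unif_time t" using t by (rule prob_space_unif_time)
    have "tail (cesaro t x) L = (\<integral>\<^sup>+s. tail (kernel Pr Phi (max 0 s) x) L \<partial>unif_time t)"
      unfolding tail_def cesaro_def by (rule nn_integral_bind[where B=borel]) measurable
    also have "\<dots> \<le> (\<integral>\<^sup>+s. \<tau> L \<partial>unif_time t)"
      by (intro nn_integral_mono K_tail)
    also have "\<dots> = \<tau> L" using U.emeasure_space_1 by simp
    finally show ?thesis .
  qed
  then show ?thesis using lim by blast
qed

lemma Ffam_integrable:
  assumes N: "prob_space N" "sets N = sets borel" and tl: "tail N L < \<infinity>" and f: "f \<in> Ffam V"
  shows "integrable N f"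
proof (rule integrableI_bounded)
  interpret prob_space N by fact
  note [measurable_cong] = N(2)
  show "f \<in> borel_measurable N"
    using f N(2) by (auto simp: Ffam_def cong: measurable_cong_sets)
  have "(\<integral>\<^sup>+x. ennreal (norm (f x)) \<partial>N) \<le> (\<integral>\<^sup>+x. ennreal \<bar>L\<bar> + ennreal (1 + V x) * indicator {y. L \<le> 1 + V y} x \<partial>N)"
  proof (rule nn_integral_mono)
    fix x
    have "\<bar>f x\<bar> \<le> 1 + V x" using f by (simp add: Ffam_def)
    then show "ennreal (norm (f x)) \<le> ennreal \<bar>L\<bar> + ennreal (1 + V x) * indicator {y. L \<le> 1 + V y} x"
      by (cases "L \<le> 1 + V x") (auto intro!: ennreal_leI add_increasing)
  qed
  also have "\<dots> = ennreal \<bar>L\<bar> + tail N L"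
    unfolding tail_def using emeasure_space_1 by (subst nn_integral_add) auto
  also have "\<dots> < \<infinity>" using tl by simp
  finally show "(\<integral>\<^sup>+x. ennreal (norm (f x)) \<partial>N) < \<infinity>" .
qed

lemma cesaro_Ffam_integrable:
  assumes t: "0 < t" and f: "f \<in> Ffam V"
  shows "integrable (cesaro t x) f"
proof -
  obtain \<tau> where tau: "(\<tau> \<longlongrightarrow> 0) at_top" "\<And>t L. 0 < t \<Longrightarrow> tail (cesaro t x) L \<le> \<tau> L"
    using cesaro_tails[of x] by blast
  have "eventually (\<lambda>L. \<tau> L < 1) at_top" using order_tendstoD(2)[OF tau(1), of 1] by simp
  then obtain L where "\<tau> L < 1" by (auto simp: eventually_at_top_linorder)
  with tau(2)[OF t, of L] have "tail (cesaro t x) L < 1" by (rule le_less_trans)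
  then have "tail (cesaro t x) L < \<infinity>" by (rule less_trans) simp
  then show ?thesis by (rule Ffam_integrable[OF prob_space_cesaro[OF t] sets_cesaro _ f])
qed

section \<open>Agreement of the stated notions with those of the semigroup\<close>

lemma Qt_eq:
  assumes t: "0 < t" and f: "f \<in> Ffam V"
  shows "Qt Pr Phi t f x = Qf t f x"
proof -
  have fm: "f \<in> borel_measurable borel" using f by (simp add: Ffam_def)
  have "(LBINT s=0..t. Pt Pr Phi s f x) = (LBINT s:{0<..<t}. Pt Pr Phi s f x)"
    using t by (simp add: interval_lebesgue_integral_def zero_ereal_def)
  also have "\<dots> = (LBINT s:{0<..<t}. integral\<^sup>L (kernel Pr Phi (max 0 s) x) f)"
    by (intro set_lebesgue_integral_cong) (auto simp: Pt_def)
  finally show ?thesis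
    unfolding Qt_def integral_cesaro[OF fm cesaro_Ffam_integrable[OF t f]]
    using t by (subst integral_unif_time) (auto intro: K_time_measurable(1)[OF fm])
qed

lemma Qset_eq:
  assumes t: "0 < t" and B: "B \<in> sets borel"
  shows "Qset Pr Phi t x B = measure (cesaro t x) B"
proof -
  have "Qset Pr Phi t x B = Qt Pr Phi t (indicator B) x"
    unfolding Qset_def Qt_def Pt_def using B by (simp add: kernel_def)
  also have "\<dots> = Qf t (indicator B) x"
    using t B by (intro Qt_eq unit_fun_Ffam indicator_unit_fun)
  finally show ?thesis using B by simp
qed

lemma Qmeasure_eq:
  assumes t: "0 < t"
  shows "Qmeasure Pr Phi t x = cesaro t x"
proof -
  interpret prob_space "cesaro t x" using t by (rule prob_space_cesaro)
  have "Qmeasure Pr Phi t x = measure_of UNIV (sets borel) (emeasure (cesaro t x))"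
    unfolding Qmeasure_def using t
    by (intro measure_of_eq) (auto simp: Qset_eq emeasure_eq_measure sets.sigma_sets_eq[of borel, simplified])
  also have "\<dots> = cesaro t x"
    using measure_of_of_measure[of "cesaro t x"] by simp
  finally show ?thesis .
qed

lemma invariant_prob_iff: "invariant_prob Pr Phi \<mu> \<longleftrightarrow> invariant \<mu>"
proof -
  have "(\<forall>B\<in>sets borel. (\<integral>\<^sup>+ x. emeasure (kernel Pr Phi t x) B \<partial>\<mu>) = emeasure \<mu> B) \<longleftrightarrow>
      \<mu> \<bind> kernel Pr Phi (max 0 t) = \<mu>" (is "?l \<longleftrightarrow> ?r")
    if p: "prob_space \<mu>" and s: "sets \<mu> = sets borel" and t: "0 \<le> t" for t
  proof -
    have mt: "max 0 t = t" using t by simp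
    have ne: "space \<mu> \<noteq> {}" using p by (simp add: prob_space.not_empty)
    have m: "kernel Pr Phi t \<in> \<mu> \<rightarrow>\<^sub>M subprob_algebra borel"
      using K_meas2[of t] s mt by (simp cong: measurable_cong_sets)
    have e: "emeasure (\<mu> \<bind> kernel Pr Phi t) B = (\<integral>\<^sup>+ x. emeasure (kernel Pr Phi t x) B \<partial>\<mu>)"
      if "B \<in> sets borel" for B
      using ne m that by (rule emeasure_bind)
    have sb: "sets (\<mu> \<bind> kernel Pr Phi t) = sets borel"
      using ne by (intro sets_bind) (auto simp: kernel_def)
    show ?thesis unfolding mt
    proof
      assume l: ?l
      show "\<mu> \<bind> kernel Pr Phi t = \<mu>"
      proof (rule measure_eqI)
        show "sets (\<mu> \<bind> kernel Pr Phi t) = sets \<mu>" using sb s by (rule trans[OF _ sym])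
        fix B assume "B \<in> sets (\<mu> \<bind> kernel Pr Phi t)"
        then have "B \<in> sets borel" unfolding sb .
        then show "emeasure (\<mu> \<bind> kernel Pr Phi t) B = emeasure \<mu> B" using e[of B] l by metis
      qed
    next
      assume r: "\<mu> \<bind> kernel Pr Phi t = \<mu>"
      show ?l
      proof
        fix B assume "B \<in> sets (borel :: 'a measure)"
        from e[OF this] show "(\<integral>\<^sup>+ x. emeasure (kernel Pr Phi t x) B \<partial>\<mu>) = emeasure \<mu> B" unfolding r by (rule sym)
      qed
    qed
  qed
  then show ?thesis unfolding invariant_prob_def invariant_def by meson
qed

text \<open>Convergence is known only for bounded functions, so the tail integrand is cut at n + 1
  and rescaled into \<open>unit_fun\<close>. The bound passes to the limit in t for each n, and
  monotone convergence removes the cut. This is how integrability under \<mu> of the functions in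
  \<open>Ffam V\<close> is reached.\<close>

lemma invariant_tail_le:
  assumes inv: "invariant \<mu>" and conv: "\<And>f. f \<in> unit_fun \<Longrightarrow> ((\<lambda>t. Qf t f x) \<longlongrightarrow> integral\<^sup>L \<mu> f) at_top"
    and tau: "\<And>t. 0 < t \<Longrightarrow> tail (cesaro t x) L \<le> \<tau>"
  shows "tail \<mu> L \<le> \<tau>"
proof -
  interpret mu: prob_space \<mu> using inv by (simp add: invariant_def)
  have smu[measurable_cong]: "sets \<mu> = sets borel" using inv by (simp add: invariant_def)
  define w where "w y = (1 + V y) * indicator {y. L \<le> 1 + V y} y" for y
  have wm[measurable]: "w \<in> borel_measurable borel" unfolding w_def by measurable
  have w0: "0 \<le> w y" for y using Vnn[of y] by (simp add: w_def)
  have we: "ennreal (1 + V y) * indicator {y. L \<le> 1 + V y} y = ennreal (w y)" for y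
    by (simp add: w_def indicator_def)
  have bound: "(\<integral>\<^sup>+y. ennreal (min (real (Suc n)) (w y)) \<partial>\<mu>) \<le> \<tau>" for n
  proof -
    define f where "f y = min (real (Suc n)) (w y) / real (Suc n)" for y
    have "f \<in> borel_measurable borel" unfolding f_def by measurable
    then have f: "f \<in> unit_fun" using w0 by (auto simp: unit_fun_def f_def)
    have mf: "min (real (Suc n)) (w y) = real (Suc n) * f y" for y by (simp add: f_def)
    have int: "(\<integral>\<^sup>+y. ennreal (min (real (Suc n)) (w y)) \<partial>N) = ennreal (real (Suc n) * integral\<^sup>L N f)"
      if N: "prob_space N" "sets N = sets borel" for N
    proof -
      have i: "integrable N f" using f N by (rule unit_fun_integrable)
      then have "(\<integral>\<^sup>+y. ennreal (real (Suc n) * f y) \<partial>N) = ennreal (\<integral>y. real (Suc n) * f y \<partial>N)"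
        using unit_funD(2)[OF f] by (intro nn_integral_eq_integral) auto
      then show ?thesis unfolding mf by simp
    qed
    have lim: "((\<lambda>t. ennreal (real (Suc n) * Qf t f x)) \<longlongrightarrow> ennreal (real (Suc n) * integral\<^sup>L \<mu> f)) at_top"
      by (intro tendsto_ennrealI tendsto_mult tendsto_const conv f)
    have "eventually (\<lambda>t. ennreal (real (Suc n) * Qf t f x) \<le> \<tau>) at_top"
      using eventually_gt_at_top[of "0::real"]
    proof eventually_elim
      case (elim t)
      have "ennreal (real (Suc n) * Qf t f x) = (\<integral>\<^sup>+y. ennreal (min (real (Suc n)) (w y)) \<partial>cesaro t x)"
        using int[OF prob_space_cesaro[OF elim] sets_cesaro] by simp
      also have "\<dots> \<le> tail (cesaro t x) L"
        unfolding tail_def we by (intro nn_integral_mono ennreal_leI) simp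
      also have "\<dots> \<le> \<tau>" by (rule tau[OF elim])
      finally show ?case .
    qed
    then have "ennreal (real (Suc n) * integral\<^sup>L \<mu> f) \<le> \<tau>"
      by (rule tendsto_upperbound[OF lim]) simp
    then show ?thesis using int[OF mu.prob_space_axioms smu] by simp
  qed
  have "tail \<mu> L \<le> (\<integral>\<^sup>+y. (SUP n. ennreal (min (real (Suc n)) (w y))) \<partial>\<mu>)"
    unfolding tail_def we
  proof (rule nn_integral_mono)
    fix y
    obtain n :: nat where "w y \<le> real n" using real_arch_simple by blast
    then show "ennreal (w y) \<le> (SUP n. ennreal (min (real (Suc n)) (w y)))"
      by (intro SUP_upper2[of n]) (auto simp: min_def)
  qed
  also have "\<dots> = (SUP n. \<integral>\<^sup>+y. ennreal (min (real (Suc n)) (w y)) \<partial>\<mu>)"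
    by (intro nn_integral_monotone_convergence_SUP) (auto simp: incseq_def le_fun_def intro!: ennreal_leI)
  also have "\<dots> \<le> \<tau>" using bound by (intro SUP_least) auto
  finally show ?thesis .
qed

text \<open>The radius serves all \<open>y\<close> in the ball, but the time from which the bound
  holds may depend on \<open>y\<close>, because the limsup in time is taken before the one in
  space.\<close>

lemma unif_cesaro_ev_contD:
  assumes "unif_cesaro_ev_cont Pr Phi (Ffam V) z" and e: "0 < e"
  shows "\<exists>r>0. \<forall>y\<in>ball z r. eventually (\<lambda>t. \<forall>f\<in>unit_fun. \<bar>Qf t f y - Qf t f z\<bar> \<le> e) at_top"
proof -
  have "Limsup (nhds z) (\<lambda>y. Limsup at_top (\<lambda>t. SUP f\<in>Ffam V. ereal \<bar>Qt Pr Phi t f y - Qt Pr Phi t f z\<bar>)) < ereal e"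
    using assms by (simp add: unif_cesaro_ev_cont_def)
  then have "eventually (\<lambda>y. Limsup at_top (\<lambda>t. SUP f\<in>Ffam V. ereal \<bar>Qt Pr Phi t f y - Qt Pr Phi t f z\<bar>) < ereal e) (nhds z)"
    by (rule Limsup_lessD)
  then obtain r where r: "0 < r" "\<And>y. dist y z < r \<Longrightarrow>
      Limsup at_top (\<lambda>t. SUP f\<in>Ffam V. ereal \<bar>Qt Pr Phi t f y - Qt Pr Phi t f z\<bar>) < ereal e"
    unfolding eventually_nhds_metric by blast
  have "eventually (\<lambda>t. \<forall>f\<in>unit_fun. \<bar>Qf t f y - Qf t f z\<bar> \<le> e) at_top" if "y \<in> ball z r" for y
  proof -
    from that have "dist y z < r" by (simp add: dist_commute)
    from Limsup_lessD[OF r(2)[OF this]] eventually_gt_at_top[of 0]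
    show ?thesis
    proof eventually_elim
      case (elim t)
      show ?case
      proof
        fix f :: "'a \<Rightarrow> real" assume "f \<in> unit_fun"
        then have f: "f \<in> Ffam V" by (rule unit_fun_Ffam)
        have "ereal \<bar>Qt Pr Phi t f y - Qt Pr Phi t f z\<bar> < ereal e"
          using elim(1) f by (rule le_less_trans[rotated, OF _ SUP_upper])
        then show "\<bar>Qf t f y - Qf t f z\<bar> \<le> e" using elim(2) f by (simp add: Qt_eq)
      qed
    qed
  qed
  then show ?thesis using r(1) by blast
qed

lemma C2D:
  assumes C2: "C2 Pr Phi z" and r: "0 < r"
  shows "\<exists>c>0. \<forall>x. \<exists>\<^sub>F t in at_top. c < measure (cesaro t x) (ball z r)"
proof -
  have "0 < (INF x. Limsup at_top (\<lambda>t. ereal (Qset Pr Phi t x (ball z r))))"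
    using C2 r by (simp add: C2_def)
  then obtain c where c: "0 < c" "ereal c < (INF x. Limsup at_top (\<lambda>t. ereal (Qset Pr Phi t x (ball z r))))"
    using ereal_dense2[of 0] by (metis ereal_less(2))
  have "\<exists>\<^sub>F t in at_top. c < measure (cesaro t x) (ball z r)" for x
  proof -
    have "ereal c < Limsup at_top (\<lambda>t. ereal (Qset Pr Phi t x (ball z r)))"
      using c(2) by (rule less_le_trans) (rule INF_lower, simp)
    from frequently_eventually_frequently[OF frequently_of_less_Limsup[OF this] eventually_gt_at_top[of 0]]
    show ?thesis by (rule frequently_elim1) (auto simp: Qset_eq)
  qed
  then show ?thesis using c(1) by blast
qed

text \<open>A time average above \<open>c\<close> forces the integrand to reach \<open>c\<close> at
  some time. The Cesaro lower bound thus becomes one for a single kernel, to which subharmonicity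
  can be applied.\<close>

lemma exists_K_ge_of_cesaro:
  assumes t: "0 < t" and c: "c < measure (cesaro t x) B" and B: "B \<in> sets borel"
  shows "\<exists>s\<ge>0. c \<le> measure (kernel Pr Phi (max 0 s) x) B"
proof (rule ccontr)
  assume no: "\<not> ?thesis"
  interpret U: prob_space "unif_time t" using t by (rule prob_space_unif_time)
  note iB = indicator_unit_fun[OF B]
  have "measure (cesaro t x) B = (\<integral>s. integral\<^sup>L (kernel Pr Phi (max 0 s) x) (indicator B) \<partial>unif_time t)"
    using integral_cesaro[OF unit_funD(1)[OF iB] unit_fun_integrable[OF iB prob_space_cesaro[OF t] sets_cesaro], of x] B
    by simp
  also have "\<dots> \<le> (\<integral>s. c \<partial>unif_time t)"
  proof (rule integral_mono_AE)
    show "integrable (unif_time t) (\<lambda>s. integral\<^sup>L (kernel Pr Phi (max 0 s) x) (indicator B :: 'a \<Rightarrow> real))"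
      using K_time_measurable(1)[OF unit_funD(1)[OF iB], of x] unit_fun_integral_bounds[OF iB prob_K sets_K]
      by (intro U.integrable_const_bound[where B=1] AE_I2) (auto cong: measurable_cong_sets)
    show "AE s in unif_time t. integral\<^sup>L (kernel Pr Phi (max 0 s) x) (indicator B) \<le> c"
      using AE_unif_time[OF t]
    proof eventually_elim
      case (elim s)
      then have "\<not> c \<le> measure (kernel Pr Phi (max 0 s) x) B" using no by auto
      then show ?case using B by (simp add: kernel_def)
    qed
  qed simp
  also have "\<dots> = c" using U.prob_space by simp
  finally show False using c by simp
qed

section \<open>Equivalence of ergodicity and the local conditions\<close>

lemma ergodic_of_local_conditions:
  assumes ucc: "unif_cesaro_ev_cont Pr Phi (Ffam V) z" and C2: "C2 Pr Phi z"
  shows "\<exists>\<mu>. invariant_prob Pr Phi \<mu> \<and> (\<forall>\<nu>. invariant_prob Pr Phi \<nu> \<longrightarrow> \<nu> = \<mu>) \<and>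
             (\<forall>f\<in>Ffam V. integrable \<mu> f) \<and>
             (\<forall>x. ((\<lambda>t. dV V (Qmeasure Pr Phi t x) \<mu>) \<longlongrightarrow> 0) at_top)"
proof -
  have hit: "\<exists>c>0. \<forall>x. \<exists>s\<ge>0. c \<le> measure (kernel Pr Phi (max 0 s) x) (ball z r)" if r: "0 < r" for r
  proof -
    from C2D[OF C2 r] obtain c where c: "0 < c" "\<And>x. \<exists>\<^sub>F t in at_top. c < measure (cesaro t x) (ball z r)" by blast
    have "\<exists>s\<ge>0. c \<le> measure (kernel Pr Phi (max 0 s) x) (ball z r)" for x
    proof -
      from frequently_ex[OF frequently_eventually_frequently[OF c(2)[of x] eventually_gt_at_top[of 0]]]
      obtain t where "0 < t" "c < measure (cesaro t x) (ball z r)" by blast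
      then show ?thesis by (intro exists_K_ge_of_cesaro) auto
    qed
    then show ?thesis using c(1) by blast
  qed
  have merge: "merges x z" for x
    using unif_cesaro_ev_contD[OF ucc] hit by (rule merges_of_local_closeness)
  \<comment> \<open>Here \<open>C2\<close> is used for the process started at \<open>z\<close>
    itself.\<close>
  have "z \<in> recurrent_set z"
    unfolding recurrent_set_def
  proof (intro CollectI allI impI)
    fix r :: real assume "0 < r"
    from C2D[OF C2 this] show "\<exists>c>0. \<exists>\<^sub>F t in at_top. c < measure (cesaro t z) (ball z r)" by blast
  qed
  from invariant_exists[OF this merge] obtain \<mu> where inv: "invariant \<mu>" ..
  interpret mu: prob_space \<mu> using inv by (simp add: invariant_def)
  have smu: "sets \<mu> = sets borel" using inv by (simp add: invariant_def)
  note tv = cesaro_tendsto_invariant[OF merge inv]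
  have conv: "((\<lambda>t. Qf t f x) \<longlongrightarrow> integral\<^sup>L \<mu> f) at_top" if f: "f \<in> unit_fun" for f x
  proof (rule tendstoI)
    fix e :: real assume "0 < e"
    from tv[OF this, of x] show "\<forall>\<^sub>F t in at_top. dist (Qf t f x) (integral\<^sup>L \<mu> f) < e"
      by eventually_elim (use f in \<open>auto simp: dist_real_def\<close>)
  qed
  have uniq: "\<nu> = \<mu>" if "invariant \<nu>" for \<nu>
  proof (rule invariant_unique[OF _ inv that])
    fix x B assume B: "B \<in> sets (borel :: 'a measure)"
    show "((\<lambda>t. Qf t (indicator B) x) \<longlongrightarrow> measure \<mu> B) at_top"
      using conv[OF indicator_unit_fun[OF B], of x] B smu by simp
  qed
  have tails: "\<exists>\<tau>. (\<tau> \<longlongrightarrow> 0) at_top \<and> (\<forall>t>0. \<forall>L. tail (cesaro t x) L \<le> \<tau> L) \<and> (\<forall>L. tail \<mu> L \<le> \<tau> L)" for x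
  proof -
    obtain \<tau> where "(\<tau> \<longlongrightarrow> 0) at_top" and le: "\<And>t L. 0 < t \<Longrightarrow> tail (cesaro t x) L \<le> \<tau> L"
      using cesaro_tails[of x] by blast
    moreover have "tail \<mu> L \<le> \<tau> L" for L using inv conv le by (rule invariant_tail_le)
    ultimately show ?thesis by blast
  qed
  have integ: "integrable \<mu> f" if f: "f \<in> Ffam V" for f
  proof -
    obtain \<tau> where tau: "(\<tau> \<longlongrightarrow> 0) at_top" "\<And>L. tail \<mu> L \<le> \<tau> L" using tails by blast
    have "eventually (\<lambda>L. \<tau> L < 1) at_top" using order_tendstoD(2)[OF tau(1), of 1] by simp
    then obtain L where "\<tau> L < 1" by (auto simp: eventually_at_top_linorder)
    with tau(2)[of L] have "tail \<mu> L < 1" by (rule le_less_trans)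
    then have "tail \<mu> L < \<infinity>" by (rule less_trans) simp
    then show ?thesis by (rule Ffam_integrable[OF mu.prob_space_axioms smu _ f])
  qed
  have dlim: "((\<lambda>t. dV V (Qmeasure Pr Phi t x) \<mu>) \<longlongrightarrow> 0) at_top" for x
  proof (rule tendsto_zero_ennreal)
    fix e :: real assume e: "0 < e"
    obtain \<tau> where tau: "(\<tau> \<longlongrightarrow> 0) at_top" "\<And>t L. 0 < t \<Longrightarrow> tail (cesaro t x) L \<le> \<tau> L" "\<And>L. tail \<mu> L \<le> \<tau> L"
      using tails by blast
    have "eventually (\<lambda>L. \<tau> L < ennreal (e / 4)) at_top"
      using order_tendstoD(2)[OF tau(1), of "ennreal (e/4)"] e by simp
    then have "eventually (\<lambda>L. \<tau> L < ennreal (e / 4) \<and> 1 \<le> L) at_top"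
      using eventually_ge_at_top by (rule eventually_conj)
    then obtain L where L: "\<tau> L < ennreal (e / 4)" "1 \<le> L" by (auto simp: eventually_at_top_linorder)
    \<comment> \<open>With this choice 2 * L * d equals e / 4; two tails of at most e / 4 each bring
      the total to 3 * e / 4.\<close>
    define d where "d = e / (8 * L)"
    have d: "0 < d" using e L(2) by (simp add: d_def)
    from tv[OF d, of x] eventually_gt_at_top[of 0]
    show "\<forall>\<^sub>F t in at_top. dV V (Qmeasure Pr Phi t x) \<mu> < ennreal e"
    proof eventually_elim
      case (elim t)
      have "dV V (Qmeasure Pr Phi t x) \<mu> = dV V (cesaro t x) \<mu>" using elim(2) by (simp add: Qmeasure_eq)
      also have "\<dots> \<le> ennreal (2 * L * d) + (tail (cesaro t x) L + tail \<mu> L)"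
        unfolding tail_def
      proof (rule dV_le_tails[OF V_measurable Vnn prob_space_cesaro[OF elim(2)] sets_cesaro mu.prob_space_axioms smu])
        fix A assume A: "A \<in> sets (borel :: 'a measure)"
        show "\<bar>measure (cesaro t x) A - measure \<mu> A\<bar> \<le> d"
          using elim(1)[rule_format, OF indicator_unit_fun[OF A]] A smu by simp
      qed (use L in simp)
      also have "\<dots> \<le> ennreal (e / 4) + (ennreal (e / 4) + ennreal (e / 4))"
      proof (intro add_mono)
        show "ennreal (2 * L * d) \<le> ennreal (e / 4)" using L(2) by (simp add: d_def)
        show "tail (cesaro t x) L \<le> ennreal (e / 4)" using tau(2)[OF elim(2), of L] L(1) by simp
        show "tail \<mu> L \<le> ennreal (e / 4)" using tau(3)[of L] L(1) by simp
      qed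
      also have "\<dots> = ennreal (3 * e / 4)"
        using e by (simp add: ennreal_plus[symmetric] del: ennreal_plus)
      also have "\<dots> < ennreal e" using e by (simp add: ennreal_less_iff)
      finally show ?case .
    qed
  qed
  show ?thesis
    unfolding invariant_prob_iff using inv uniq integ dlim by (intro exI[of _ \<mu>] conjI ballI allI impI)
qed

lemma local_conditions_of_ergodic:
  assumes inv: "invariant_prob Pr Phi \<mu>" and int: "\<forall>f\<in>Ffam V. integrable \<mu> f"
    and conv: "\<forall>x. ((\<lambda>t. dV V (Qmeasure Pr Phi t x) \<mu>) \<longlongrightarrow> 0) at_top"
  shows "(\<forall>x. unif_cesaro_ev_cont Pr Phi (Ffam V) x) \<and> (\<exists>z. C2 Pr Phi z)"
proof -
  have mu: "prob_space \<mu>" "sets \<mu> = sets borel" using inv by (auto simp: invariant_prob_def)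
  have close: "eventually (\<lambda>t. \<forall>f\<in>Ffam V. \<bar>Qt Pr Phi t f x - integral\<^sup>L \<mu> f\<bar> < e) at_top" if e: "0 < e" for e x
  proof -
    have "eventually (\<lambda>t. dV V (Qmeasure Pr Phi t x) \<mu> < ennreal e) at_top"
      using order_tendstoD(2)[OF conv[rule_format, of x], of "ennreal e"] e by simp
    then show ?thesis using eventually_gt_at_top[of 0]
    proof eventually_elim
      case (elim t)
      show ?case
      proof
        fix f assume f: "f \<in> Ffam V"
        have "ennreal \<bar>Qf t f x - integral\<^sup>L \<mu> f\<bar> \<le> dV V (cesaro t x) \<mu>"
          using f int cesaro_Ffam_integrable[OF elim(2) f] by (intro integral_diff_le_dV Vnn) (auto simp: Ffam_def)
        also have "\<dots> < ennreal e" using elim by (simp add: Qmeasure_eq)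
        finally show "\<bar>Qt Pr Phi t f x - integral\<^sup>L \<mu> f\<bar> < e"
          using e elim(2) f by (simp add: ennreal_less_iff Qt_eq)
      qed
    qed
  qed
  have Lim0: "Limsup at_top (\<lambda>t. SUP f\<in>Ffam V. ereal \<bar>Qt Pr Phi t f y - Qt Pr Phi t f x\<bar>) = 0" (is "Limsup at_top ?S = 0") for x y
  proof (rule antisym)
    show "Limsup at_top ?S \<le> 0"
    proof (rule ereal_le_epsilon2)
      fix e :: real assume e: "0 < e"
      have "Limsup at_top ?S \<le> ereal e"
      proof (rule Limsup_bounded)
        from close[of "e/2" x] close[of "e/2" y] e
        have "\<forall>\<^sub>F t in at_top. \<forall>f\<in>Ffam V. \<bar>Qt Pr Phi t f x - integral\<^sup>L \<mu> f\<bar> < e/2"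
          "\<forall>\<^sub>F t in at_top. \<forall>f\<in>Ffam V. \<bar>Qt Pr Phi t f y - integral\<^sup>L \<mu> f\<bar> < e/2" by auto
        then show "\<forall>\<^sub>F t in at_top. ?S t \<le> ereal e"
        proof eventually_elim
          case (elim t)
          show ?case
          proof (rule SUP_least)
            fix f assume "f \<in> Ffam V"
            with elim have "\<bar>Qt Pr Phi t f x - integral\<^sup>L \<mu> f\<bar> < e/2" "\<bar>Qt Pr Phi t f y - integral\<^sup>L \<mu> f\<bar> < e/2"
              by auto
            then have "\<bar>Qt Pr Phi t f y - Qt Pr Phi t f x\<bar> \<le> e" by linarith
            then show "ereal \<bar>Qt Pr Phi t f y - Qt Pr Phi t f x\<bar> \<le> ereal e" by simp
          qed
        qed
      qed
      then show "Limsup at_top ?S \<le> 0 + ereal e" by simp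
    qed
    \<comment> \<open>The zero function bounds the supremum from below by 0; over an empty family it
      would be minus infinity.\<close>
    have "(\<lambda>_. 0) \<in> Ffam V" using Vnn by (simp add: Ffam_def)
    then have "0 \<le> ?S t" for t
      by (rule SUP_upper2) simp
    then have "Limsup at_top (\<lambda>_::real. 0::ereal) \<le> Limsup at_top ?S"
      by (intro Limsup_mono always_eventually allI)
    then show "0 \<le> Limsup at_top ?S" by (simp add: Limsup_const)
  qed
  have ucc: "unif_cesaro_ev_cont Pr Phi (Ffam V) x" for x
    unfolding unif_cesaro_ev_cont_def Lim0 by (rule Limsup_const) simp
  \<comment> \<open>Q_t(x, B(z, r)) tends to \<mu>(B(z, r)) for every starting point x, so the
    infimum in \<open>C2\<close> equals this number, and it is positive at a support point.\<close>
  obtain z where z: "\<And>r. 0 < r \<Longrightarrow> 0 < measure \<mu> (ball z r)"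
    using prob_space_support_point[OF mu] by blast
  have "C2 Pr Phi z"
    unfolding C2_def
  proof (intro allI impI)
    fix r :: real assume r: "0 < r"
    have "((\<lambda>t. Qset Pr Phi t x (ball z r)) \<longlongrightarrow> measure \<mu> (ball z r)) at_top" for x
    proof (rule tendstoI)
      fix e :: real assume "0 < e"
      from close[OF this, of x] eventually_gt_at_top[of 0]
      show "\<forall>\<^sub>F t in at_top. dist (Qset Pr Phi t x (ball z r)) (measure \<mu> (ball z r)) < e"
      proof eventually_elim
        case (elim t)
        have i: "indicator (ball z r) \<in> Ffam V" by (intro unit_fun_Ffam indicator_unit_fun) simp
        show ?case
          using elim(1)[rule_format, OF i] elim(2) mu(2) by (simp add: dist_real_def Qt_eq[OF _ i] Qset_eq)
      qed
    qed
    then have "Limsup at_top (\<lambda>t. ereal (Qset Pr Phi t x (ball z r))) = ereal (measure \<mu> (ball z r))" for x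
      by (intro lim_imp_Limsup tendsto_ereal) simp
    then show "0 < (INF x. Limsup at_top (\<lambda>t. ereal (Qset Pr Phi t x (ball z r))))"
      using z[OF r] by simp
  qed
  then show ?thesis using ucc by blast
qed

end

theorem mainTheorem8:
  fixes M :: "'w measure" and Pr :: "'a::polish_space \<Rightarrow> 'w measure"
    and Phi :: "real \<Rightarrow> 'w \<Rightarrow> 'a" and V :: "'a \<Rightarrow> real"
  assumes proc: "cadlag_feller_markov M Pr Phi"
    and Vnn: "\<forall>x. V x \<ge> 0" and Vcont: "continuous_on UNIV V"
    and H2: "H2 Pr Phi (Ffam V)"
  shows "((\<exists>\<mu>. invariant_prob Pr Phi \<mu> \<and> (\<forall>\<nu>. invariant_prob Pr Phi \<nu> \<longrightarrow> \<nu> = \<mu>) \<and>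
             (\<forall>f\<in>Ffam V. integrable \<mu> f) \<and>
             (\<forall>x. ((\<lambda>t. dV V (Qmeasure Pr Phi t x) \<mu>) \<longlongrightarrow> 0) at_top))
          \<longleftrightarrow> ((\<forall>x. unif_cesaro_ev_cont Pr Phi (Ffam V) x) \<and> (\<exists>z. C2 Pr Phi z)))
       \<and> (((\<forall>x. unif_cesaro_ev_cont Pr Phi (Ffam V) x) \<and> (\<exists>z. C2 Pr Phi z))
          \<longleftrightarrow> (\<exists>z. unif_cesaro_ev_cont Pr Phi (Ffam V) z \<and> C2 Pr Phi z))"
proof -
  interpret weighted_feller_process M Pr Phi V
    by (rule weighted_feller_process.intro[OF proc Vnn[rule_format] Vcont H2])
  let ?i = "\<exists>\<mu>. invariant_prob Pr Phi \<mu> \<and> (\<forall>\<nu>. invariant_prob Pr Phi \<nu> \<longrightarrow> \<nu> = \<mu>) \<and>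
             (\<forall>f\<in>Ffam V. integrable \<mu> f) \<and>
             (\<forall>x. ((\<lambda>t. dV V (Qmeasure Pr Phi t x) \<mu>) \<longlongrightarrow> 0) at_top)"
  let ?ii = "(\<forall>x. unif_cesaro_ev_cont Pr Phi (Ffam V) x) \<and> (\<exists>z. C2 Pr Phi z)"
  let ?iii = "\<exists>z. unif_cesaro_ev_cont Pr Phi (Ffam V) z \<and> C2 Pr Phi z"
  have "?i" if "?iii" using that ergodic_of_local_conditions by (elim exE conjE)
  moreover have "?ii" if "?i" using that local_conditions_of_ergodic by (elim exE conjE)
  moreover have "?iii" if "?ii" using that by iprover
  ultimately show ?thesis by argo
qed

end
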